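(* Let $a,d\in\mathbb{R}$ and $A_2=\begin{pmatrix} a & 0\\ 1 & d\end{pmatrix}$. The following statements are true. (a) If $ad=0$ then $\mathrm{Spec}(A_2D)=\mathbb{C}$. (b) If $ad\neq 0$ then $\mathrm{Spec}(A_2D)=\{a\pi^2n^2,\ d\pi^2n^2\}_{n=0}^\infty$. (c) If $ad>0$, then for all $\varepsilon>0$ there exists $k_\varepsilon>0$ independent of $z$ such that $$\|(A_2D-z)^{-1}\|\le \frac{k_\varepsilon}{|z|}\qquad\text{for all } z\notin \pm S(-\varepsilon,\varepsilon),$$ where the sign $\pm$ is the sign of $a$. (d) If $ad<0$, then for all $\varepsilon>0$ there exists $k_\varepsilon>0$ independent of $z$ such that $$\|(A_2D-z)^{-1}\|\le \frac{k_\varepsilon}{|z|}\qquad\text{for all } z\notin S(-\varepsilon,\varepsilon)\cup S(-\pi-\varepsilon,-\pi+\varepsilon).$$ (e) If $a=d\neq0$, let $\varepsilon>0$ and $z_r=4a\pi^2r^2\pm i\varepsilon$. Then there exists a constant $k_\varepsilon>0$ independent of $r$ such that $$\|(A_2D-z_r)^{-1}\|\ge k_\varepsilon|z_r|^{1/4}\qquad\text{for all } r=1,2,\ldots.$$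
   Context: Let $W^{2,2}$ be the Sobolev space of all $f\in L^2(0,1)\otimes\mathbb{C}^2$ whose generalized derivative $f''$ lies in $L^2(0,1)\otimes\mathbb{C}^2$, and write $f=\begin{pmatrix}\phi\\ \gamma\end{pmatrix}$. The operator $D$ acts on $L^2(0,1)\otimes\mathbb{C}^2$ by $Df=-f''$ with domain $\mathrm{Dom}(D)=\{f\in W^{2,2}:\phi(0)=\phi(1)=0,\ \gamma'(0)=\gamma'(1)=0\}$. For a constant $2\times2$ matrix $A$, $AD$ is the operator $f\mapsto -Af''$ with domain $\mathrm{Dom}(D)$. $\mathrm{Spec}(K)$ denotes the spectrum of $K$, i.e. the complement of the set of $z$ for which $K-z$ is a bijection from $\mathrm{Dom}(K)$ onto the Hilbert space with bounded inverse (so an operator that is not closed has spectrum $\mathbb{C}$). For real $\alpha\le\beta$, $S(\alpha,\beta)=\{z\in\mathbb{C}:\alpha\le\arg z\le\beta\}$, where $\arg z$ may be any determination of the argument (it is taken modulo $2\pi$) and $0$ is counted as an element of $S(\alpha,\beta)$. $-S(\alpha,\beta)=\{-z:z\in S(\alpha,\beta)\}$. *)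

theory Defs
  imports "HOL-Analysis.Analysis"
begin

section \<open>The Hilbert space \<open>L\<^sup>2(0,1)\<close>\<close>

abbreviation lebesgue01 :: "real measure" where
  "lebesgue01 \<equiv> lebesgue_on {0<..<1}"

definition square_integrable :: "(real \<Rightarrow> complex) \<Rightarrow> bool" where
  "square_integrable f \<longleftrightarrow>
     f \<in> borel_measurable lebesgue01 \<and> integrable lebesgue01 (\<lambda>x. (cmod (f x))\<^sup>2)"

lemma square_integrable_0: "square_integrable (\<lambda>x. 0)"
  by (simp add: square_integrable_def)

lemma square_integrable_mult:
  assumes "square_integrable f"
  shows "square_integrable (\<lambda>x. c * f x)"
  using assms by (auto simp: square_integrable_def norm_mult power_mult_distrib)

lemma square_integrable_add:
  assumes "square_integrable f" "square_integrable g"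
  shows "square_integrable (\<lambda>x. f x + g x)"
proof -
  have [measurable]: "f \<in> borel_measurable lebesgue01" "g \<in> borel_measurable lebesgue01"
    using assms by (auto simp: square_integrable_def)
  have "(cmod (f x + g x))\<^sup>2 \<le> 2 * (cmod (f x))\<^sup>2 + 2 * (cmod (g x))\<^sup>2" for x
  proof -
    have "(cmod (f x + g x))\<^sup>2 \<le> (cmod (f x) + cmod (g x))\<^sup>2"
      by (intro power_mono norm_triangle_ineq norm_ge_zero)
    also have "\<dots> \<le> 2 * (cmod (f x))\<^sup>2 + 2 * (cmod (g x))\<^sup>2"
      using sum_squares_bound[of "cmod (f x)" "cmod (g x)"] by (simp add: power2_sum)
    finally show ?thesis .
  qed
  moreover have "integrable lebesgue01 (\<lambda>x. 2 * (cmod (f x))\<^sup>2 + 2 * (cmod (g x))\<^sup>2)"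
    using assms by (auto simp: square_integrable_def)
  ultimately have "integrable lebesgue01 (\<lambda>x. (cmod (f x + g x))\<^sup>2)"
    by - (rule Bochner_Integration.integrable_bound
        [where f = "\<lambda>x. 2 * (cmod (f x))\<^sup>2 + 2 * (cmod (g x))\<^sup>2"], auto)
  then show ?thesis
    by (auto simp: square_integrable_def)
qed

lemma square_integrable_minus:
  assumes "square_integrable f"
  shows "square_integrable (\<lambda>x. - f x)"
  using square_integrable_mult[OF assms, of "-1"] by simp

lemma square_integrable_diff:
  assumes "square_integrable f" "square_integrable g"
  shows "square_integrable (\<lambda>x. f x - g x)"
  using square_integrable_add[OF assms(1) square_integrable_minus[OF assms(2)]] by simp

lemma integrable_inner_square_integrable:
  assumes "square_integrable f" "square_integrable g"
  shows "integrable lebesgue01 (\<lambda>x. f x \<bullet> g x)"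
proof -
  have [measurable]: "f \<in> borel_measurable lebesgue01" "g \<in> borel_measurable lebesgue01"
    using assms by (auto simp: square_integrable_def)
  have "norm (f x \<bullet> g x) \<le> norm ((cmod (f x))\<^sup>2 + (cmod (g x))\<^sup>2)" for x
  proof -
    have "\<bar>f x \<bullet> g x\<bar> \<le> cmod (f x) * cmod (g x)"
      by (rule Cauchy_Schwarz_ineq2)
    also have "\<dots> \<le> (cmod (f x))\<^sup>2 + (cmod (g x))\<^sup>2"
      using sum_squares_bound[of "cmod (f x)" "cmod (g x)"]
        mult_nonneg_nonneg[OF norm_ge_zero norm_ge_zero, of "f x" "g x"]
      by linarith
    finally show ?thesis by simp
  qed
  moreover have "integrable lebesgue01 (\<lambda>x. (cmod (f x))\<^sup>2 + (cmod (g x))\<^sup>2)"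
    using assms by (auto simp: square_integrable_def)
  ultimately show ?thesis
    by - (rule Bochner_Integration.integrable_bound
        [where f = "\<lambda>x. (cmod (f x))\<^sup>2 + (cmod (g x))\<^sup>2"], auto)
qed

quotient_type L2 = "real \<Rightarrow> complex" / partial:
  "\<lambda>f g. square_integrable f \<and> square_integrable g \<and> (AE x in lebesgue01. f x = g x)"
proof (intro part_equivpI exI[of _ "\<lambda>x. 0"] sympI transpI, goal_cases)
  case 1
  show ?case by (simp add: square_integrable_0)
next
  case (2 f g)
  then show ?case by (auto elim: eventually_mono)
next
  case (3 f g h)
  then show ?case by (auto elim: eventually_elim2)
qed

text \<open>
  As a real inner product space, with inner product the real part of
  \<open>\<integral> f \<cdot> cnj g\<close>; the norm is the usual \<open>L\<^sup>2\<close> norm.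
  Complex multiples are provided by \<open>scaleC\<close> below.
\<close>

instantiation L2 :: real_inner
begin

lift_definition zero_L2 :: L2 is "\<lambda>x. 0"
  by (simp add: square_integrable_0)

lift_definition plus_L2 :: "L2 \<Rightarrow> L2 \<Rightarrow> L2" is "\<lambda>f g x. f x + g x"
  by (auto intro: square_integrable_add elim: eventually_elim2)

lift_definition minus_L2 :: "L2 \<Rightarrow> L2 \<Rightarrow> L2" is "\<lambda>f g x. f x - g x"
  by (auto intro: square_integrable_diff elim: eventually_elim2)

lift_definition uminus_L2 :: "L2 \<Rightarrow> L2" is "\<lambda>f x. - f x"
  by (auto intro: square_integrable_minus elim: eventually_mono)

lift_definition scaleR_L2 :: "real \<Rightarrow> L2 \<Rightarrow> L2" is "\<lambda>r f x. complex_of_real r * f x"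
  by (auto intro: square_integrable_mult elim: eventually_mono)

lift_definition inner_L2 :: "L2 \<Rightarrow> L2 \<Rightarrow> real" is
  "\<lambda>f g. \<integral>x. f x \<bullet> g x \<partial>lebesgue01"
proof (rule integral_cong_AE, goal_cases)
  case (1 f f' g g')
  then have [measurable]: "f \<in> borel_measurable lebesgue01" "g \<in> borel_measurable lebesgue01"
    by (auto simp: square_integrable_def)
  show ?case by measurable
next
  case (2 f f' g g')
  then have [measurable]: "f' \<in> borel_measurable lebesgue01" "g' \<in> borel_measurable lebesgue01"
    by (auto simp: square_integrable_def)
  show ?case by measurable
next
  case (3 f f' g g')
  then show ?case by (auto elim: eventually_elim2)
qed

definition norm_L2 :: "L2 \<Rightarrow> real" where
  "norm_L2 f = sqrt (f \<bullet> f)"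

definition sgn_L2 :: "L2 \<Rightarrow> L2" where
  "sgn_L2 f = inverse (sqrt (f \<bullet> f)) *\<^sub>R f"

definition dist_L2 :: "L2 \<Rightarrow> L2 \<Rightarrow> real" where
  "dist_L2 f g = sqrt ((f - g) \<bullet> (f - g))"

definition uniformity_L2 :: "(L2 \<times> L2) filter" where
  "uniformity_L2 = (INF e\<in>{0<..}. principal {(f, g). sqrt ((f - g) \<bullet> (f - g)) < e})"

definition open_L2 :: "L2 set \<Rightarrow> bool" where
  "open_L2 U \<longleftrightarrow> (\<forall>f\<in>U. eventually (\<lambda>(f', g). f' = f \<longrightarrow> g \<in> U)
     (INF e\<in>{0<..}. principal {(f, g). sqrt ((f - g) \<bullet> (f - g)) < e}))"

instance
proof
  fix f g h :: L2 and r s :: real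
  show "f + g + h = f + (g + h)"
    by transfer (auto intro!: square_integrable_add simp: add.assoc)
  show "f + g = g + f"
    by transfer (auto intro!: square_integrable_add simp: add.commute)
  show "0 + f = f"
    by transfer (auto intro!: square_integrable_add)
  show "- f + f = 0"
    by transfer (auto intro!: square_integrable_0)
  show "f - g = f + - g"
    by transfer (auto intro!: square_integrable_add square_integrable_diff square_integrable_minus)
  show "r *\<^sub>R (f + g) = r *\<^sub>R f + r *\<^sub>R g"
    by transfer (auto intro!: square_integrable_add square_integrable_mult simp: distrib_left)
  show "(r + s) *\<^sub>R f = r *\<^sub>R f + s *\<^sub>R f"
    by transfer (auto intro!: square_integrable_add square_integrable_mult simp: distrib_right)
  show "r *\<^sub>R s *\<^sub>R f = (r * s) *\<^sub>R f"
    by transfer (auto intro!: square_integrable_mult simp: mult.assoc)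
  show "1 *\<^sub>R f = f"
    by transfer auto
  show "f \<bullet> g = g \<bullet> f"
    by transfer (simp add: inner_commute)
  show "(f + g) \<bullet> h = f \<bullet> h + g \<bullet> h"
    by transfer (simp add: inner_add_left integrable_inner_square_integrable)
  show "(r *\<^sub>R f) \<bullet> g = r * (f \<bullet> g)"
    by transfer (simp flip: scaleR_conv_of_real)
  show "0 \<le> f \<bullet> f"
    by transfer simp
  show "f \<bullet> f = 0 \<longleftrightarrow> f = 0"
  proof transfer
    fix f :: "real \<Rightarrow> complex"
    assume "square_integrable f \<and> square_integrable f \<and> (AE x in lebesgue01. f x = f x)"
    then have f: "square_integrable f" by simp
    have "(\<integral>x. f x \<bullet> f x \<partial>lebesgue01) = 0 \<longleftrightarrow> (AE x in lebesgue01. f x \<bullet> f x = 0)"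
      using f by (intro integral_nonneg_eq_0_iff_AE integrable_inner_square_integrable) auto
    then show "(\<integral>x. f x \<bullet> f x \<partial>lebesgue01) = 0 \<longleftrightarrow>
        square_integrable f \<and> square_integrable (\<lambda>x. 0) \<and> (AE x in lebesgue01. f x = 0)"
      using f by (simp add: square_integrable_0)
  qed
qed (unfold norm_L2_def sgn_L2_def dist_L2_def uniformity_L2_def open_L2_def, (rule refl)+)

end

lift_definition scaleC :: "complex \<Rightarrow> L2 \<Rightarrow> L2" is "\<lambda>z f x. z * f x"
  by (auto intro: square_integrable_mult elim: eventually_mono)


section \<open>The space \<open>L\<^sup>2(0,1) \<otimes> \<complex>\<^sup>2\<close>, spectra and resolvents\<close>

text \<open>
  \<open>L\<^sup>2(0,1) \<otimes> \<complex>\<^sup>2\<close> is rendered as \<open>L2^2\<close>, whose norm is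
  \<open>sqrt ((norm (f$1))\<^sup>2 + (norm (f$2))\<^sup>2)\<close>.
\<close>

definition matrix_action :: "complex^2^2 \<Rightarrow> L2^2 \<Rightarrow> L2^2" where
  "matrix_action A f = (\<chi> i. \<Sum>j\<in>UNIV. scaleC (A $ i $ j) (f $ j))"

text \<open>An unbounded operator is its domain together with a map that is relevant only on the domain.\<close>

type_synonym operator = "(L2^2) set \<times> (L2^2 \<Rightarrow> L2^2)"

definition left_mult :: "complex^2^2 \<Rightarrow> operator \<Rightarrow> operator" where
  "left_mult A K = (fst K, \<lambda>f. matrix_action A (snd K f))"

definition shifted :: "operator \<Rightarrow> complex \<Rightarrow> L2^2 \<Rightarrow> L2^2" where
  "shifted K z f = snd K f - (\<chi> i. scaleC z (f $ i))"

text \<open>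
  For a complex linear operator the inverse is automatically complex linear, so boundedness
  is its only content in \<open>bounded_linear\<close> below.
\<close>

definition resolvent :: "operator \<Rightarrow> complex \<Rightarrow> L2^2 \<Rightarrow> L2^2" where
  "resolvent K z = inv_into (fst K) (shifted K z)"

definition resolvent_set :: "operator \<Rightarrow> complex set" where
  "resolvent_set K =
     {z. bij_betw (shifted K z) (fst K) UNIV \<and> bounded_linear (resolvent K z)}"

definition Spec :: "operator \<Rightarrow> complex set" where
  "Spec K = - resolvent_set K"


section \<open>The operator \<open>D\<close>\<close>

text \<open>Test functions are real valued, which is no restriction by linearity.\<close>

definition test_function :: "(real \<Rightarrow> real) \<Rightarrow> bool" where
  "test_function \<psi> \<longleftrightarrow>
     (\<forall>k x. (deriv ^^ k) \<psi> differentiable (at x)) \<and> closure {x. \<psi> x \<noteq> 0} \<subseteq> {0<..<1}"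

definition has_weak_deriv2 :: "L2 \<Rightarrow> L2 \<Rightarrow> bool" where
  "has_weak_deriv2 f g \<longleftrightarrow>
     (\<forall>\<psi>. test_function \<psi> \<longrightarrow>
        (\<integral>x. (deriv ^^ 2) \<psi> x *\<^sub>R rep_L2 f x \<partial>lebesgue01) =
        (\<integral>x. \<psi> x *\<^sub>R rep_L2 g x \<partial>lebesgue01))"

definition weak_deriv2 :: "L2 \<Rightarrow> L2" where
  "weak_deriv2 f = (THE g. has_weak_deriv2 f g)"

definition W22 :: "(L2^2) set" where
  "W22 = {f. \<forall>i. \<exists>g. has_weak_deriv2 (f $ i) g}"

text \<open>
  Boundary values of \<open>f\<close> and \<open>f'\<close> are those of the continuously differentiable
  representative on \<open>[0,1]\<close>, which exists and is unique there whenever the weak second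
  derivative is in \<open>L\<^sup>2\<close>.
\<close>

definition C1_representative :: "L2 \<Rightarrow> (real \<Rightarrow> complex) \<Rightarrow> (real \<Rightarrow> complex) \<Rightarrow> bool" where
  "C1_representative f u u' \<longleftrightarrow>
     (AE x in lebesgue01. rep_L2 f x = u x) \<and>
     (\<forall>x\<in>{0..1}. (u has_vector_derivative u' x) (at x within {0..1})) \<and>
     continuous_on {0..1} u'"

definition Dom_D :: "(L2^2) set" where
  "Dom_D = {f \<in> W22.
     (\<exists>u u'. C1_representative (f $ 1) u u' \<and> u 0 = 0 \<and> u 1 = 0) \<and>
     (\<exists>u u'. C1_representative (f $ 2) u u' \<and> u' 0 = 0 \<and> u' 1 = 0)}"

definition D_op :: operator where
  "D_op = (Dom_D, \<lambda>f. \<chi> i. - weak_deriv2 (f $ i))"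


section \<open>The matrix \<open>A\<^sub>2\<close> and sectors\<close>

definition A2 :: "real \<Rightarrow> real \<Rightarrow> complex^2^2" where
  "A2 a d = vector [vector [complex_of_real a, 0], vector [1, complex_of_real d]]"

definition sector :: "real \<Rightarrow> real \<Rightarrow> complex set" where
  "sector \<alpha> \<beta> = {z. z = 0 \<or> (\<exists>\<theta>. \<alpha> \<le> \<theta> \<and> \<theta> \<le> \<beta> \<and> z = complex_of_real (cmod z) * cis \<theta>)}"

end

theory Submission
  imports Defs
begin

text \<open>
  \<open>K - z\<close> is lower triangular, so everything reduces to the scalar problems \<open>-c u'' - z u = h\<close>
  with Dirichlet (\<open>c = a\<close>) or Neumann (\<open>c = d\<close>) conditions. Off the eigenvalues \<open>c\<pi>\<^sup>2n\<^sup>2\<close> these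
  are solved explicitly by factoring the differential operator. Pairing with \<open>cnj u\<close> gives
  \<open>c \<parallel>u'\<parallel>\<^sup>2 - z \<parallel>u\<parallel>\<^sup>2\<close>, whence \<open>\<parallel>u\<parallel> \<le> \<parallel>h\<parallel> / dist (z, c[0,\<infinity>))\<close>; this yields the sectorial bounds.
  The growth for \<open>a = d\<close> comes from the Dirichlet and Neumann eigenfunctions not being orthogonal
  to each other. Du Bois-Reymond's lemma identifies the weak second derivative of \<open>u\<close> with
  the \<open>L\<^sup>2\<close> density of \<open>u'\<close>.
\<close>

subsection \<open>Integration by parts\<close>

text \<open>Two obstacles shape the proof. The right-hand side \<open>h\<close> is only square
  integrable, so \<open>u'\<close> is an indefinite integral that need not be differentiable
  everywhere; identities are therefore kept in integrated form and rest on one integration by parts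
  with an integrable density. And the domain speaks of weak derivatives of classes but of boundary
  values of functions; the two are tied together once, in \<open>has_deriv2_rep\<close>, and
  afterwards test functions disappear.

  The coupling entry of the resolvent contains D (a D - z)^(-1), which does not decay. It equals (1
  + z (a D - z)^(-1)) / a, so a bound of order 1 / |z| for the scalar resolvent keeps it bounded,
  and the second scalar resolvent restores the decay. Hence the triangular system obeys the same
  sectorial estimate as its diagonal.

  The points 4 a \<pi>^2 r^2 are the Dirichlet eigenvalues of a D with index 2 r, so after a shift
  by \<epsilon> the first scalar resolvent multiplies sin (2 r \<pi> x) by a number of modulus 1 /
  \<epsilon>. The decisive coefficient of the second component is then read off by Green's identity
  instead of an eigenfunction expansion.\<close>

lemma integrable_lebesgue01_iff:
  fixes f :: "real \<Rightarrow> 'a::euclidean_space"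
  shows "integrable lebesgue01 f \<longleftrightarrow> f absolutely_integrable_on {0..1}"
proof -
  have "integrable lebesgue01 f \<longleftrightarrow> f absolutely_integrable_on {0<..<1}"
    unfolding set_integrable_def by (subst integrable_restrict_space) auto
  then show ?thesis by (simp add: absolutely_integrable_on_Icc_iff_Ioo)
qed

lemma integral_lebesgue01:
  fixes f :: "real \<Rightarrow> 'a::euclidean_space"
  assumes "f absolutely_integrable_on {0..1}"
  shows "integral\<^sup>L lebesgue01 f = integral {0..1} f"
  using lebesgue_integral_eq_integral[of "{0<..<1}" f] assms
  by (simp add: integrable_lebesgue01_iff integral_open_interval_real)

lemma absolutely_integrable_continuous_mult:
  fixes p h :: "real \<Rightarrow> complex"
  assumes "continuous_on {a..b} p" "h absolutely_integrable_on {a..b}"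
  shows "(\<lambda>x. p x * h x) absolutely_integrable_on {a..b}"
proof (rule absolutely_integrable_bounded_measurable_product[of "(*)"])
  show "p \<in> borel_measurable (lebesgue_on {a..b})"
    using assms(1) by (intro continuous_imp_measurable_on_sets_lebesgue) auto
  show "bounded (p ` {a..b})"
    using assms(1) compact_continuous_image compact_imp_bounded by blast
qed (use assms bilinear_conv_bounded_bilinear bounded_bilinear_mult in auto)

text \<open>Continuity of \<open>N\<close> turns the factor |N y - N x| into o(1), so the increments
  of \<open>F\<close> are o(|y - x|). The lemma is aimed at \<open>N\<close> the indefinite integral
  of |h|, where Lebesgue differentiation would give the derivative only almost everywhere, and a
  derivative vanishing almost everywhere does not force constancy.\<close>

lemma vector_derivative_zero_if_bounded_by_product:
  fixes F :: "real \<Rightarrow> 'a::real_normed_vector" and N :: "real \<Rightarrow> real"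
  assumes bound: "\<And>y. y \<in> S \<Longrightarrow> norm (F y - F x) \<le> C * \<bar>y - x\<bar> * \<bar>N y - N x\<bar>"
    and cont: "continuous_on S N" and x: "x \<in> S"
  shows "(F has_vector_derivative 0) (at x within S)"
  unfolding has_vector_derivative_def has_derivative_within_alt
proof (intro conjI allI impI)
  fix e :: real assume "0 < e"
  define e' where "e' = e / (\<bar>C\<bar> + 1)"
  have "e' > 0" using \<open>0 < e\<close> by (simp add: e'_def)
  then obtain d where "d > 0" and d: "\<And>y. y \<in> S \<Longrightarrow> \<bar>y - x\<bar> < d \<Longrightarrow> \<bar>N y - N x\<bar> < e'"
    using cont x unfolding continuous_on_iff dist_real_def by blast
  have "norm (F y - F x) \<le> e * \<bar>y - x\<bar>" if "y \<in> S" "\<bar>y - x\<bar> < d" for y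
  proof -
    have "norm (F y - F x) \<le> C * \<bar>y - x\<bar> * \<bar>N y - N x\<bar>" using bound that by blast
    also have "\<dots> \<le> (\<bar>C\<bar> + 1) * \<bar>y - x\<bar> * e'"
      using d[OF that] by (intro mult_mono) auto
    also have "\<dots> = e * \<bar>y - x\<bar>" by (simp add: e'_def field_simps)
    finally show ?thesis .
  qed
  then show "\<exists>d>0. \<forall>y\<in>S. norm (y - x) < d \<longrightarrow> norm (F y - F x - (y - x) *\<^sub>R 0) \<le> e * norm (y - x)"
    using \<open>d > 0\<close> by auto
qed auto

lemma integrable_sub01:
  fixes f :: "real \<Rightarrow> 'a::euclidean_space"
  assumes "f absolutely_integrable_on {0..1}" "0 \<le> x" "y \<le> 1"
  shows "f absolutely_integrable_on {x..y}" "f integrable_on {x..y}"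
    "(\<lambda>t. norm (f t)) integrable_on {x..y}"
proof -
  show "f absolutely_integrable_on {x..y}"
    using absolutely_integrable_on_subinterval[OF assms(1), of x y] assms by auto
  then show "f integrable_on {x..y}" "(\<lambda>t. norm (f t)) integrable_on {x..y}"
    by (simp_all add: absolutely_integrable_on_def)
qed

lemma integral_split01:
  fixes f :: "real \<Rightarrow> 'a::euclidean_space"
  assumes "f absolutely_integrable_on {0..1}" "0 \<le> x" "x \<le> y" "y \<le> 1"
  shows "integral {x..y} f = integral {0..y} f - integral {0..x} f"
  using Henstock_Kurzweil_Integration.integral_combine[of 0 x y f] integrable_sub01[OF assms(1), of 0 y] assms
  by (simp add: algebra_simps)

lemma continuous_on_indefinite_integral01:
  fixes h :: "real \<Rightarrow> 'a::euclidean_space"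
  assumes "h absolutely_integrable_on {0..1}"
  shows "continuous_on {0..1} (\<lambda>x. integral {0..x} h)"
  using assms by (intro indefinite_integral_continuous_1) (simp add: absolutely_integrable_on_def)

text \<open>
  The difference of the two sides, as a function of \<open>b\<close>, has increments
  \<open>O(\<bar>y - x\<bar> \<cdot> \<integral>\<^sub>x\<^sup>y \<bar>h\<bar>)\<close> and hence derivative zero everywhere,
  although \<open>h\<close> is only integrable.
\<close>

lemma integral_by_parts_indefinite:
  fixes h p p' :: "real \<Rightarrow> complex"
  assumes h: "h absolutely_integrable_on {0..1}"
    and p: "\<And>x. x \<in> {0..1} \<Longrightarrow> (p has_vector_derivative p' x) (at x within {0..1})"
    and p': "continuous_on {0..1} p'"
    and H: "\<And>x. x \<in> {0..1} \<Longrightarrow> H x = H 0 + integral {0..x} h"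
    and b: "b \<in> {0..1}"
  shows "integral {0..b} (\<lambda>x. p x * h x) = p b * H b - p 0 * H 0 - integral {0..b} (\<lambda>x. p' x * H x)"
proof -
  define N where "N x = integral {0..x} (\<lambda>t. cmod (h t))" for x
  have nh: "(\<lambda>t. cmod (h t)) absolutely_integrable_on {0..1}"
    using h by (rule set_integrable_norm)
  have contp: "continuous_on {0..1} p"
    using p by (rule continuous_on_vector_derivative)
  have contH: "continuous_on {0..1} H"
  proof -
    have "continuous_on {0..1} (\<lambda>x. H 0 + integral {0..x} h)"
      by (intro continuous_intros continuous_on_indefinite_integral01 h)
    then show ?thesis using H by (metis (no_types, lifting) continuous_on_cong)
  qed
  have contN: "continuous_on {0..1} N"
    unfolding N_def by (rule continuous_on_indefinite_integral01[OF nh])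
  have php: "(\<lambda>x. p x * h x) absolutely_integrable_on {0..1}"
    by (rule absolutely_integrable_continuous_mult[OF contp h])
  have pH: "(\<lambda>x. p' x * H x) absolutely_integrable_on {0..1}"
    by (intro absolutely_integrable_continuous_real continuous_intros p' contH)
  have "bounded (p' ` {0..1})"
    using p' compact_continuous_image compact_imp_bounded by blast
  then obtain M where M: "\<And>x. x \<in> {0..1} \<Longrightarrow> cmod (p' x) \<le> M"
    unfolding bounded_iff by (metis imageI)
  have M0: "0 \<le> M" using M[of 0] norm_ge_zero[of "p' 0"] by (simp del: norm_ge_zero)
  define F where "F x = integral {0..x} (\<lambda>x. p x * h x) - p x * H x + integral {0..x} (\<lambda>x. p' x * H x)" for x
  have bd: "cmod (F y - F x) \<le> 2 * M * \<bar>y - x\<bar> * \<bar>N y - N x\<bar>" if xy: "0 \<le> x" "x \<le> y" "y \<le> 1" for x y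
  proof -
    have Nxy: "N y - N x = integral {x..y} (\<lambda>t. cmod (h t))"
      using integral_split01[OF nh xy] by (simp add: N_def)
    have Hxt: "H t - H x = integral {x..t} h" if "t \<in> {x..y}" for t
      using integral_split01[OF h, of x t] that xy H[of t] H[of x] by simp
    have hxy: "h absolutely_integrable_on {x..y}" using integrable_sub01[OF h] xy by blast
    have der: "(p has_vector_derivative p' s) (at s within {x..y})" if "s \<in> {x..y}" for s
      using that xy by (intro has_vector_derivative_within_subset[OF p]) auto
    have pxy: "integral {x..y} p' = p y - p x"
      using xy der by (intro integral_unique fundamental_theorem_of_calculus) auto
    have pxy': "p' integrable_on {x..y}"
      using p' xy by (intro integrable_continuous_real) (auto intro: continuous_on_subset)
    have contp_xy: "continuous_on {x..y} p" "continuous_on {x..y} p'" "continuous_on {x..y} H"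
      using contp p' contH xy by (auto intro: continuous_on_subset)
    have e1: "F y - F x = integral {x..y} (\<lambda>t. p t * h t) - p y * H y + p x * H x
                + integral {x..y} (\<lambda>t. p' t * H t)"
      using integral_split01[OF php xy] integral_split01[OF pH xy] by (simp add: F_def)
    have i1: "(\<lambda>t. (p t - p y) * h t) absolutely_integrable_on {x..y}"
      by (intro absolutely_integrable_continuous_mult continuous_intros contp_xy hxy)
    have i2: "(\<lambda>t. p' t * (H t - H x)) absolutely_integrable_on {x..y}"
      by (intro absolutely_integrable_continuous_real continuous_intros contp_xy)
    \<comment> \<open>Here \<open>p\<close> is frozen at the right endpoint and, in the next
      identity, \<open>H\<close> at the left one. With these opposite choices the extracted terms
      add up to p y * H y - p x * H x and cancel the boundary terms in \<open>e1\<close>, leaving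
      two integrals that are each small.\<close>
    have e2: "integral {x..y} (\<lambda>t. p t * h t)
        = integral {x..y} (\<lambda>t. (p t - p y) * h t) + p y * (H y - H x)"
    proof -
      have "integral {x..y} (\<lambda>t. p t * h t) = integral {x..y} (\<lambda>t. (p t - p y) * h t + p y * h t)"
        by (simp add: algebra_simps)
      also have "\<dots> = integral {x..y} (\<lambda>t. (p t - p y) * h t) + p y * integral {x..y} h"
        using i1 hxy by (subst Henstock_Kurzweil_Integration.integral_add)
          (auto simp: absolutely_integrable_on_def integrable_on_mult_right)
      finally show ?thesis using Hxt[of y] xy by simp
    qed
    have e3: "integral {x..y} (\<lambda>t. p' t * H t)
        = integral {x..y} (\<lambda>t. p' t * (H t - H x)) + (p y - p x) * H x"
    proof -
      have "integral {x..y} (\<lambda>t. p' t * H t) = integral {x..y} (\<lambda>t. p' t * (H t - H x) + p' t * H x)"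
        by (simp add: algebra_simps)
      also have "\<dots> = integral {x..y} (\<lambda>t. p' t * (H t - H x)) + integral {x..y} p' * H x"
        using i2 pxy' by (subst Henstock_Kurzweil_Integration.integral_add)
          (auto simp: absolutely_integrable_on_def integrable_on_mult_left)
      finally show ?thesis using pxy by simp
    qed
    have e: "F y - F x = integral {x..y} (\<lambda>t. (p t - p y) * h t) + integral {x..y} (\<lambda>t. p' t * (H t - H x))"
      unfolding e1 e2 e3 by (simp add: algebra_simps)
    have b1: "cmod (integral {x..y} (\<lambda>t. (p t - p y) * h t)) \<le> integral {x..y} (\<lambda>t. (M * (y - x)) * cmod (h t))"
    proof (rule integral_norm_bound_integral)
      show "(\<lambda>t. (p t - p y) * h t) integrable_on {x..y}" using i1 by (simp add: absolutely_integrable_on_def)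
      show "(\<lambda>t. M * (y - x) * cmod (h t)) integrable_on {x..y}"
        using hxy by (simp add: absolutely_integrable_on_def integrable_on_mult_right)
      fix t assume t: "t \<in> {x..y}"
      have "cmod (p t - p y) \<le> M * norm (t - y)"
      proof (rule differentiable_bound[where S = "{x..y}"])
        show "\<And>s. s \<in> {x..y} \<Longrightarrow> (p has_derivative (\<lambda>k. k *\<^sub>R p' s)) (at s within {x..y})"
          using der by (simp add: has_vector_derivative_def)
        show "\<And>s. s \<in> {x..y} \<Longrightarrow> onorm (\<lambda>k. k *\<^sub>R p' s) \<le> M"
          using M xy by (auto simp: onorm_scaleR_left bounded_linear_ident onorm_id)
      qed (use t in auto)
      also have "\<dots> \<le> M * (y - x)" using t M0 by (intro mult_left_mono) auto
      finally show "cmod ((p t - p y) * h t) \<le> M * (y - x) * cmod (h t)"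
        by (simp add: norm_mult mult_right_mono)
    qed
    have b2: "cmod (integral {x..y} (\<lambda>t. p' t * (H t - H x))) \<le> integral {x..y} (\<lambda>t. M * (N y - N x))"
    proof (rule integral_norm_bound_integral)
      show "(\<lambda>t. p' t * (H t - H x)) integrable_on {x..y}" using i2 by (simp add: absolutely_integrable_on_def)
      fix t assume t: "t \<in> {x..y}"
      have "cmod (H t - H x) \<le> integral {x..t} (\<lambda>t. cmod (h t))"
        unfolding Hxt[OF t] using integrable_sub01[OF h, of x t] xy t
        by (intro integral_norm_bound_integral) auto
      also have "\<dots> \<le> integral {x..y} (\<lambda>t. cmod (h t))"
        using integrable_sub01[OF h, of x t] integrable_sub01[OF h, of x y] xy t
        by (intro integral_subset_le) auto
      finally show "cmod (p' t * (H t - H x)) \<le> M * (N y - N x)"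
        using M[of t] t xy M0 by (auto simp: norm_mult Nxy intro!: mult_mono)
    qed auto
    have "cmod (F y - F x) \<le> M * (y - x) * (N y - N x) + (y - x) * (M * (N y - N x))"
      unfolding e using b1 b2 xy
      by (intro norm_triangle_le add_mono) (auto simp: Nxy mult_ac)
    also have "\<dots> = 2 * M * (y - x) * (N y - N x)" by (simp add: algebra_simps)
    also have "N y - N x \<ge> 0"
      unfolding Nxy using integrable_sub01[OF h, of x y] xy by (intro Henstock_Kurzweil_Integration.integral_nonneg) auto
    ultimately show ?thesis using xy by simp
  qed
  have bd': "cmod (F y - F x) \<le> 2 * M * \<bar>y - x\<bar> * \<bar>N y - N x\<bar>" if "x \<in> {0..1}" "y \<in> {0..1}" for x y
    using bd[of x y] bd[of y x] that by (cases "x \<le> y") (auto simp: norm_minus_commute abs_minus_commute)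
  have "(F has_vector_derivative 0) (at x within {0..1})" if "x \<in> {0..1}" for x
    using vector_derivative_zero_if_bounded_by_product[of "{0..1}" F x "2 * M" N] bd' that contN by blast
  then obtain c where "\<And>x. x \<in> {0..1} \<Longrightarrow> F x = c"
    using has_vector_derivative_zero_constant[of "{0..1}" F] by auto
  then have "F b = F 0" using b by simp
  then show ?thesis by (simp add: F_def algebra_simps)
qed

subsection \<open>Test functions\<close>

text \<open>The powers in the denominator are there for closure under differentiation: each
  derivative of exp (- 1 / x) is a combination of these functions, so all orders are handled by one
  first-order rule.\<close>

definition flat :: "nat \<Rightarrow> real \<Rightarrow> real" where
  "flat k x = (if x > 0 then exp (- 1 / x) / x ^ k else 0)"

lemma flat_tendsto_0: "(flat k \<longlongrightarrow> 0) (at 0)"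
proof (rule filterlim_split_at_real)
  have "((\<lambda>x::real. inverse x ^ k / exp (inverse x)) \<longlongrightarrow> 0) (at_right 0)"
    by (rule filterlim_compose[OF tendsto_power_div_exp_0 filterlim_inverse_at_top_right])
  then show "(flat k \<longlongrightarrow> 0) (at_right 0)"
    by (rule Lim_transform_eventually)
      (auto simp: eventually_at_filter flat_def exp_minus field_simps)
  show "(flat k \<longlongrightarrow> 0) (at_left 0)"
    by (rule Lim_transform_eventually[OF tendsto_const[of 0]])
      (auto simp: eventually_at_filter flat_def)
qed

lemma flat_has_derivative:
  "(flat k has_real_derivative flat (k + 2) x - real k * flat (k + 1) x) (at x)"
proof -
  consider "x > 0" | "x = 0" | "x < 0" by linarith
  then show ?thesis
  proof cases
    case 1
    have pk: "real k * x ^ (k - Suc 0) = real k * x ^ k / x" using 1 by (cases k) auto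
    have "((\<lambda>x. exp (- 1 / x) / x ^ k) has_real_derivative
        (exp (- 1 / x) * (1 / x\<^sup>2) * x ^ k - exp (- 1 / x) * (real k * x ^ (k - Suc 0))) / (x ^ k * x ^ k)) (at x)"
      using 1 by (auto intro!: derivative_eq_intros simp: power2_eq_square)
    also have "(exp (- 1 / x) * (1 / x\<^sup>2) * x ^ k - exp (- 1 / x) * (real k * x ^ (k - Suc 0))) / (x ^ k * x ^ k)
        = flat (k + 2) x - real k * flat (k + 1) x"
      unfolding pk using 1 by (simp add: flat_def field_simps power2_eq_square)
    finally have "((\<lambda>x. exp (- 1 / x) / x ^ k) has_real_derivative flat (k + 2) x - real k * flat (k + 1) x) (at x)" .
    then show ?thesis
      by (rule has_field_derivative_transform_within_open[of _ _ _ "{0<..}"]) (use 1 in \<open>auto simp: flat_def\<close>)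
  next
    case 2
    \<comment> \<open>The difference quotient of \<open>flat k\<close> at 0 is
      \<open>flat (Suc k)\<close>, whose limit there is already known.\<close>
    have "((\<lambda>y. flat k y / y) \<longlongrightarrow> 0) (at 0)"
      by (rule Lim_transform_eventually[OF flat_tendsto_0[of "Suc k"]])
        (auto simp: eventually_at_filter flat_def)
    then show ?thesis using 2 by (simp add: has_field_derivative_iff flat_def)
  next
    case 3
    have "((\<lambda>x. 0) has_real_derivative flat (k + 2) x - real k * flat (k + 1) x) (at x)"
      using 3 by (auto simp: flat_def)
    then show ?thesis
      by (rule has_field_derivative_transform_within_open[of _ _ _ "{..<0}"]) (use 3 in \<open>auto simp: flat_def\<close>)
  qed
qed

text \<open>Products of two flat functions, one for each end of [\<alpha>, \<beta>], with arbitrary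
  orders and coefficients. Since one differentiation stays inside this class, smoothness of a bump
  follows by induction without a formula for its higher derivatives.\<close>

inductive bump_span :: "real \<Rightarrow> real \<Rightarrow> (real \<Rightarrow> real) \<Rightarrow> bool" for \<alpha> \<beta> where
  "bump_span \<alpha> \<beta> (\<lambda>x. c * flat i (x - \<alpha>) * flat j (\<beta> - x))"
| "bump_span \<alpha> \<beta> f \<Longrightarrow> bump_span \<alpha> \<beta> g \<Longrightarrow> bump_span \<alpha> \<beta> (\<lambda>x. f x + g x)"

lemma bump_span_derivative:
  assumes "bump_span \<alpha> \<beta> f"
  shows "\<exists>g. bump_span \<alpha> \<beta> g \<and> (\<forall>x. (f has_real_derivative g x) (at x))"
  using assms
proof induction
  case (1 c i j)
  define g where "g = (\<lambda>x. (c * flat (i + 2) (x - \<alpha>) * flat j (\<beta> - x) +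
      (- c * real i) * flat (i + 1) (x - \<alpha>) * flat j (\<beta> - x)) +
    ((- c) * flat i (x - \<alpha>) * flat (j + 2) (\<beta> - x) +
      (c * real j) * flat i (x - \<alpha>) * flat (j + 1) (\<beta> - x)))"
  have "bump_span \<alpha> \<beta> g" unfolding g_def by (intro bump_span.intros)
  moreover have "((\<lambda>x. c * flat i (x - \<alpha>) * flat j (\<beta> - x)) has_real_derivative g x) (at x)" for x
    unfolding g_def
    by (rule derivative_eq_intros DERIV_chain2[OF flat_has_derivative] refl)+
      (simp add: algebra_simps)
  ultimately show ?case by blast
next
  case (2 f g)
  then obtain f' g' where "bump_span \<alpha> \<beta> f'" "\<forall>x. (f has_real_derivative f' x) (at x)"
    "bump_span \<alpha> \<beta> g'" "\<forall>x. (g has_real_derivative g' x) (at x)" by blast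
  then show ?case
    by (intro exI[of _ "\<lambda>x. f' x + g' x"] conjI allI bump_span.intros DERIV_add) auto
qed

lemma bump_span_deriv:
  assumes "bump_span \<alpha> \<beta> f"
  shows "bump_span \<alpha> \<beta> (deriv f)" "f differentiable (at x)"
proof -
  obtain g where g: "bump_span \<alpha> \<beta> g" "\<And>x. (f has_real_derivative g x) (at x)"
    using bump_span_derivative[OF assms] by blast
  then have "deriv f = g" by (auto intro: DERIV_imp_deriv)
  then show "bump_span \<alpha> \<beta> (deriv f)" "f differentiable (at x)"
    using g by (auto simp: real_differentiable_def)
qed

lemma bump_span_higher_deriv:
  assumes "bump_span \<alpha> \<beta> f"
  shows "bump_span \<alpha> \<beta> ((deriv ^^ k) f)"
  using assms by (induction k) (auto intro: bump_span_deriv)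

text \<open>The points 0 and 1 have positive distance from the closed support, so the inclusion
  amounts to a uniform margin \<open>e\<close>. In this form supports of sums and antiderivatives
  are handled by comparing numbers.\<close>

lemma test_function_iff:
  "test_function \<psi> \<longleftrightarrow> (\<forall>k x. (deriv ^^ k) \<psi> differentiable (at x)) \<and>
     (\<exists>e>0. \<forall>x. \<psi> x \<noteq> 0 \<longrightarrow> e \<le> x \<and> x \<le> 1 - e)"
proof -
  have "closure S \<subseteq> {0<..<1} \<longleftrightarrow> (\<exists>e>0. \<forall>x\<in>S. e \<le> x \<and> x \<le> 1 - e)" for S :: "real set"
  proof
    assume S: "closure S \<subseteq> {0<..<1}"
    then have "0 \<notin> closure S" "1 \<notin> closure S" by auto
    then obtain d e where "d > 0" "e > 0" "\<forall>x\<in>S. d \<le> dist x 0" "\<forall>x\<in>S. e \<le> dist x 1"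
      by (auto simp: closure_approachable not_less)
    moreover have "S \<subseteq> {0<..<1}" using S closure_subset by blast
    ultimately show "\<exists>e>0. \<forall>x\<in>S. e \<le> x \<and> x \<le> 1 - e"
      by (intro exI[of _ "min d e"]) (force simp: dist_real_def)
  next
    assume "\<exists>e>0. \<forall>x\<in>S. e \<le> x \<and> x \<le> 1 - e"
    then obtain e where "e > 0" "S \<subseteq> {e..1 - e}" by (metis atLeastAtMost_iff subsetI)
    then have "closure S \<subseteq> {e..1 - e}" by (intro closure_minimal) auto
    then show "closure S \<subseteq> {0<..<1}" using \<open>e > 0\<close> by auto
  qed
  then show ?thesis by (simp add: test_function_def)
qed

lemma test_function_higher_deriv_add:
  assumes "\<And>k x. (deriv ^^ k) f differentiable (at x)" "\<And>k x. (deriv ^^ k) g differentiable (at x)"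
  shows "(deriv ^^ k) (\<lambda>x. f x + c * g x) = (\<lambda>x. (deriv ^^ k) f x + c * (deriv ^^ k) (g :: real \<Rightarrow> real) x)"
proof (induction k)
  case (Suc k)
  show ?case
  proof
    fix x
    have "((\<lambda>x. (deriv ^^ k) f x + c * (deriv ^^ k) g x) has_real_derivative
        deriv ((deriv ^^ k) f) x + c * deriv ((deriv ^^ k) g) x) (at x)"
      using assms by (intro DERIV_add DERIV_cmult) (auto simp: DERIV_deriv_iff_real_differentiable)
    then show "(deriv ^^ Suc k) (\<lambda>x. f x + c * g x) x = (deriv ^^ Suc k) f x + c * (deriv ^^ Suc k) g x"
      by (simp add: Suc DERIV_imp_deriv)
  qed
qed simp

lemma test_function_add:
  assumes f: "test_function f" and g: "test_function g"
  shows "test_function (\<lambda>x. f x + c * g x)"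
proof -
  have d: "(deriv ^^ k) f differentiable (at x)" "(deriv ^^ k) g differentiable (at x)" for k x
    using f g by (auto simp: test_function_def)
  obtain a b where "a > 0" "b > 0" "\<And>x. f x \<noteq> 0 \<Longrightarrow> a \<le> x \<and> x \<le> 1 - a" "\<And>x. g x \<noteq> 0 \<Longrightarrow> b \<le> x \<and> x \<le> 1 - b"
    using f g unfolding test_function_iff by metis
  then have "\<forall>x. f x + c * g x \<noteq> 0 \<longrightarrow> min a b \<le> x \<and> x \<le> 1 - min a b"
    by (metis (no_types) add_0 diff_left_mono dual_order.trans min.cobounded1 min.cobounded2 mult_zero_right)
  moreover have "min a b > 0" using \<open>a > 0\<close> \<open>b > 0\<close> by simp
  ultimately show ?thesis
    unfolding test_function_iff test_function_higher_deriv_add[OF d]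
    by (intro conjI allI differentiable_add differentiable_mult differentiable_const d) blast
qed

lemma test_function_deriv:
  assumes "test_function \<psi>"
  shows "(\<psi> has_real_derivative deriv \<psi> x) (at x)"
    "(deriv \<psi> has_real_derivative (deriv ^^ 2) \<psi> x) (at x)"
    "continuous_on S \<psi>" "continuous_on S (deriv \<psi>)" "continuous_on S ((deriv ^^ 2) \<psi>)"
proof -
  have d: "\<And>k x. (deriv ^^ k) \<psi> differentiable (at x)" using assms by (simp add: test_function_def)
  from d[of 0] d[of 1] show "(\<psi> has_real_derivative deriv \<psi> x) (at x)"
    "(deriv \<psi> has_real_derivative (deriv ^^ 2) \<psi> x) (at x)"
    by (auto simp: DERIV_deriv_iff_real_differentiable numeral_2_eq_2)
  have "continuous_on S ((deriv ^^ k) \<psi>)" for k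
    using d by (intro differentiable_imp_continuous_on) (auto simp: differentiable_on_def intro: differentiable_at_withinI)
  from this[of 0] this[of 1] this[of 2]
  show "continuous_on S \<psi>" "continuous_on S (deriv \<psi>)" "continuous_on S ((deriv ^^ 2) \<psi>)"
    by auto
qed

lemma test_function_boundary:
  assumes "test_function \<psi>"
  shows "\<psi> 0 = 0" "\<psi> 1 = 0" "deriv \<psi> 0 = 0" "deriv \<psi> 1 = 0"
proof -
  obtain e where e: "e > 0" "\<And>x. \<psi> x \<noteq> 0 \<Longrightarrow> e \<le> x \<and> x \<le> 1 - e"
    using assms unfolding test_function_iff by auto
  then show "\<psi> 0 = 0" "\<psi> 1 = 0" by force+
  have "(\<psi> has_real_derivative 0) (at x)" if "x = 0 \<or> x = 1" for x
    by (rule has_field_derivative_transform_within_open[of "\<lambda>x. 0" _ _ "ball x e"])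
      (use e that in \<open>force simp: dist_real_def\<close>)+
  then show "deriv \<psi> 0 = 0" "deriv \<psi> 1 = 0" by (auto intro: DERIV_imp_deriv)
qed

lemma bump_exists:
  assumes "0 < \<alpha>" "\<alpha> < \<beta>" "\<beta> < 1"
  obtains \<phi> where "test_function \<phi>" "\<And>x. 0 \<le> \<phi> x" "\<And>x. \<phi> x \<noteq> 0 \<longleftrightarrow> \<alpha> < x \<and> x < \<beta>"
proof
  let ?\<phi> = "\<lambda>x. 1 * flat 0 (x - \<alpha>) * flat 0 (\<beta> - x)"
  show "?\<phi> x \<noteq> 0 \<longleftrightarrow> \<alpha> < x \<and> x < \<beta>" and "0 \<le> ?\<phi> x" for x by (auto simp: flat_def)
  have "bump_span \<alpha> \<beta> ?\<phi>" by (rule bump_span.intros)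
  then have "(deriv ^^ k) ?\<phi> differentiable (at x)" for k x
    by (intro bump_span_deriv(2) bump_span_higher_deriv)
  moreover have "\<forall>x. ?\<phi> x \<noteq> 0 \<longrightarrow> min \<alpha> (1 - \<beta>) \<le> x \<and> x \<le> 1 - min \<alpha> (1 - \<beta>)"
    by (auto simp: flat_def)
  moreover have "min \<alpha> (1 - \<beta>) > 0" using assms by simp
  ultimately show "test_function ?\<phi>" unfolding test_function_iff by blast
qed

text \<open>The antiderivative starting at 0 vanishes left of the support of \<eta>; to the right of
  it, it equals the total integral, so mean zero is exactly what makes it compactly supported
  again.\<close>

lemma test_function_antiderivative:
  assumes \<eta>: "test_function \<eta>" and int: "integral {0..1} \<eta> = 0"
  obtains \<psi> where "test_function \<psi>" "deriv \<psi> = \<eta>"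
proof -
  obtain e where e: "e > 0" "\<And>x. \<eta> x \<noteq> 0 \<Longrightarrow> e \<le> x \<and> x \<le> 1 - e"
    using \<eta> unfolding test_function_iff by auto
  define \<psi> where "\<psi> x = integral {0..x} \<eta>" for x
  have cont: "continuous_on S \<eta>" for S using test_function_deriv[OF \<eta>] by blast
  have low: "\<psi> x = 0" if "x < e" for x
  proof -
    have "integral {0..x} \<eta> = integral {0..x} (\<lambda>x. 0)"
      using e(2) that by (intro integral_cong) force
    then show ?thesis by (simp add: \<psi>_def)
  qed
  have high: "\<psi> x = 0" if "x > 1 - e" for x
  proof (cases "e \<le> 1")
    case True
    have "integral {1 - e..y} \<eta> = 0" if "1 - e \<le> y" for y
    proof -
      \<comment> \<open>The margin condition leaves open the value at 1 - e itself, so this point is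
        treated as negligible.\<close>
      have "integral {1 - e..y} \<eta> = integral {1 - e..y} (\<lambda>x. 0)"
        using e(2) that by (intro integral_spike[of "{1 - e}"]) force+
      then show ?thesis by simp
    qed
    note z = this
    have s: "integral {0..y} \<eta> = integral {0..1 - e} \<eta> + integral {1 - e..y} \<eta>" if "1 - e \<le> y" for y
      using True that
      by (intro Henstock_Kurzweil_Integration.integral_combine[symmetric] integrable_continuous_real cont) auto
    have "integral {0..1 - e} \<eta> = 0" using s[of 1] z[of 1] int e by simp
    then show ?thesis using s[of x] z[of x] that by (simp add: \<psi>_def)
  next
    case False
    \<comment> \<open>With a margin above 1 no point satisfies e \<le> x \<le> 1 - e, so \<eta> is
      identically zero.\<close>
    then have "\<eta> = (\<lambda>x. 0)" using e by force
    then show ?thesis by (simp add: \<psi>_def)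
  qed
  have der: "(\<psi> has_real_derivative \<eta> x) (at x)" for x
  proof (cases "x < e")
    case True
    then have "\<eta> x = 0" using e(2)[of x] by auto
    then have "((\<lambda>x. 0) has_real_derivative \<eta> x) (at x)" by simp
    then show ?thesis
      by (rule has_field_derivative_transform_within_open[of _ _ _ "{..<e}"]) (use True low in auto)
  next
    case False
    have "((\<lambda>x. integral {0..x} \<eta>) has_real_derivative \<eta> x) (at x within {0..x + 1})"
      using False e by (intro integral_has_real_derivative cont) auto
    moreover have "at x within {0..x + 1} = at x"
      using False e by (intro at_within_interior) auto
    ultimately show ?thesis by (simp add: \<psi>_def[abs_def])
  qed
  then have d: "deriv \<psi> = \<eta>" by (auto intro: DERIV_imp_deriv)
  have "(deriv ^^ k) \<psi> differentiable (at x)" for k x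
  proof (cases k)
    case 0
    then show ?thesis using der by (auto simp: real_differentiable_def)
  next
    case (Suc m)
    have "(deriv ^^ k) \<psi> = (deriv ^^ m) \<eta>" by (simp add: Suc d funpow_swap1)
    then show ?thesis using \<eta> by (simp add: test_function_def)
  qed
  moreover have "\<forall>x. \<psi> x \<noteq> 0 \<longrightarrow> e \<le> x \<and> x \<le> 1 - e" using low high by (meson not_le)
  ultimately have "test_function \<psi>" unfolding test_function_iff using e(1) by blast
  then show ?thesis using d that by blast
qed

section \<open>Orthogonality to test functions and to their derivatives\<close>

lemma continuous_eq_0_if_orthogonal_test_functions:
  fixes r :: "real \<Rightarrow> complex"
  assumes cont: "continuous_on {0..1} r"
    and orth: "\<And>\<phi>. test_function \<phi> \<Longrightarrow> integral {0..1} (\<lambda>x. \<phi> x *\<^sub>R r x) = 0"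
    and x: "x \<in> {0..1}"
  shows "r x = 0"
proof -
  have zero: "r y = 0" if y: "y \<in> {0<..<1}" for y
  proof (rule ccontr)
    assume "r y \<noteq> 0"
    \<comment> \<open>The real inner product with the fixed value \<open>r y\<close> replaces the
      complex function by a real one that is positive at \<open>y\<close>, so a nonnegative bump
      near \<open>y\<close> detects it.\<close>
    define s where "s t = r t \<bullet> r y" for t
    have conts: "continuous_on {0..1} s" unfolding s_def by (intro continuous_intros cont)
    have "s y > 0" using \<open>r y \<noteq> 0\<close> by (simp add: s_def)
    moreover have "continuous_on {0<..<1} s"
      using conts by (rule continuous_on_subset) auto
    then have "isCont s y"
      using y by (simp add: continuous_on_eq_continuous_at)
    ultimately obtain d where d: "d > 0" "\<And>t. \<bar>t - y\<bar> < d \<Longrightarrow> \<bar>s t - s y\<bar> < s y"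
      unfolding continuous_at_eps_delta dist_real_def by blast
    have pos: "s t > 0" if "\<bar>t - y\<bar> < d" for t using d(2)[OF that] by linarith
    define d' where "d' = min d (min y (1 - y)) / 2"
    have d': "0 < d'" "d' < d" "d' < y" "d' < 1 - y" using d y by (auto simp: d'_def min_def)
    obtain \<phi> where \<phi>: "test_function \<phi>" "\<And>x. 0 \<le> \<phi> x" "\<And>x. \<phi> x \<noteq> 0 \<longleftrightarrow> y - d' < x \<and> x < y + d'"
      using bump_exists[of "y - d'" "y + d'"] d' by auto
    have cont\<phi>: "continuous_on {0..1} \<phi>" using test_function_deriv[OF \<phi>(1)] by blast
    have "integral {0..1} (\<lambda>t. \<phi> t * s t) = integral {0..1} (\<lambda>t. (\<phi> t *\<^sub>R r t) \<bullet> r y)"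
      by (simp add: s_def)
    also have "\<dots> = integral {0..1} (\<lambda>t. \<phi> t *\<^sub>R r t) \<bullet> r y"
      using integral_linear[of "\<lambda>t. \<phi> t *\<^sub>R r t" "{0..1}" "\<lambda>z. z \<bullet> r y"]
      by (simp add: o_def bounded_linear_inner_left integrable_continuous_real continuous_intros cont cont\<phi>)
    finally have "integral {0..1} (\<lambda>t. \<phi> t * s t) = 0" using orth[OF \<phi>(1)] by simp
    moreover have "0 \<le> \<phi> t * s t" for t
    proof (cases "\<phi> t = 0")
      case False
      then have "\<bar>t - y\<bar> < d" using \<phi>(3)[of t] d' by auto
      then show ?thesis using pos[of t] \<phi>(2)[of t] by simp
    qed simp
    ultimately have "\<forall>t\<in>{0..1}. \<phi> t * s t = 0"
      by (subst (asm) integral_eq_0_iff) (auto intro!: continuous_intros cont\<phi> conts)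
    then have "\<phi> y * s y = 0" using y by simp
    then show False using \<open>s y > 0\<close> \<phi>(3)[of y] d' by simp
  qed
  have "closure {0<..<1::real} = {0..1}" by simp
  then show ?thesis using continuous_constant_on_closure[of "{0<..<1}" r 0 x] cont zero x by simp
qed

text \<open>Only functions of mean zero are derivatives of test functions. An arbitrary \<phi> is
  corrected by a multiple of a fixed bump \<phi>0 to have mean zero, and orthogonality of
  \<open>q\<close> to the result says that \<open>q\<close> minus its \<phi>0-weighted mean
  \<open>c\<close> is orthogonal to \<phi> itself.\<close>

lemma du_Bois_Reymond:
  fixes q :: "real \<Rightarrow> complex"
  assumes cont: "continuous_on {0..1} q"
    and orth: "\<And>\<psi>. test_function \<psi> \<Longrightarrow> integral {0..1} (\<lambda>x. deriv \<psi> x *\<^sub>R q x) = 0"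
    and x: "x \<in> {0..1}"
  shows "q x = q 0"
proof -
  obtain \<phi>0 where \<phi>0: "test_function \<phi>0" "\<And>x. 0 \<le> \<phi>0 x" "\<And>x. \<phi>0 x \<noteq> 0 \<longleftrightarrow> 1/4 < x \<and> x < 3/4"
    using bump_exists[of "1/4" "3/4"] by auto
  define m0 where "m0 = integral {0..1} \<phi>0"
  have cont\<phi>0: "continuous_on {0..1} \<phi>0" using test_function_deriv[OF \<phi>0(1)] by blast
  have "m0 \<noteq> 0"
  proof
    assume "m0 = 0"
    then have "\<forall>t\<in>{0..1}. \<phi>0 t = 0"
      unfolding m0_def using cont\<phi>0 \<phi>0(2) by (subst (asm) integral_eq_0_iff) auto
    then show False using \<phi>0(3)[of "1/2"] by simp
  qed
  define c where "c = integral {0..1} (\<lambda>x. \<phi>0 x *\<^sub>R q x) /\<^sub>R m0"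
  have "integral {0..1} (\<lambda>x. \<phi> x *\<^sub>R (q x - c)) = 0" if \<phi>: "test_function \<phi>" for \<phi>
  proof -
    have cont\<phi>: "continuous_on {0..1} \<phi>" using test_function_deriv[OF \<phi>] by blast
    define m where "m = integral {0..1} \<phi>"
    have i: "\<phi> integrable_on {0..1}" "\<phi>0 integrable_on {0..1}"
      "(\<lambda>x. \<phi> x *\<^sub>R q x) integrable_on {0..1}" "(\<lambda>x. \<phi>0 x *\<^sub>R q x) integrable_on {0..1}"
      "(\<lambda>x. \<phi> x *\<^sub>R c) integrable_on {0..1}" "(\<lambda>x. (- m / m0) * \<phi>0 x) integrable_on {0..1}"
      "(\<lambda>x. (- m / m0) *\<^sub>R (\<phi>0 x *\<^sub>R q x)) integrable_on {0..1}"
      by (intro integrable_continuous_real continuous_intros cont cont\<phi> cont\<phi>0)+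
    have "integral {0..1} (\<lambda>x. \<phi> x + (- m / m0) * \<phi>0 x) = m + (- m / m0) * m0"
      by (subst Henstock_Kurzweil_Integration.integral_add[OF i(1) i(6)])
        (simp add: m_def m0_def del: times_divide_eq_left)
    also have "\<dots> = 0" using \<open>m0 \<noteq> 0\<close> by simp
    finally obtain \<psi> where \<psi>: "test_function \<psi>" "deriv \<psi> = (\<lambda>x. \<phi> x + (- m / m0) * \<phi>0 x)"
      using test_function_antiderivative[OF test_function_add[OF \<phi> \<phi>0(1), of "- m / m0"]] by blast
    have "0 = integral {0..1} (\<lambda>x. \<phi> x *\<^sub>R q x + (- m / m0) *\<^sub>R (\<phi>0 x *\<^sub>R q x))"
      using orth[OF \<psi>(1)] by (simp add: \<psi>(2) scaleR_diff_left)
    also have "\<dots> = integral {0..1} (\<lambda>x. \<phi> x *\<^sub>R q x) - m *\<^sub>R c"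
      by (subst Henstock_Kurzweil_Integration.integral_add[OF i(3) i(7)])
        (simp only: integral_cmul c_def divide_inverse, simp add: algebra_simps)
    also have "m *\<^sub>R c = integral {0..1} (\<lambda>x. \<phi> x *\<^sub>R c)"
      using integral_linear[of \<phi> "{0..1}" "\<lambda>z. z *\<^sub>R c"] i
      by (simp add: o_def bounded_linear_scaleR_left m_def)
    finally show ?thesis
      using i by (simp add: scaleR_diff_right Henstock_Kurzweil_Integration.integral_diff)
  qed
  then have "q y - c = 0" if "y \<in> {0..1}" for y
    using that by (intro continuous_eq_0_if_orthogonal_test_functions[where r = "\<lambda>x. q x - c"] continuous_intros cont) auto
  then show ?thesis using x by simp
qed

subsection \<open>Representatives of classes in \<open>L\<^sup>2(0,1)\<close>\<close>

text \<open>The endpoints go into the null set, which lets statements about the measure on the open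
  interval be used with integrals over closed intervals {0..b}.\<close>

lemma AE_lebesgue01_iff:
  "(AE x in lebesgue01. P x) \<longleftrightarrow> (\<exists>N. negligible N \<and> (\<forall>x\<in>{0..1} - N. P x))"
proof -
  have "(AE x in lebesgue01. P x) \<longleftrightarrow> (AE x in lebesgue. x \<in> {0<..<1} \<longrightarrow> P x)"
    by (rule AE_restrict_space_iff) auto
  also have "\<dots> \<longleftrightarrow> (\<exists>N. negligible N \<and> {x. \<not> (x \<in> {0<..<1} \<longrightarrow> P x)} \<subseteq> N)"
    by (rule eventually_ae_filter_negligible)
  also have "\<dots> \<longleftrightarrow> (\<exists>N. negligible N \<and> (\<forall>x\<in>{0..1} - N. P x))"
  proof
    assume "\<exists>N. negligible N \<and> {x. \<not> (x \<in> {0<..<1} \<longrightarrow> P x)} \<subseteq> N"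
    then obtain N where N: "negligible N" "{x. \<not> (x \<in> {0<..<1} \<longrightarrow> P x)} \<subseteq> N" by blast
    have "P x" if "x \<in> {0..1} - (N \<union> {0, 1})" for x
    proof -
      have "x \<in> {0<..<1}" "x \<notin> N" using that by auto
      then show ?thesis using N(2) by blast
    qed
    moreover have "negligible (N \<union> {0, 1})" using N(1) by simp
    ultimately show "\<exists>N. negligible N \<and> (\<forall>x\<in>{0..1} - N. P x)" by blast
  next
    assume "\<exists>N. negligible N \<and> (\<forall>x\<in>{0..1} - N. P x)"
    then show "\<exists>N. negligible N \<and> {x. \<not> (x \<in> {0<..<1} \<longrightarrow> P x)} \<subseteq> N"
      by (elim exE, intro exI) auto
  qed
  finally show ?thesis .
qed

lemma integral_cong_AE01:
  fixes f g :: "real \<Rightarrow> 'a::banach"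
  assumes "AE x in lebesgue01. f x = g x" "b \<le> 1"
  shows "integral {0..b} f = integral {0..b} g"
proof -
  obtain N where "negligible N" "\<forall>x\<in>{0..1} - N. f x = g x"
    using assms(1) unfolding AE_lebesgue01_iff by blast
  then show ?thesis using assms(2) by (intro integral_spike[of N]) auto
qed

lemma absolutely_integrable_cong_AE01:
  fixes f g :: "real \<Rightarrow> 'a::euclidean_space"
  assumes "AE x in lebesgue01. f x = g x" "f absolutely_integrable_on {0..1}"
  shows "g absolutely_integrable_on {0..1}"
proof -
  obtain N where "negligible N" "\<forall>x\<in>{0..1} - N. f x = g x"
    using assms(1) unfolding AE_lebesgue01_iff by blast
  then show ?thesis using assms(2) by (intro absolutely_integrable_spike[OF assms(2), of N]) auto
qed

text \<open>Lebesgue differentiation applied to \<open>h\<close> extended by zero: outside a null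
  set, \<open>h x\<close> is the limit of averages over [x, x + k], all of which vanish. The point 1
  joins the null set because these intervals must stay in [0, 1].\<close>

lemma AE_0_if_indefinite_integral_0:
  fixes h :: "real \<Rightarrow> 'a::euclidean_space"
  assumes h: "h absolutely_integrable_on {0..1}"
    and zero: "\<And>x. x \<in> {0..1} \<Longrightarrow> integral {0..x} h = 0"
  shows "AE x in lebesgue01. h x = 0"
proof -
  define f where "f x = (if x \<in> {0..1} then h x else 0)" for x
  have "f integrable_on UNIV"
    unfolding f_def Henstock_Kurzweil_Integration.integrable_restrict_UNIV
    using h by (simp add: absolutely_integrable_on_def)
  then have "f integrable_on cbox a b" for a b
    by (rule integrable_on_subcbox) simp
  then obtain N where N: "negligible N" "\<And>x e. x \<notin> N \<Longrightarrow> 0 < e \<Longrightarrow>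
      \<exists>d>0. \<forall>k. 0 < k \<and> k < d \<longrightarrow>
        norm (integral (cbox x (x + k *\<^sub>R One)) f /\<^sub>R k ^ DIM(real) - f x) < e"
    using integrable_ccontinuous_explicit[of f] by blast
  have "h x = 0" if x: "x \<in> {0..1} - (N \<union> {1})" for x
  proof (rule ccontr)
    assume "h x \<noteq> 0"
    then obtain d where d: "d > 0" "\<And>k. 0 < k \<Longrightarrow> k < d \<Longrightarrow>
        norm (integral {x..x + k} f /\<^sub>R k - f x) < norm (h x)"
      using N(2)[of x "norm (h x)"] x by auto
    define k where "k = min d (1 - x) / 2"
    have k: "0 < k" "k < d" "x + k \<le> 1" using d(1) x by (auto simp: k_def min_def field_simps)
    have "integral {x..x + k} f = integral {x..x + k} h"
      using x k by (intro integral_cong) (auto simp: f_def)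
    also have "\<dots> = 0" using integral_split01[OF h, of x "x + k"] zero x k by simp
    finally show False using d(2)[OF k(1,2)] x by (simp add: f_def)
  qed
  moreover have "negligible (N \<union> {1})" using N(1) by simp
  ultimately show ?thesis unfolding AE_lebesgue01_iff by blast
qed

text \<open>This makes boundary values of a class meaningful: two continuous representatives agree
  up to the endpoints, although the endpoints themselves carry no measure.\<close>

lemma continuous_eq_if_AE:
  fixes u v :: "real \<Rightarrow> complex"
  assumes "AE x in lebesgue01. u x = v x" "continuous_on {0..1} u" "continuous_on {0..1} v" "x \<in> {0..1}"
  shows "u x = v x"
proof -
  have "integral {0..1} (\<lambda>x. \<phi> x *\<^sub>R (u x - v x)) = 0" for \<phi> :: "real \<Rightarrow> real"
  proof -
    have "integral {0..1} (\<lambda>x. \<phi> x *\<^sub>R (u x - v x)) = integral {0..1} (\<lambda>x::real. 0)"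
      by (rule integral_cong_AE01) (use assms(1) in auto)
    then show ?thesis by simp
  qed
  then have "u x - v x = 0"
    using assms by (intro continuous_eq_0_if_orthogonal_test_functions[where r = "\<lambda>x. u x - v x"] continuous_intros) auto
  then show ?thesis by simp
qed

lemma square_integrable_continuous:
  assumes "continuous_on {0..1} f"
  shows "square_integrable f"
  unfolding square_integrable_def
proof
  show "f \<in> borel_measurable lebesgue01"
    using assms by (intro continuous_imp_measurable_on_sets_lebesgue continuous_on_subset[OF assms]) auto
  show "integrable lebesgue01 (\<lambda>x. (cmod (f x))\<^sup>2)"
    unfolding integrable_lebesgue01_iff
    by (intro absolutely_integrable_continuous_real continuous_intros assms)
qed

lemma square_integrable_cnj: "square_integrable f \<Longrightarrow> square_integrable (\<lambda>x. cnj (f x))"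
  unfolding square_integrable_def
  by (auto intro: measurable_compose[OF _ borel_measurable_continuous_onI[of cnj]] continuous_intros)

lemma square_integrable_product:
  assumes f: "square_integrable f" and g: "square_integrable g"
  shows "(\<lambda>x. f x * g x) absolutely_integrable_on {0..1}"
    "(\<lambda>x. cmod (f x) * cmod (g x)) absolutely_integrable_on {0..1}"
proof -
  have [measurable]: "f \<in> borel_measurable lebesgue01" "g \<in> borel_measurable lebesgue01"
    using assms by (auto simp: square_integrable_def)
  have "cmod (f x) * cmod (g x) \<le> (cmod (f x))\<^sup>2 + (cmod (g x))\<^sup>2" for x
    using sum_squares_bound[of "cmod (f x)" "cmod (g x)"]
      mult_nonneg_nonneg[OF norm_ge_zero norm_ge_zero, of "f x" "g x"] by linarith
  moreover have "integrable lebesgue01 (\<lambda>x. (cmod (f x))\<^sup>2 + (cmod (g x))\<^sup>2)"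
    using assms by (auto simp: square_integrable_def)
  ultimately show "(\<lambda>x. f x * g x) absolutely_integrable_on {0..1}"
    "(\<lambda>x. cmod (f x) * cmod (g x)) absolutely_integrable_on {0..1}"
    unfolding integrable_lebesgue01_iff[symmetric]
    by - (rule Bochner_Integration.integrable_bound[where f = "\<lambda>x. (cmod (f x))\<^sup>2 + (cmod (g x))\<^sup>2"];
        auto simp: norm_mult)+
qed

lemma square_integrable_imp:
  assumes "square_integrable f"
  shows "f absolutely_integrable_on {0..1}" "(\<lambda>x. (cmod (f x))\<^sup>2) absolutely_integrable_on {0..1}"
  using square_integrable_product(1)[OF assms square_integrable_continuous[of "\<lambda>x. 1"]] assms
  by (auto simp: square_integrable_def integrable_lebesgue01_iff)

section \<open>Classes, their representatives and complex multiples\<close>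

lemma square_integrable_rep: "square_integrable (rep_L2 f)"
  using Quotient3_rep_reflp[OF Quotient3_L2, of f] by blast

lemma rep_abs_L2:
  assumes "square_integrable u"
  shows "AE x in lebesgue01. rep_L2 (abs_L2 u) x = u x"
  using rep_abs_rsp_left[OF Quotient3_L2, of u u] assms by auto

lemma L2_eqI:
  assumes "AE x in lebesgue01. rep_L2 f x = rep_L2 g x"
  shows "f = g"
  using Quotient3_rel_rep[OF Quotient3_L2, of f g] assms square_integrable_rep by blast

lemma abs_rep_L2: "abs_L2 (rep_L2 f) = f"
  by (rule Quotient3_abs_rep[OF Quotient3_L2])

lemma rep_plus_L2: "AE x in lebesgue01. rep_L2 (f + g) x = rep_L2 f x + rep_L2 g x"
  using rep_abs_L2[of "\<lambda>x. rep_L2 f x + rep_L2 g x"] plus_L2.abs_eq[of "rep_L2 f" "rep_L2 g"]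
  by (simp add: square_integrable_rep square_integrable_add abs_rep_L2)

lemma rep_minus_L2: "AE x in lebesgue01. rep_L2 (f - g) x = rep_L2 f x - rep_L2 g x"
  using rep_abs_L2[of "\<lambda>x. rep_L2 f x - rep_L2 g x"] minus_L2.abs_eq[of "rep_L2 f" "rep_L2 g"]
  by (simp add: square_integrable_rep square_integrable_diff abs_rep_L2)

lemma rep_uminus_L2: "AE x in lebesgue01. rep_L2 (- f) x = - rep_L2 f x"
  using rep_abs_L2[of "\<lambda>x. - rep_L2 f x"] uminus_L2.abs_eq[of "rep_L2 f"]
  by (simp add: square_integrable_rep square_integrable_minus abs_rep_L2)

lemma rep_scaleC: "AE x in lebesgue01. rep_L2 (scaleC c f) x = c * rep_L2 f x"
  using rep_abs_L2[of "\<lambda>x. c * rep_L2 f x"] scaleC.abs_eq[of "rep_L2 f" c]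
  by (simp add: square_integrable_rep square_integrable_mult abs_rep_L2)

lemma rep_scaleR_L2: "AE x in lebesgue01. rep_L2 (r *\<^sub>R f) x = of_real r * rep_L2 f x"
  using rep_abs_L2[of "\<lambda>x. of_real r * rep_L2 f x"] scaleR_L2.abs_eq[of "rep_L2 f" r]
  by (simp add: square_integrable_rep square_integrable_mult abs_rep_L2)

lemma rep_zero_L2: "AE x in lebesgue01. rep_L2 0 x = 0"
  using rep_abs_L2[of "\<lambda>x. 0"] by (simp add: square_integrable_0 zero_L2_def)

lemma scaleC_zero: "scaleC c 0 = 0" "scaleC 0 f = 0"
  by (rule L2_eqI, use rep_scaleC[of c 0] rep_scaleC[of 0 f] rep_zero_L2 in \<open>eventually_elim; simp\<close>)+

lemma scaleC_add: "scaleC c (f + g) = scaleC c f + scaleC c g"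
  by (rule L2_eqI, use rep_scaleC[of c "f + g"] rep_scaleC[of c f] rep_scaleC[of c g]
      rep_plus_L2[of f g] rep_plus_L2[of "scaleC c f" "scaleC c g"]
      in \<open>eventually_elim; simp add: algebra_simps\<close>)

lemma scaleC_minus: "scaleC c (f - g) = scaleC c f - scaleC c g"
  by (rule L2_eqI, use rep_scaleC[of c "f - g"] rep_scaleC[of c f] rep_scaleC[of c g]
      rep_minus_L2[of f g] rep_minus_L2[of "scaleC c f" "scaleC c g"]
      in \<open>eventually_elim; simp add: right_diff_distrib\<close>)

lemma scaleC_uminus: "scaleC c (- f) = - scaleC c f"
  by (rule L2_eqI, use rep_scaleC[of c "- f"] rep_scaleC[of c f]
      rep_uminus_L2[of f] rep_uminus_L2[of "scaleC c f"]
      in \<open>eventually_elim; simp add: algebra_simps\<close>)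

lemma scaleC_uminus_left: "scaleC (- c) f = - scaleC c f"
  by (rule L2_eqI, use rep_scaleC[of "- c" f] rep_scaleC[of c f] rep_uminus_L2[of "scaleC c f"]
      in \<open>eventually_elim; simp add: algebra_simps\<close>)

lemma scaleC_scaleC: "scaleC c (scaleC d f) = scaleC (c * d) f"
  by (rule L2_eqI, use rep_scaleC[of c "scaleC d f"] rep_scaleC[of d f] rep_scaleC[of "c * d" f]
      in \<open>eventually_elim; simp add: algebra_simps\<close>)

lemma scaleC_one: "scaleC 1 f = f"
  by (rule L2_eqI, use rep_scaleC[of 1 f] in \<open>eventually_elim; simp\<close>)

lemma scaleC_of_real: "scaleC (of_real r) f = r *\<^sub>R f"
  by (rule L2_eqI, use rep_scaleC[of "of_real r" f] rep_scaleR_L2[of r f] in \<open>eventually_elim; simp\<close>)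

text \<open>A bilinear form rather than the Hermitian one. It makes -u'' - w u symmetric for every
  complex \<open>w\<close>, so no conjugate spectral parameter enters; where positivity is wanted,
  the conjugate is inserted explicitly through \<open>cnj_L2\<close>.\<close>

definition pairing :: "L2 \<Rightarrow> L2 \<Rightarrow> complex" where
  "pairing f g = integral {0..1} (\<lambda>x. rep_L2 f x * rep_L2 g x)"

definition cnj_L2 :: "L2 \<Rightarrow> L2" where
  "cnj_L2 f = abs_L2 (\<lambda>x. cnj (rep_L2 f x))"

lemma rep_cnj_L2: "AE x in lebesgue01. rep_L2 (cnj_L2 f) x = cnj (rep_L2 f x)"
  unfolding cnj_L2_def by (intro rep_abs_L2 square_integrable_cnj square_integrable_rep)

lemma pairing_eq:
  assumes "AE x in lebesgue01. rep_L2 f x = u x" "AE x in lebesgue01. rep_L2 g x = v x"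
  shows "pairing f g = integral {0..1} (\<lambda>x. u x * v x)"
  unfolding pairing_def by (rule integral_cong_AE01) (use assms in \<open>eventually_elim; simp\<close>, simp)

lemma pairing_commute: "pairing f g = pairing g f"
  by (simp add: pairing_def mult.commute)

lemma pairing_integrable: "(\<lambda>x. rep_L2 f x * rep_L2 g x) integrable_on {0..1}"
  using square_integrable_product(1)[OF square_integrable_rep square_integrable_rep]
  by (simp add: absolutely_integrable_on_def)

lemma pairing_minus_left: "pairing (f - g) k = pairing f k - pairing g k"
proof -
  have "pairing (f - g) k = integral {0..1} (\<lambda>x. (rep_L2 f x - rep_L2 g x) * rep_L2 k x)"
    by (rule pairing_eq) (use rep_minus_L2 in auto)
  then show ?thesis
    by (simp add: pairing_def left_diff_distrib Henstock_Kurzweil_Integration.integral_diff pairing_integrable)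
qed

lemma pairing_scaleC_left: "pairing (scaleC c f) g = c * pairing f g"
proof -
  have "pairing (scaleC c f) g = integral {0..1} (\<lambda>x. (c * rep_L2 f x) * rep_L2 g x)"
    by (rule pairing_eq) (use rep_scaleC in auto)
  then show ?thesis by (simp add: pairing_def mult.assoc)
qed

lemma pairing_uminus_left: "pairing (- f) g = - pairing f g"
  using pairing_scaleC_left[of "-1" f g] by (simp add: scaleC_uminus_left scaleC_one)

lemma pairing_zero_left: "pairing 0 g = 0"
  using pairing_scaleC_left[of 0 0 g] by (simp add: scaleC_zero)

lemma pairing_minus_right: "pairing k (f - g) = pairing k f - pairing k g"
  by (metis pairing_commute pairing_minus_left)

lemma pairing_scaleC_right: "pairing g (scaleC c f) = c * pairing g f"
  by (metis pairing_commute pairing_scaleC_left)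

lemma pairing_uminus_right: "pairing g (- f) = - pairing g f"
  by (metis pairing_commute pairing_uminus_left)

section \<open>The norm and the Cauchy-Schwarz inequality\<close>

lemma norm_L2_squared: "(norm f)\<^sup>2 = integral {0..1} (\<lambda>x. (cmod (rep_L2 f x))\<^sup>2)"
proof -
  have "f \<bullet> f = integral\<^sup>L lebesgue01 (\<lambda>x. (cmod (rep_L2 f x))\<^sup>2)"
    by (simp add: inner_L2.rep_eq dot_square_norm)
  also have "\<dots> = integral {0..1} (\<lambda>x. (cmod (rep_L2 f x))\<^sup>2)"
    by (intro integral_lebesgue01 square_integrable_imp square_integrable_rep)
  finally show ?thesis by (simp add: dot_square_norm)
qed

lemma norm_L2_squared_eq:
  assumes "AE x in lebesgue01. rep_L2 f x = u x"
  shows "(norm f)\<^sup>2 = integral {0..1} (\<lambda>x. (cmod (u x))\<^sup>2)"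
  unfolding norm_L2_squared by (rule integral_cong_AE01) (use assms in auto)

lemma norm_L2_le:
  assumes "AE x in lebesgue01. rep_L2 f x = u x" "\<And>x. x \<in> {0..1} \<Longrightarrow> cmod (u x) \<le> B"
  shows "norm f \<le> B"
proof (rule power2_le_imp_le)
  show "0 \<le> B" using assms(2)[of 0] norm_ge_zero[of "u 0"] by (simp del: norm_ge_zero)
  have sq: "(cmod (u x))\<^sup>2 \<le> B\<^sup>2" if "x \<in> {0..1}" for x using assms(2)[OF that] by (simp add: power_mono)
  have "(\<lambda>x. (cmod (u x))\<^sup>2) absolutely_integrable_on {0..1}"
    by (rule absolutely_integrable_cong_AE01[OF _ square_integrable_imp(2)[OF square_integrable_rep[of f]]])
      (use assms(1) in auto)
  then have "integral {0..1} (\<lambda>x. (cmod (u x))\<^sup>2) \<le> integral {0..1} (\<lambda>x::real. B\<^sup>2)"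
    using sq by (intro integral_le) (auto simp: absolutely_integrable_on_def)
  then show "(norm f)\<^sup>2 \<le> B\<^sup>2" unfolding norm_L2_squared_eq[OF assms(1)] by simp
qed

lemma norm_scaleC: "norm (scaleC c f) = cmod c * norm f"
proof -
  have "(norm (scaleC c f))\<^sup>2 = integral {0..1} (\<lambda>x. (cmod c)\<^sup>2 * (cmod (rep_L2 f x))\<^sup>2)"
    using norm_L2_squared_eq[OF rep_scaleC[of c f]] by (simp add: norm_mult power_mult_distrib)
  also have "\<dots> = (cmod c * norm f)\<^sup>2" by (simp add: norm_L2_squared power_mult_distrib)
  finally show ?thesis by (simp add: power2_eq_iff_nonneg)
qed

lemma norm_cnj_L2: "norm (cnj_L2 f) = norm f"
proof -
  have "(norm (cnj_L2 f))\<^sup>2 = (norm f)\<^sup>2"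
    using norm_L2_squared_eq[OF rep_cnj_L2[of f]] by (simp add: norm_L2_squared)
  then show ?thesis by (simp add: power2_eq_iff_nonneg)
qed

lemma pairing_cnj_self: "pairing f (cnj_L2 f) = of_real ((norm f)\<^sup>2)"
proof -
  have "pairing f (cnj_L2 f) = integral {0..1} (\<lambda>x. rep_L2 f x * cnj (rep_L2 f x))"
    by (rule pairing_eq) (use rep_cnj_L2 in auto)
  also have "\<dots> = integral {0..1} (\<lambda>x. complex_of_real ((cmod (rep_L2 f x))\<^sup>2))"
    by (simp add: complex_norm_square del: of_real_power)
  also have "\<dots> = of_real (integral {0..1} (\<lambda>x. (cmod (rep_L2 f x))\<^sup>2))"
    using square_integrable_imp(2)[OF square_integrable_rep[of f]]
    by (intro integral_unique has_integral_of_real integrable_integral) (simp add: absolutely_integrable_on_def)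
  finally show ?thesis by (simp add: norm_L2_squared)
qed

text \<open>The inner product of the type is a real part, in which phases can cancel. Passing to
  moduli keeps the norms and removes the phases, so the real Cauchy-Schwarz inequality yields the
  full estimate.\<close>

lemma integral_cmod_product_le: "integral {0..1} (\<lambda>x. cmod (rep_L2 f x) * cmod (rep_L2 g x)) \<le> norm f * norm g"
proof -
  define a where "a h = abs_L2 (\<lambda>x. complex_of_real (cmod (rep_L2 h x)))" for h
  have ra: "AE x in lebesgue01. rep_L2 (a h) x = complex_of_real (cmod (rep_L2 h x))" for h
    unfolding a_def
  proof (rule rep_abs_L2)
    have "rep_L2 h \<in> borel_measurable lebesgue01" "integrable lebesgue01 (\<lambda>x. (cmod (rep_L2 h x))\<^sup>2)"
      using square_integrable_rep by (auto simp: square_integrable_def)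
    then show "square_integrable (\<lambda>x. complex_of_real (cmod (rep_L2 h x)))"
      by (auto simp: square_integrable_def)
  qed
  have na: "norm (a h) = norm h" for h
  proof -
    have "(norm (a h))\<^sup>2 = (norm h)\<^sup>2"
      using norm_L2_squared_eq[OF ra[of h]] by (simp add: norm_L2_squared)
    then show ?thesis by (simp add: power2_eq_iff_nonneg)
  qed
  have "a f \<bullet> a g = integral\<^sup>L lebesgue01 (\<lambda>x. rep_L2 (a f) x \<bullet> rep_L2 (a g) x)"
    by (simp add: inner_L2.rep_eq)
  also have "\<dots> = integral {0..1} (\<lambda>x. rep_L2 (a f) x \<bullet> rep_L2 (a g) x)"
    by (intro integral_lebesgue01) (simp add: integrable_lebesgue01_iff[symmetric] integrable_inner_square_integrable square_integrable_rep)
  also have "\<dots> = integral {0..1} (\<lambda>x. cmod (rep_L2 f x) * cmod (rep_L2 g x))"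
    by (rule integral_cong_AE01) (use ra[of f] ra[of g] in \<open>eventually_elim; simp add: inner_complex_def\<close>, simp)
  finally show ?thesis using norm_cauchy_schwarz[of "a f" "a g"] by (simp add: na)
qed

lemma norm_pairing_le: "cmod (pairing f g) \<le> norm f * norm g"
proof -
  have "cmod (pairing f g) \<le> integral {0..1} (\<lambda>x. cmod (rep_L2 f x) * cmod (rep_L2 g x))"
    unfolding pairing_def
    using square_integrable_product[OF square_integrable_rep[of f] square_integrable_rep[of g]]
    by (intro integral_norm_bound_integral) (auto simp: absolutely_integrable_on_def norm_mult)
  then show ?thesis using integral_cmod_product_le[of f g] by linarith
qed

lemma integral_cmod_rep_le: "integral {0..1} (\<lambda>x. cmod (rep_L2 f x)) \<le> norm f"
proof -
  define e where "e = abs_L2 (\<lambda>x. 1)"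
  have e: "AE x in lebesgue01. rep_L2 e x = 1"
    unfolding e_def by (intro rep_abs_L2 square_integrable_continuous) simp
  have "integral {0..1} (\<lambda>x. cmod (rep_L2 f x)) = integral {0..1} (\<lambda>x. cmod (rep_L2 f x) * cmod (rep_L2 e x))"
    by (rule integral_cong_AE01) (use e in auto)
  also have "\<dots> \<le> norm f * norm e" by (rule integral_cmod_product_le)
  also have "\<dots> \<le> norm f" using norm_L2_le[OF e, of 1] by (simp add: mult_left_le)
  finally show ?thesis .
qed

subsection \<open>The second derivative with Dirichlet or Neumann conditions\<close>

text \<open>The classical description of W^{2,2}: \<open>u'\<close> is absolutely continuous with
  density \<open>g\<close>. The integral form avoids a pointwise second derivative, and
  \<open>u\<close> and \<open>u'\<close> are arguments because boundary conditions are read off from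
  them.\<close>

definition has_deriv2_rep :: "L2 \<Rightarrow> L2 \<Rightarrow> (real \<Rightarrow> complex) \<Rightarrow> (real \<Rightarrow> complex) \<Rightarrow> bool" where
  "has_deriv2_rep f g u u' \<longleftrightarrow>
     (AE x in lebesgue01. rep_L2 f x = u x) \<and>
     (\<forall>x\<in>{0..1}. (u has_vector_derivative u' x) (at x within {0..1})) \<and>
     (\<forall>x\<in>{0..1}. u' x = u' 0 + integral {0..x} (rep_L2 g))"

lemma has_deriv2_repD:
  assumes "has_deriv2_rep f g u u'"
  shows "AE x in lebesgue01. rep_L2 f x = u x"
    "\<And>x. x \<in> {0..1} \<Longrightarrow> (u has_vector_derivative u' x) (at x within {0..1})"
    "\<And>x. x \<in> {0..1} \<Longrightarrow> u' x = u' 0 + integral {0..x} (rep_L2 g)"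
    "continuous_on {0..1} u" "continuous_on {0..1} u'"
proof -
  show *: "AE x in lebesgue01. rep_L2 f x = u x"
    "\<And>x. x \<in> {0..1} \<Longrightarrow> (u has_vector_derivative u' x) (at x within {0..1})"
    "\<And>x. x \<in> {0..1} \<Longrightarrow> u' x = u' 0 + integral {0..x} (rep_L2 g)"
    using assms unfolding has_deriv2_rep_def by blast+
  show "continuous_on {0..1} u" using *(2) by (rule continuous_on_vector_derivative)
  have "continuous_on {0..1} (\<lambda>x. u' 0 + integral {0..x} (rep_L2 g))"
    by (intro continuous_intros continuous_on_indefinite_integral01 square_integrable_imp square_integrable_rep)
  then show "continuous_on {0..1} u'" using *(3) by (metis (no_types, lifting) continuous_on_cong)
qed

lemma vector_derivative_indefinite_integral:
  fixes u u' :: "real \<Rightarrow> 'a::banach"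
  assumes "\<And>x. x \<in> {0..1} \<Longrightarrow> (u has_vector_derivative u' x) (at x within {0..1})" "x \<in> {0..1::real}"
  shows "u x = u 0 + integral {0..x} u'"
proof -
  have d: "(u has_vector_derivative u' y) (at y within {0..x})" if "y \<in> {0..x}" for y
    using that assms(2) by (intro has_vector_derivative_within_subset[OF assms(1)]) auto
  have "(u' has_integral u x - u 0) {0..x}"
    by (rule fundamental_theorem_of_calculus) (use assms(2) d in auto)
  then show ?thesis by (simp add: integral_unique)
qed

lemma integral_by_parts_real_compact:
  fixes p p' :: "real \<Rightarrow> real" and h H :: "real \<Rightarrow> complex"
  assumes p: "\<And>x. (p has_real_derivative p' x) (at x)" and p': "continuous_on {0..1} p'"
    and bc: "p 0 = 0" "p 1 = 0"
    and h: "h absolutely_integrable_on {0..1}"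
    and H: "\<And>x. x \<in> {0..1} \<Longrightarrow> H x = H 0 + integral {0..x} h"
  shows "integral {0..1} (\<lambda>x. p' x *\<^sub>R H x) = - integral {0..1} (\<lambda>x. p x *\<^sub>R h x)"
proof -
  have "integral {0..1} (\<lambda>x. of_real (p x) * h x) = of_real (p 1) * H 1 - of_real (p 0) * H 0
      - integral {0..1} (\<lambda>x. of_real (p' x) * H x)"
  proof (rule integral_by_parts_indefinite[OF h _ _ H])
    show "((\<lambda>x. complex_of_real (p x)) has_vector_derivative of_real (p' x)) (at x within {0..1})" for x
      using p by (intro has_vector_derivative_of_real) (auto intro: has_field_derivative_at_within)
    show "continuous_on {0..1} (\<lambda>x. complex_of_real (p' x))" by (intro continuous_intros p')
  qed auto
  then show ?thesis by (simp add: bc scaleR_conv_of_real)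
qed

lemma integral_lebesgue01_test:
  assumes "continuous_on {0..1} p" "AE x in lebesgue01. rep_L2 f x = u x"
  shows "(\<integral>x. p x *\<^sub>R rep_L2 f x \<partial>lebesgue01) = integral {0..1} (\<lambda>x. p x *\<^sub>R u x)"
proof -
  have "(\<lambda>x. of_real (p x) * rep_L2 f x) absolutely_integrable_on {0..1}"
    by (intro absolutely_integrable_continuous_mult continuous_intros assms square_integrable_imp square_integrable_rep)
  then have "(\<integral>x. p x *\<^sub>R rep_L2 f x \<partial>lebesgue01) = integral {0..1} (\<lambda>x. p x *\<^sub>R rep_L2 f x)"
    by (intro integral_lebesgue01) (simp add: scaleR_conv_of_real)
  also have "\<dots> = integral {0..1} (\<lambda>x. p x *\<^sub>R u x)"
    by (rule integral_cong_AE01) (use assms in auto)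
  finally show ?thesis .
qed

lemma integral_deriv2_test:
  fixes u u' :: "real \<Rightarrow> complex"
  assumes \<psi>: "test_function \<psi>"
    and u: "\<And>x. x \<in> {0..1} \<Longrightarrow> (u has_vector_derivative u' x) (at x within {0..1})"
    and u': "continuous_on {0..1} u'"
  shows "integral {0..1} (\<lambda>x. (deriv ^^ 2) \<psi> x *\<^sub>R u x) = - integral {0..1} (\<lambda>x. deriv \<psi> x *\<^sub>R u' x)"
  by (intro integral_by_parts_real_compact test_function_deriv test_function_boundary \<psi> u'
      absolutely_integrable_continuous_real vector_derivative_indefinite_integral u)

lemma has_deriv2_rep_imp_weak:
  assumes "has_deriv2_rep f g u u'"
  shows "has_weak_deriv2 f g"
  unfolding has_weak_deriv2_def
proof (intro allI impI)
  fix \<psi> assume \<psi>: "test_function \<psi>"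
  note a = has_deriv2_repD[OF assms]
  have "(\<integral>x. (deriv ^^ 2) \<psi> x *\<^sub>R rep_L2 f x \<partial>lebesgue01) = integral {0..1} (\<lambda>x. (deriv ^^ 2) \<psi> x *\<^sub>R u x)"
    by (intro integral_lebesgue01_test test_function_deriv \<psi> a)
  also have "\<dots> = - integral {0..1} (\<lambda>x. deriv \<psi> x *\<^sub>R u' x)"
    by (intro integral_deriv2_test \<psi> a)
  also have "integral {0..1} (\<lambda>x. deriv \<psi> x *\<^sub>R u' x) = - integral {0..1} (\<lambda>x. \<psi> x *\<^sub>R rep_L2 g x)"
    by (intro integral_by_parts_real_compact test_function_deriv test_function_boundary \<psi> a
        square_integrable_imp square_integrable_rep)
  also have "integral {0..1} (\<lambda>x. \<psi> x *\<^sub>R rep_L2 g x) = (\<integral>x. \<psi> x *\<^sub>R rep_L2 g x \<partial>lebesgue01)"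
    by (intro integral_lebesgue01_test[symmetric] test_function_deriv \<psi>) auto
  finally show "(\<integral>x. (deriv ^^ 2) \<psi> x *\<^sub>R rep_L2 f x \<partial>lebesgue01) = (\<integral>x. \<psi> x *\<^sub>R rep_L2 g x \<partial>lebesgue01)"
    by simp
qed

text \<open>Integration by parts shows that \<open>u'\<close> minus the indefinite integral of
  \<open>g\<close> is orthogonal to every derivative of a test function, hence constant.\<close>

lemma has_deriv2_rep_if_weak:
  assumes C1: "C1_representative f u u'" and w: "has_weak_deriv2 f g"
  shows "has_deriv2_rep f g u u'"
proof -
  have u: "AE x in lebesgue01. rep_L2 f x = u x"
    "\<And>x. x \<in> {0..1} \<Longrightarrow> (u has_vector_derivative u' x) (at x within {0..1})"
    "continuous_on {0..1} u'"
    using C1 unfolding C1_representative_def by blast+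
  define G where "G x = integral {0..x} (rep_L2 g)" for x
  have g: "rep_L2 g absolutely_integrable_on {0..1}"
    by (intro square_integrable_imp square_integrable_rep)
  have contG: "continuous_on {0..1} G"
    unfolding G_def by (rule continuous_on_indefinite_integral01[OF g])
  have "u' x - G x = u' 0 - G 0" if "x \<in> {0..1}" for x
  proof (rule du_Bois_Reymond[OF _ _ that])
    show "continuous_on {0..1} (\<lambda>x. u' x - G x)" by (intro continuous_intros u contG)
    fix \<psi> assume \<psi>: "test_function \<psi>"
    have i: "(\<lambda>x. deriv \<psi> x *\<^sub>R u' x) integrable_on {0..1}" "(\<lambda>x. deriv \<psi> x *\<^sub>R G x) integrable_on {0..1}"
      by (intro integrable_continuous_real continuous_intros u contG test_function_deriv[OF \<psi>])+
    have "integral {0..1} (\<lambda>x. deriv \<psi> x *\<^sub>R G x) = - integral {0..1} (\<lambda>x. \<psi> x *\<^sub>R rep_L2 g x)"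
      by (intro integral_by_parts_real_compact test_function_deriv test_function_boundary \<psi> g) (simp add: G_def)
    also have "integral {0..1} (\<lambda>x. \<psi> x *\<^sub>R rep_L2 g x) = (\<integral>x. \<psi> x *\<^sub>R rep_L2 g x \<partial>lebesgue01)"
      by (intro integral_lebesgue01_test[symmetric] test_function_deriv \<psi>) auto
    also have "\<dots> = (\<integral>x. (deriv ^^ 2) \<psi> x *\<^sub>R rep_L2 f x \<partial>lebesgue01)"
      using w \<psi> by (simp add: has_weak_deriv2_def)
    also have "\<dots> = integral {0..1} (\<lambda>x. (deriv ^^ 2) \<psi> x *\<^sub>R u x)"
      by (intro integral_lebesgue01_test test_function_deriv \<psi> u)
    also have "\<dots> = - integral {0..1} (\<lambda>x. deriv \<psi> x *\<^sub>R u' x)"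
      by (intro integral_deriv2_test \<psi> u)
    finally show "integral {0..1} (\<lambda>x. deriv \<psi> x *\<^sub>R (u' x - G x)) = 0"
      using i by (simp add: scaleR_diff_right Henstock_Kurzweil_Integration.integral_diff)
  qed
  moreover have "G 0 = 0" by (simp add: G_def)
  ultimately have "u' x = u' 0 + G x" if "x \<in> {0..1}" for x
    using that by (metis add_diff_cancel_left' diff_add_cancel diff_zero add.commute)
  then show ?thesis unfolding has_deriv2_rep_def G_def using u by blast
qed

text \<open>This justifies the definite description in \<open>weak_deriv2\<close>. The indefinite
  integral of g - k is orthogonal to all derivatives of test functions, so it is constant, namely 0,
  and its density vanishes almost everywhere.\<close>

lemma has_weak_deriv2_unique:
  assumes "has_weak_deriv2 f g" "has_weak_deriv2 f k"
  shows "g = k"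
proof -
  have i: "rep_L2 h absolutely_integrable_on {0..1}" for h
    by (intro square_integrable_imp square_integrable_rep)
  define G where "G x = integral {0..x} (rep_L2 (g - k))" for x
  have "G x = G 0" if "x \<in> {0..1}" for x
  proof (rule du_Bois_Reymond[OF _ _ that])
    show "continuous_on {0..1} G"
      unfolding G_def by (rule continuous_on_indefinite_integral01[OF i])
    fix \<psi> assume \<psi>: "test_function \<psi>"
    have p: "(\<lambda>x. \<psi> x *\<^sub>R rep_L2 h x) integrable_on {0..1}" for h
      using absolutely_integrable_continuous_mult[OF _ i[of h], of "\<lambda>x. of_real (\<psi> x)"] test_function_deriv[OF \<psi>]
      by (simp add: scaleR_conv_of_real absolutely_integrable_on_def continuous_intros)
    have "integral {0..1} (\<lambda>x. deriv \<psi> x *\<^sub>R G x) = - integral {0..1} (\<lambda>x. \<psi> x *\<^sub>R rep_L2 (g - k) x)"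
      by (intro integral_by_parts_real_compact test_function_deriv test_function_boundary \<psi> i) (simp add: G_def)
    also have "integral {0..1} (\<lambda>x. \<psi> x *\<^sub>R rep_L2 (g - k) x)
        = integral {0..1} (\<lambda>x. \<psi> x *\<^sub>R rep_L2 g x - \<psi> x *\<^sub>R rep_L2 k x)"
      by (rule integral_cong_AE01) (use rep_minus_L2[of g k] in \<open>eventually_elim; simp add: scaleR_diff_right\<close>, simp)
    also have "\<dots> = integral {0..1} (\<lambda>x. \<psi> x *\<^sub>R rep_L2 g x) - integral {0..1} (\<lambda>x. \<psi> x *\<^sub>R rep_L2 k x)"
      by (rule Henstock_Kurzweil_Integration.integral_diff[OF p p])
    also have "\<dots> = (\<integral>x. \<psi> x *\<^sub>R rep_L2 g x \<partial>lebesgue01) - (\<integral>x. \<psi> x *\<^sub>R rep_L2 k x \<partial>lebesgue01)"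
      by (intro arg_cong2[where f = "(-)"] integral_lebesgue01_test[symmetric] test_function_deriv \<psi>) auto
    also have "\<dots> = 0" using assms \<psi> by (simp add: has_weak_deriv2_def)
    finally show "integral {0..1} (\<lambda>x. deriv \<psi> x *\<^sub>R G x) = 0" by simp
  qed
  then have "AE x in lebesgue01. rep_L2 (g - k) x = 0"
    by (intro AE_0_if_indefinite_integral_0 i) (simp add: G_def)
  then have "AE x in lebesgue01. rep_L2 (g - k) x = rep_L2 0 x"
    using rep_zero_L2 by eventually_elim simp
  then have "g - k = 0" by (rule L2_eqI)
  then show ?thesis by simp
qed

lemma weak_deriv2_eq: "has_deriv2_rep f g u u' \<Longrightarrow> weak_deriv2 f = g"
  unfolding weak_deriv2_def
  by (rule the_equality) (erule has_deriv2_rep_imp_weak, metis has_deriv2_rep_imp_weak has_weak_deriv2_unique)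

text \<open>Both scalar problems run through the same proofs with the condition as a parameter; they
  differ only in which boundary data vanish.\<close>

datatype boundary_condition = Dirichlet | Neumann

fun satisfies :: "boundary_condition \<Rightarrow> (real \<Rightarrow> complex) \<Rightarrow> (real \<Rightarrow> complex) \<Rightarrow> bool" where
  "satisfies Dirichlet u u' \<longleftrightarrow> u 0 = 0 \<and> u 1 = 0"
| "satisfies Neumann u u' \<longleftrightarrow> u' 0 = 0 \<and> u' 1 = 0"

definition laplacian_dom :: "boundary_condition \<Rightarrow> L2 set" where
  "laplacian_dom b = {f. \<exists>g u u'. has_deriv2_rep f g u u' \<and> satisfies b u u'}"

lemma laplacian_domI:
  assumes "has_deriv2_rep f g u u'" "satisfies b u u'"
  shows "f \<in> laplacian_dom b" "weak_deriv2 f = g"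
  using assms weak_deriv2_eq by (auto simp: laplacian_dom_def)

lemma laplacian_domE:
  assumes "f \<in> laplacian_dom b"
  obtains u u' where "has_deriv2_rep f (weak_deriv2 f) u u'" "satisfies b u u'"
proof -
  obtain g u u' where "has_deriv2_rep f g u u'" "satisfies b u u'"
    using assms unfolding laplacian_dom_def by blast
  then show ?thesis using that weak_deriv2_eq by blast
qed

lemma Dom_D_iff: "f \<in> Dom_D \<longleftrightarrow> f $ 1 \<in> laplacian_dom Dirichlet \<and> f $ 2 \<in> laplacian_dom Neumann"
proof
  assume "f \<in> Dom_D"
  then obtain g1 g2 u u' v v' where a:
    "has_weak_deriv2 (f $ 1) g1" "has_weak_deriv2 (f $ 2) g2"
    "C1_representative (f $ 1) u u'" "u 0 = 0" "u 1 = 0"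
    "C1_representative (f $ 2) v v'" "v' 0 = 0" "v' 1 = 0"
    unfolding Dom_D_def W22_def by blast
  show "f $ 1 \<in> laplacian_dom Dirichlet \<and> f $ 2 \<in> laplacian_dom Neumann"
    using laplacian_domI(1)[OF has_deriv2_rep_if_weak[OF a(3,1)], of Dirichlet]
      laplacian_domI(1)[OF has_deriv2_rep_if_weak[OF a(6,2)], of Neumann] a by simp
next
  assume "f $ 1 \<in> laplacian_dom Dirichlet \<and> f $ 2 \<in> laplacian_dom Neumann"
  then obtain g1 g2 u u' v v' where
    a: "has_deriv2_rep (f $ 1) g1 u u'" "u 0 = 0" "u 1 = 0"
    "has_deriv2_rep (f $ 2) g2 v v'" "v' 0 = 0" "v' 1 = 0"
    unfolding laplacian_dom_def by auto
  then have "has_weak_deriv2 (f $ 1) g1" "has_weak_deriv2 (f $ 2) g2"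
    using has_deriv2_rep_imp_weak by blast+
  moreover have "C1_representative (f $ 1) u u'" "C1_representative (f $ 2) v v'"
    unfolding C1_representative_def using has_deriv2_repD[OF a(1)] has_deriv2_repD[OF a(4)] by blast+
  ultimately have "f \<in> W22" "\<exists>u u'. C1_representative (f $ 1) u u' \<and> u 0 = 0 \<and> u 1 = 0"
    "\<exists>u u'. C1_representative (f $ 2) u u' \<and> u' 0 = 0 \<and> u' 1 = 0"
    unfolding W22_def forall_2 using a by blast+
  then show "f \<in> Dom_D" unfolding Dom_D_def by simp
qed

lemma has_deriv2_rep_add:
  assumes f: "has_deriv2_rep f g u u'" and k: "has_deriv2_rep k l v v'"
  shows "has_deriv2_rep (f + scaleC c k) (g + scaleC c l) (\<lambda>x. u x + c * v x) (\<lambda>x. u' x + c * v' x)"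
  unfolding has_deriv2_rep_def
proof (intro conjI ballI)
  note a = has_deriv2_repD[OF f] and b = has_deriv2_repD[OF k]
  show "AE x in lebesgue01. rep_L2 (f + scaleC c k) x = u x + c * v x"
    using a(1) b(1) rep_plus_L2[of f "scaleC c k"] rep_scaleC[of c k] by eventually_elim simp
  fix x :: real assume x: "x \<in> {0..1}"
  show "((\<lambda>x. u x + c * v x) has_vector_derivative u' x + c * v' x) (at x within {0..1})"
    by (intro derivative_intros a(2)[OF x] b(2)[OF x])
  have i: "rep_L2 h integrable_on {0..x}" for h
    using integrable_sub01(2)[OF square_integrable_imp(1)[OF square_integrable_rep], of 0 x] x by simp
  have "integral {0..x} (rep_L2 (g + scaleC c l)) = integral {0..x} (\<lambda>x. rep_L2 g x + c * rep_L2 l x)"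
    by (rule integral_cong_AE01)
      (use rep_plus_L2[of g "scaleC c l"] rep_scaleC[of c l] x in \<open>auto elim: eventually_elim2\<close>)
  also have "\<dots> = integral {0..x} (rep_L2 g) + c * integral {0..x} (rep_L2 l)"
    using i by (simp add: Henstock_Kurzweil_Integration.integral_add integrable_on_mult_right)
  finally show "u' x + c * v' x = u' 0 + c * v' 0 + integral {0..x} (rep_L2 (g + scaleC c l))"
    using a(3)[OF x] b(3)[OF x] by (simp add: algebra_simps)
qed

lemma laplacian_dom_add:
  assumes "f \<in> laplacian_dom b" "k \<in> laplacian_dom b"
  shows "f + scaleC c k \<in> laplacian_dom b"
    "weak_deriv2 (f + scaleC c k) = weak_deriv2 f + scaleC c (weak_deriv2 k)"
proof -
  obtain u u' v v' where *: "has_deriv2_rep f (weak_deriv2 f) u u'" "satisfies b u u'"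
    "has_deriv2_rep k (weak_deriv2 k) v v'" "satisfies b v v'"
    using assms by (meson laplacian_domE)
  have "satisfies b (\<lambda>x. u x + c * v x) (\<lambda>x. u' x + c * v' x)" using *(2,4) by (cases b) auto
  then show "f + scaleC c k \<in> laplacian_dom b"
    "weak_deriv2 (f + scaleC c k) = weak_deriv2 f + scaleC c (weak_deriv2 k)"
    using laplacian_domI has_deriv2_rep_add[OF *(1,3)] by blast+
qed

lemma has_deriv2_rep_smooth:
  assumes u: "\<And>x. (u has_vector_derivative u' x) (at x)" and u': "\<And>x. (u' has_vector_derivative u'' x) (at x)"
    and u'': "continuous_on {0..1} u''"
  shows "has_deriv2_rep (abs_L2 u) (abs_L2 u'') u u'"
  unfolding has_deriv2_rep_def
proof (intro conjI ballI)
  have "continuous_on {0..1} u"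
    using u by (intro continuous_on_vector_derivative) (auto intro: has_vector_derivative_at_within)
  then show "AE x in lebesgue01. rep_L2 (abs_L2 u) x = u x"
    by (intro rep_abs_L2 square_integrable_continuous)
  fix x :: real assume x: "x \<in> {0..1}"
  show "(u has_vector_derivative u' x) (at x within {0..1})" using u by (rule has_vector_derivative_at_within)
  have "u' x = u' 0 + integral {0..x} u''"
    using x u' by (intro vector_derivative_indefinite_integral) (auto intro: has_vector_derivative_at_within)
  also have "integral {0..x} u'' = integral {0..x} (rep_L2 (abs_L2 u''))"
    using rep_abs_L2[OF square_integrable_continuous[OF u'']] x
    by (intro integral_cong_AE01) (auto elim: eventually_mono)
  finally show "u' x = u' 0 + integral {0..x} (rep_L2 (abs_L2 u''))" .
qed

text \<open>Both sides equal minus the integral of u' v'. In each boundary product one factor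
  vanishes at 0 and at 1, whichever condition is imposed, as long as it is the same for
  \<open>f\<close> and \<open>k\<close>.\<close>

lemma laplacian_green:
  assumes "f \<in> laplacian_dom b" "k \<in> laplacian_dom b"
  shows "pairing (weak_deriv2 f) k = pairing f (weak_deriv2 k)"
proof -
  obtain u u' v v' where *: "has_deriv2_rep f (weak_deriv2 f) u u'" "satisfies b u u'"
    "has_deriv2_rep k (weak_deriv2 k) v v'" "satisfies b v v'"
    using assms by (meson laplacian_domE)
  note u = has_deriv2_repD[OF *(1)] and v = has_deriv2_repD[OF *(3)]
  have i: "rep_L2 h absolutely_integrable_on {0..1}" for h
    by (intro square_integrable_imp square_integrable_rep)
  have b: "v 1 * u' 1 - v 0 * u' 0 = 0" "u 1 * v' 1 - u 0 * v' 0 = 0" using *(2,4) by (cases b; simp)+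
  have 1: "integral {0..1} (\<lambda>x. v x * rep_L2 (weak_deriv2 f) x) = v 1 * u' 1 - v 0 * u' 0
      - integral {0..1} (\<lambda>x. v' x * u' x)"
    by (intro integral_by_parts_indefinite i u v) auto
  have 2: "integral {0..1} (\<lambda>x. u x * rep_L2 (weak_deriv2 k) x) = u 1 * v' 1 - u 0 * v' 0
      - integral {0..1} (\<lambda>x. u' x * v' x)"
    by (intro integral_by_parts_indefinite i u v) auto
  have "pairing (weak_deriv2 f) k = integral {0..1} (\<lambda>x. v x * rep_L2 (weak_deriv2 f) x)"
    using pairing_eq[of "weak_deriv2 f" "rep_L2 (weak_deriv2 f)", OF _ v(1)] by (simp add: mult.commute)
  also have "\<dots> = integral {0..1} (\<lambda>x. u x * rep_L2 (weak_deriv2 k) x)"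
    unfolding 1 2 b by (simp add: mult.commute)
  also have "\<dots> = pairing f (weak_deriv2 k)"
    using pairing_eq[OF u(1), of "weak_deriv2 k" "rep_L2 (weak_deriv2 k)"] by simp
  finally show ?thesis .
qed

text \<open>The number is the Dirichlet energy, the integral of |u'|^2. It stays behind an
  existential because later steps use only that it is real and nonnegative.\<close>

lemma laplacian_energy:
  assumes "f \<in> laplacian_dom b"
  shows "\<exists>t\<ge>0. pairing (- weak_deriv2 f) (cnj_L2 f) = complex_of_real t"
proof -
  obtain u u' where *: "has_deriv2_rep f (weak_deriv2 f) u u'" "satisfies b u u'"
    using assms by (meson laplacian_domE)
  note u = has_deriv2_repD[OF *(1)]
  have b: "cnj (u 1) * u' 1 - cnj (u 0) * u' 0 = 0" using *(2) by (cases b) auto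
  have "AE x in lebesgue01. rep_L2 (cnj_L2 f) x = cnj (u x)"
    using u(1) rep_cnj_L2[of f] by eventually_elim simp
  then have "pairing (weak_deriv2 f) (cnj_L2 f) = integral {0..1} (\<lambda>x. cnj (u x) * rep_L2 (weak_deriv2 f) x)"
    using pairing_eq[of "weak_deriv2 f" "rep_L2 (weak_deriv2 f)"] by (simp add: mult.commute)
  also have "\<dots> = cnj (u 1) * u' 1 - cnj (u 0) * u' 0 - integral {0..1} (\<lambda>x. cnj (u' x) * u' x)"
  proof (rule integral_by_parts_indefinite)
    show "((\<lambda>x. cnj (u x)) has_vector_derivative cnj (u' x)) (at x within {0..1})" if "x \<in> {0..1}" for x
      using u(2)[OF that] by (rule has_vector_derivative_cnj)
  qed (intro continuous_intros square_integrable_imp square_integrable_rep u | simp)+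
  also have "\<dots> = - integral {0..1} (\<lambda>x. complex_of_real ((cmod (u' x))\<^sup>2))"
    unfolding b by (simp add: complex_norm_square mult.commute del: of_real_power)
  also have "integral {0..1} (\<lambda>x. complex_of_real ((cmod (u' x))\<^sup>2))
      = complex_of_real (integral {0..1} (\<lambda>x. (cmod (u' x))\<^sup>2))"
    by (intro integral_unique has_integral_of_real integrable_integral integrable_continuous_real
        continuous_intros u)
  finally have "pairing (- weak_deriv2 f) (cnj_L2 f) = complex_of_real (integral {0..1} (\<lambda>x. (cmod (u' x))\<^sup>2))"
    by (simp add: pairing_uminus_left)
  moreover have "0 \<le> integral {0..1} (\<lambda>x. (cmod (u' x))\<^sup>2)"
    by (intro Henstock_Kurzweil_Integration.integral_nonneg integrable_continuous_real continuous_intros u) simp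
  ultimately show ?thesis by blast
qed

subsection \<open>Solvability of the boundary value problems\<close>

lemma integral_cmod_mult_le:
  fixes p h :: "real \<Rightarrow> complex"
  assumes "continuous_on {0..1} p" "h absolutely_integrable_on {0..1}" "x \<in> {0..1}"
    "\<And>t. t \<in> {0..1} \<Longrightarrow> cmod (p t) \<le> M"
  shows "cmod (integral {0..x} (\<lambda>t. p t * h t)) \<le> M * integral {0..1} (\<lambda>t. cmod (h t))"
proof -
  have M: "0 \<le> M" using assms(4)[of 0] norm_ge_zero[of "p 0"] by (simp del: norm_ge_zero)
  have i: "(\<lambda>t. p t * h t) integrable_on {0..x}" "(\<lambda>t. M * cmod (h t)) integrable_on {0..x}"
    "(\<lambda>t. M * cmod (h t)) integrable_on {0..1}"
    using integrable_sub01[OF absolutely_integrable_continuous_mult[OF assms(1,2)], of 0 x]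
      integrable_sub01[OF assms(2), of 0 x] integrable_sub01[OF assms(2), of 0 1] assms(3)
    by (auto intro: integrable_on_mult_right)
  have "cmod (integral {0..x} (\<lambda>t. p t * h t)) \<le> integral {0..x} (\<lambda>t. M * cmod (h t))"
    using i assms(3,4) by (intro integral_norm_bound_integral) (auto simp: norm_mult intro!: mult_right_mono)
  also have "\<dots> \<le> integral {0..1} (\<lambda>t. M * cmod (h t))"
    using i assms(3) M by (intro integral_subset_le) auto
  finally show ?thesis by simp
qed

lemma has_vector_derivative_exp_mult:
  "((\<lambda>x. exp (c * complex_of_real x)) has_vector_derivative c * exp (c * complex_of_real x)) (at x within S)"
proof -
  have "((\<lambda>z. exp (c * z)) has_field_derivative c * exp (c * complex_of_real x)) (at (complex_of_real x) within of_real ` S)"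
    by (auto intro!: derivative_eq_intros)
  from field_vector_diff_chain_within[OF has_vector_derivative_of_real[OF DERIV_ident] this]
  show ?thesis by (simp add: o_def)
qed

lemma cmod_exp_mult_le:
  assumes "t \<in> {0..1}"
  shows "cmod (exp (c * complex_of_real t)) \<le> exp (cmod c)"
proof -
  have "cmod (exp (c * complex_of_real t)) \<le> exp (cmod (c * complex_of_real t))"
    by (rule norm_exp)
  also have "\<dots> \<le> exp (cmod c)" using assms by (simp add: norm_mult mult_left_le)
  finally show ?thesis .
qed

text \<open>Factor \<open>u'' - c\<^sup>2 u = h\<close> as \<open>v' + c v = h\<close>, \<open>u' - c u = v\<close>; only the first equation involves the merely integrable \<open>h\<close>.\<close>

lemma particular_solution:
  fixes c :: complex
  defines "B \<equiv> (cmod c + 1) * exp (cmod c) ^ 4"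
  obtains u u' where "\<And>x. x \<in> {0..1} \<Longrightarrow> (u has_vector_derivative u' x) (at x within {0..1})"
    "u 0 = 0" "u' 0 = 0"
    "\<And>x. x \<in> {0..1} \<Longrightarrow> u' x = integral {0..x} (rep_L2 h) + c\<^sup>2 * integral {0..x} u"
    "\<And>x. x \<in> {0..1} \<Longrightarrow> cmod (u x) \<le> B * norm h"
    "\<And>x. x \<in> {0..1} \<Longrightarrow> cmod (u' x) \<le> 2 * B * norm h"
proof -
  let ?e = "\<lambda>c x. exp (c * complex_of_real x)"
  \<comment> \<open>\<open>M\<close> bounds exp (c t) and exp (- c t) on [0, 1]. Each first-order
    equation costs two such factors, one inside and one outside its integral, which gives the fourth
    power in \<open>B\<close>; the factor cmod c + 1 comes from u' = c u + v.\<close>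
  define M where "M = exp (cmod c)"
  have M1: "1 \<le> M" by (simp add: M_def)
  have eM: "cmod (?e c t) \<le> M" "cmod (?e (- c) t) \<le> M" if "t \<in> {0..1}" for t
    using cmod_exp_mult_le[OF that, of c] cmod_exp_mult_le[OF that, of "- c"] by (simp_all add: M_def)
  have inv: "?e (- c) x * ?e c x = 1" "?e c x * ?e (- c) x = 1" for x
    by (simp_all flip: exp_add)
  have conte: "continuous_on S (?e c)" for S c by (intro continuous_intros)
  have h: "rep_L2 h absolutely_integrable_on {0..1}"
    by (intro square_integrable_imp square_integrable_rep)
  have eh: "(\<lambda>t. ?e c t * rep_L2 h t) absolutely_integrable_on {0..1}"
    by (rule absolutely_integrable_continuous_mult[OF conte h])
  define H where "H x = integral {0..x} (\<lambda>t. ?e c t * rep_L2 h t)" for x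
  define v where "v x = ?e (- c) x * H x" for x
  have contH: "continuous_on {0..1} H"
    unfolding H_def by (rule continuous_on_indefinite_integral01[OF eh])
  then have contv: "continuous_on {0..1} v" unfolding v_def by (intro continuous_intros)
  \<comment> \<open>This is v' + c v = h in integrated form. Integration by parts replaces the
    product rule for exp (- c x) H x, since \<open>H\<close> has only an integrable density.\<close>
  have v_int: "v x = integral {0..x} (rep_L2 h) - c * integral {0..x} v" if "x \<in> {0..1}" for x
  proof -
    have "integral {0..x} (\<lambda>t. ?e (- c) t * (?e c t * rep_L2 h t))
        = ?e (- c) x * H x - ?e (- c) 0 * H 0 - integral {0..x} (\<lambda>t. (- c * ?e (- c) t) * H t)"
      using that by (intro integral_by_parts_indefinite[OF eh] has_vector_derivative_exp_mult continuous_intros)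
        (simp_all add: H_def)
    moreover have "(\<lambda>t. ?e (- c) t * (?e c t * rep_L2 h t)) = rep_L2 h"
      using inv by (simp add: mult.assoc[symmetric])
    moreover have "integral {0..x} (\<lambda>t. (- c * ?e (- c) t) * H t) = - c * integral {0..x} v"
      unfolding v_def by (simp add: mult.assoc flip: integral_mult_right)
    ultimately show ?thesis by (simp add: v_def H_def)
  qed
  have v_le: "cmod (v x) \<le> M\<^sup>2 * norm h" if x: "x \<in> {0..1}" for x
  proof -
    have "cmod (H x) \<le> M * integral {0..1} (\<lambda>t. cmod (rep_L2 h t))"
      unfolding H_def by (intro integral_cmod_mult_le conte h x eM)
    also have "\<dots> \<le> M * norm h" using M1 by (intro mult_left_mono integral_cmod_rep_le) auto
    finally have "cmod (v x) \<le> M * (M * norm h)"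
      unfolding v_def norm_mult using eM[OF x] M1 by (intro mult_mono) auto
    then show ?thesis by (simp add: power2_eq_square mult.assoc)
  qed
  \<comment> \<open>The second equation has the continuous right-hand side \<open>v\<close>, so
    ordinary differentiation of the integral is enough here.\<close>
  define U where "U x = integral {0..x} (\<lambda>t. ?e (- c) t * v t)" for x
  define u where "u x = ?e c x * U x" for x
  define u' where "u' x = c * u x + v x" for x
  have Uder: "(U has_vector_derivative ?e (- c) x * v x) (at x within {0..1})" if "x \<in> {0..1}" for x
    unfolding U_def by (intro integral_has_vector_derivative continuous_intros contv that)
  have uder: "(u has_vector_derivative u' x) (at x within {0..1})" if x: "x \<in> {0..1}" for x
  proof -
    have "(u has_vector_derivative (?e c x * (?e (- c) x * v x) + c * ?e c x * U x)) (at x within {0..1})"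
      unfolding u_def by (rule has_vector_derivative_mult[OF has_vector_derivative_exp_mult Uder[OF x]])
    moreover have "?e c x * (?e (- c) x * v x) + c * ?e c x * U x = u' x"
      unfolding u'_def u_def by (subst mult.assoc[symmetric]) (simp only: inv, simp)
    ultimately show ?thesis by simp
  qed
  have contu: "continuous_on {0..1} u" using uder by (rule continuous_on_vector_derivative)
  have u0: "u 0 = 0" by (simp add: u_def U_def)
  have v0: "v 0 = 0" by (simp add: v_def H_def)
  have u'_int: "u' x = integral {0..x} (rep_L2 h) + c\<^sup>2 * integral {0..x} u" if x: "x \<in> {0..1}" for x
  proof -
    have i: "u integrable_on {0..x}" "v integrable_on {0..x}"
      using contu contv x by (auto intro!: integrable_continuous_real elim: continuous_on_subset)
    have "u x = integral {0..x} u'" using vector_derivative_indefinite_integral[OF uder x] u0 by simp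
    also have "\<dots> = c * integral {0..x} u + integral {0..x} v"
      unfolding u'_def using i
      by (subst Henstock_Kurzweil_Integration.integral_add) (auto intro: integrable_on_mult_right)
    finally show ?thesis unfolding u'_def v_int[OF x] by (simp add: algebra_simps power2_eq_square)
  qed
  have u_le: "cmod (u x) \<le> M ^ 4 * norm h" if x: "x \<in> {0..1}" for x
  proof -
    have "cmod (U x) \<le> M * integral {0..1} (\<lambda>t. cmod (v t))"
      unfolding U_def by (intro integral_cmod_mult_le conte x eM absolutely_integrable_continuous_real contv)
    also have "\<dots> \<le> M * integral {0..1} (\<lambda>t::real. M\<^sup>2 * norm h)"
      using M1 v_le by (intro mult_left_mono integral_le integrable_continuous_real continuous_intros contv) auto
    finally have "cmod (u x) \<le> M * (M * (M\<^sup>2 * norm h))"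
      unfolding u_def norm_mult using eM[OF x] M1 by (intro mult_mono) auto
    then show ?thesis by (simp add: power2_eq_square power4_eq_xxxx mult.assoc)
  qed
  have B: "B = (cmod c + 1) * M ^ 4" by (simp add: B_def M_def)
  have M4: "M ^ 4 \<le> B" unfolding B using M1 by (simp add: mult_le_cancel_right1)
  have u_le': "cmod (u x) \<le> B * norm h" if "x \<in> {0..1}" for x
    using u_le[OF that] mult_right_mono[OF M4 norm_ge_zero[of h]] by linarith
  have u'_le: "cmod (u' x) \<le> 2 * B * norm h" if x: "x \<in> {0..1}" for x
  proof -
    have "cmod (u' x) \<le> cmod c * cmod (u x) + cmod (v x)"
      unfolding u'_def by (metis norm_mult norm_triangle_ineq)
    also have "\<dots> \<le> cmod c * (M ^ 4 * norm h) + M ^ 4 * norm h"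
    proof (intro add_mono mult_left_mono u_le x)
      have "M\<^sup>2 \<le> M ^ 4" using M1 by (intro power_increasing) auto
      then show "cmod (v x) \<le> M ^ 4 * norm h"
        using v_le[OF x] mult_right_mono[of "M\<^sup>2" "M ^ 4" "norm h"] by simp
    qed auto
    also have "\<dots> = B * norm h" by (simp add: B algebra_simps)
    also have "\<dots> \<le> 2 * B * norm h" using M1 by (simp add: B)
    finally show ?thesis .
  qed
  show ?thesis using that[OF uder u0 _ u'_int u_le' u'_le] by (simp add: u'_def u0 v0)
qed

text \<open>A shooting argument: the particular solution has zero Cauchy data at 0, and adding a
  multiple of a homogeneous solution that already satisfies the condition at 0 adjusts the remaining
  condition at 1. The hypothesis on \<open>c\<close> says that this homogeneous solution violates
  the condition at 1.\<close>

lemma solve_bvp: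
  assumes c: "exp (2 * c) \<noteq> 1"
  shows "\<exists>B. \<forall>h. \<exists>f\<in>laplacian_dom b. weak_deriv2 f - scaleC (c\<^sup>2) f = h \<and> norm f \<le> B * norm h"
proof -
  \<comment> \<open>With \<sigma> = - 1 the function \<open>s 0\<close> is twice sinh (c x), with
    \<sigma> = 1 it is twice cosh (c x); \<open>s k\<close> is its k-th derivative.\<close>
  define \<sigma> :: complex where "\<sigma> = (case b of Dirichlet \<Rightarrow> - 1 | Neumann \<Rightarrow> 1)"
  define s where "s k x = c ^ k * (exp (c * complex_of_real x) + (- 1) ^ k * \<sigma> * exp (- c * complex_of_real x))" for k x
  have sder: "(s k has_vector_derivative s (Suc k) x) (at x)" for k x
    unfolding s_def
    by (rule has_vector_derivative_eq_rhs,
        (rule derivative_intros has_vector_derivative_exp_mult)+) (simp add: algebra_simps)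
  have conts: "continuous_on S (s k)" for S k unfolding s_def by (intro continuous_intros)
  have c0: "c \<noteq> 0" using c by auto
  have "exp c \<noteq> exp (- c)"
    using c exp_add[of c c] exp_add[of c "- c"] by (auto simp flip: mult_2)
  then have s1: "(case b of Dirichlet \<Rightarrow> s 0 1 | Neumann \<Rightarrow> s 1 1) \<noteq> 0" (is "?d \<noteq> 0")
    using c0 by (cases b) (auto simp: s_def \<sigma>_def)
  define e where "e = abs_L2 (s 0)"
  have erep: "has_deriv2_rep e (abs_L2 (s 2)) (s 0) (s 1)"
    unfolding e_def using sder[of 0] sder[of 1]
    by (intro has_deriv2_rep_smooth conts) (simp_all add: numeral_2_eq_2)
  have e2: "abs_L2 (s 2) = scaleC (c\<^sup>2) e"
  proof (rule L2_eqI)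
    have s2: "s 2 x = c\<^sup>2 * s 0 x" for x by (simp add: s_def)
    show "AE x in lebesgue01. rep_L2 (abs_L2 (s 2)) x = rep_L2 (scaleC (c\<^sup>2) e) x"
      using rep_abs_L2[OF square_integrable_continuous[OF conts], of 2] has_deriv2_repD(1)[OF erep] rep_scaleC[of "c\<^sup>2" e]
      by eventually_elim (simp add: s2)
  qed
  define B where "B = (cmod c + 1) * exp (cmod c) ^ 4"
  have "B \<ge> 0" by (simp add: B_def)
  have "\<exists>f\<in>laplacian_dom b. weak_deriv2 f - scaleC (c\<^sup>2) f = h \<and> norm f \<le> (B + 2 * B / cmod ?d * norm e) * norm h" for h
  proof -
    obtain u u' where u: "\<And>x. x \<in> {0..1} \<Longrightarrow> (u has_vector_derivative u' x) (at x within {0..1})"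
      "u 0 = 0" "u' 0 = 0"
      "\<And>x. x \<in> {0..1} \<Longrightarrow> u' x = integral {0..x} (rep_L2 h) + c\<^sup>2 * integral {0..x} u"
      "\<And>x. x \<in> {0..1} \<Longrightarrow> cmod (u x) \<le> B * norm h"
      "\<And>x. x \<in> {0..1} \<Longrightarrow> cmod (u' x) \<le> 2 * B * norm h"
      using particular_solution[of h c] unfolding B_def by blast
    have contu: "continuous_on {0..1} u" using u(1) by (rule continuous_on_vector_derivative)
    define f0 where "f0 = abs_L2 u"
    have f0: "AE x in lebesgue01. rep_L2 f0 x = u x"
      unfolding f0_def by (intro rep_abs_L2 square_integrable_continuous contu)
    have f0rep: "has_deriv2_rep f0 (h + scaleC (c\<^sup>2) f0) u u'"
      unfolding has_deriv2_rep_def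
    proof (intro conjI ballI f0 u(1))
      fix x :: real assume x: "x \<in> {0..1}"
      have i: "rep_L2 h integrable_on {0..x}" "u integrable_on {0..x}"
        using integrable_sub01(2)[OF square_integrable_imp(1)[OF square_integrable_rep], of 0 x]
          continuous_on_subset[OF contu, of "{0..x}"] x by (auto intro: integrable_continuous_real)
      have "integral {0..x} (rep_L2 (h + scaleC (c\<^sup>2) f0)) = integral {0..x} (\<lambda>x. rep_L2 h x + c\<^sup>2 * u x)"
        by (rule integral_cong_AE01)
          (use f0 rep_plus_L2[of h "scaleC (c\<^sup>2) f0"] rep_scaleC[of "c\<^sup>2" f0] in \<open>eventually_elim; simp\<close>, use x in simp)
      also have "\<dots> = integral {0..x} (rep_L2 h) + c\<^sup>2 * integral {0..x} u"
        using i by (simp add: Henstock_Kurzweil_Integration.integral_add integrable_on_mult_right)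
      finally show "u' x = u' 0 + integral {0..x} (rep_L2 (h + scaleC (c\<^sup>2) f0))" using u(3) u(4)[OF x] by simp
    qed
    define k where "k = - (case b of Dirichlet \<Rightarrow> u 1 | Neumann \<Rightarrow> u' 1) / ?d"
    define f where "f = f0 + scaleC k e"
    have frep: "has_deriv2_rep f (h + scaleC (c\<^sup>2) f0 + scaleC k (scaleC (c\<^sup>2) e))
        (\<lambda>x. u x + k * s 0 x) (\<lambda>x. u' x + k * s 1 x)"
      unfolding f_def by (intro has_deriv2_rep_add f0rep erep[unfolded e2])
    have "satisfies b (\<lambda>x. u x + k * s 0 x) (\<lambda>x. u' x + k * s 1 x)"
      using s1 u(2,3) by (cases b) (simp_all add: k_def, simp_all add: s_def \<sigma>_def)
    note f = laplacian_domI[OF frep this]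
    have eq: "weak_deriv2 f - scaleC (c\<^sup>2) f = h"
      unfolding f(2) unfolding f_def by (simp add: scaleC_add scaleC_scaleC mult.commute)
    have "cmod k \<le> 2 * B * norm h / cmod ?d"
    proof -
      have "cmod (case b of Dirichlet \<Rightarrow> u 1 | Neumann \<Rightarrow> u' 1) \<le> 2 * B * norm h"
      proof (cases b)
        case Dirichlet
        have "cmod (u 1) \<le> B * norm h" using u(5)[of 1] by simp
        also have "\<dots> \<le> 2 * B * norm h" using \<open>B \<ge> 0\<close> by (simp add: mult_right_mono)
        finally show ?thesis using Dirichlet by simp
      next
        case Neumann
        then show ?thesis using u(6)[of 1] by simp
      qed
      then show ?thesis by (simp add: k_def norm_divide divide_right_mono)
    qed
    then have "cmod k * norm e \<le> 2 * B * norm h / cmod ?d * norm e" by (rule mult_right_mono) simp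
    moreover have "norm f0 \<le> B * norm h" using f0 u(5) by (rule norm_L2_le)
    ultimately have "norm f \<le> B * norm h + 2 * B * norm h / cmod ?d * norm e"
      unfolding f_def by (intro norm_triangle_le add_mono) (simp_all add: norm_scaleC)
    then have "norm f \<le> (B + 2 * B / cmod ?d * norm e) * norm h" by (simp add: algebra_simps)
    then show ?thesis using f(1) eq by blast
  qed
  then show ?thesis by blast
qed

lemma solve_helmholtz:
  assumes w: "\<And>n::nat. w \<noteq> complex_of_real (pi\<^sup>2 * (real n)\<^sup>2)"
  shows "\<exists>B. \<forall>h. \<exists>f\<in>laplacian_dom b. - weak_deriv2 f - scaleC w f = h \<and> norm f \<le> B * norm h"
proof -
  \<comment> \<open>With c^2 = - w the equation reads u'' - c^2 u = - h, and exp (2 * c) = 1 says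
    that \<open>c\<close> is an integer multiple of i \<pi>, that is, w = \<pi>^2 n^2. The value n =
    0 is excluded for both conditions, since for c = 0 the two exponentials coincide.\<close>
  define c where "c = csqrt (- w)"
  have c2: "c\<^sup>2 = - w" by (simp add: c_def)
  have "exp (2 * c) \<noteq> 1"
  proof
    assume "exp (2 * c) = 1"
    then obtain n :: int where "Re (2 * c) = 0" "Im (2 * c) = of_int (2 * n) * pi"
      unfolding exp_eq_1 by blast
    then have "c = \<i> * of_real (real_of_int n * pi)" by (simp add: complex_eq_iff)
    then have "w = - (\<i> * of_real (real_of_int n * pi))\<^sup>2" using c2 by simp
    also have "\<dots> = complex_of_real (pi\<^sup>2 * (real_of_int n)\<^sup>2)" by (simp add: power_mult_distrib)
    also have "(real_of_int n)\<^sup>2 = (real (nat \<bar>n\<bar>))\<^sup>2" by simp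
    finally show False using w by blast
  qed
  then obtain B where B: "\<And>h. \<exists>f\<in>laplacian_dom b. weak_deriv2 f - scaleC (c\<^sup>2) f = h \<and> norm f \<le> B * norm h"
    using solve_bvp by blast
  have "\<exists>f\<in>laplacian_dom b. - weak_deriv2 f - scaleC w f = h \<and> norm f \<le> B * norm h" for h
  proof -
    obtain f where f: "f \<in> laplacian_dom b" "weak_deriv2 f - scaleC (c\<^sup>2) f = - h" "norm f \<le> B * norm (- h)"
      using B by blast
    have "- weak_deriv2 f - scaleC w f = - (weak_deriv2 f - scaleC (c\<^sup>2) f)"
      by (simp add: c2 scaleC_uminus_left)
    then show ?thesis using f by auto
  qed
  then show ?thesis by blast
qed

text \<open>Injectivity by duality: if \<open>f\<close> solves the homogeneous problem and \<open>k\<close> solves it with right-hand side \<open>cnj f\<close>, Green's identity gives \<open>\<parallel>f\<parallel>\<^sup>2 = 0\<close>.\<close>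

lemma helmholtz_injective:
  assumes w: "\<And>n::nat. w \<noteq> complex_of_real (pi\<^sup>2 * (real n)\<^sup>2)"
    and f: "f \<in> laplacian_dom b" "- weak_deriv2 f - scaleC w f = 0"
  shows "f = 0"
proof -
  obtain k where k: "k \<in> laplacian_dom b" "- weak_deriv2 k - scaleC w k = cnj_L2 f"
    using solve_helmholtz[OF w] by blast
  have "complex_of_real ((norm f)\<^sup>2) = pairing f (- weak_deriv2 k - scaleC w k)"
    by (simp add: k pairing_cnj_self)
  also have "\<dots> = pairing (- weak_deriv2 f - scaleC w f) k"
    using laplacian_green[OF f(1) k(1)]
    by (simp only: pairing_minus_left pairing_minus_right pairing_uminus_left pairing_uminus_right
        pairing_scaleC_left pairing_scaleC_right)
  also have "\<dots> = 0" by (simp only: f(2) pairing_zero_left)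
  finally show ?thesis by simp
qed

lemma laplacian_resolvent_bound:
  assumes f: "f \<in> laplacian_dom b"
    and far: "\<And>t. t \<ge> 0 \<Longrightarrow> \<delta> \<le> cmod (complex_of_real (a * t) - z)"
  shows "\<delta> * norm f \<le> norm (scaleC (of_real a) (- weak_deriv2 f) - scaleC z f)" (is "_ \<le> norm ?h")
proof (cases "f = 0")
  case False
  obtain t where t: "t \<ge> 0" "pairing (- weak_deriv2 f) (cnj_L2 f) = complex_of_real t"
    using laplacian_energy[OF f] by blast
  have "pairing ?h (cnj_L2 f) = of_real a * of_real t - z * of_real ((norm f)\<^sup>2)"
    by (simp only: pairing_minus_left pairing_scaleC_left t pairing_cnj_self)
  \<comment> \<open>The quotient t / (norm f)^2 is the Rayleigh quotient of \<open>f\<close>, so the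
    bracket is a point of the ray a [0, \<infinity>) minus \<open>z\<close>, to which the hypothesis
    \<open>far\<close> applies.\<close>
  also have "\<dots> = of_real ((norm f)\<^sup>2) * (complex_of_real (a * (t / (norm f)\<^sup>2)) - z)"
    using False by (simp add: field_simps)
  finally have "(norm f)\<^sup>2 * cmod (complex_of_real (a * (t / (norm f)\<^sup>2)) - z) \<le> norm ?h * norm f"
    using norm_pairing_le[of ?h "cnj_L2 f"] by (simp add: norm_mult norm_cnj_L2 norm_power)
  moreover have "(norm f)\<^sup>2 * \<delta> \<le> (norm f)\<^sup>2 * cmod (complex_of_real (a * (t / (norm f)\<^sup>2)) - z)"
    using t by (intro mult_left_mono far) auto
  ultimately have "(\<delta> * norm f) * norm f \<le> norm ?h * norm f"
    by (simp add: power2_eq_square mult_ac)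
  then show ?thesis using False by simp
qed simp

subsection \<open>Eigenfunctions\<close>

definition sin_L2 :: "nat \<Rightarrow> L2" where
  "sin_L2 n = abs_L2 (\<lambda>x. complex_of_real (sin (real n * pi * x)))"

definition cos_L2 :: "nat \<Rightarrow> L2" where
  "cos_L2 n = abs_L2 (\<lambda>x. complex_of_real (cos (real n * pi * x)))"

lemma rep_trig_L2:
  "AE x in lebesgue01. rep_L2 (sin_L2 n) x = complex_of_real (sin (real n * pi * x))"
  "AE x in lebesgue01. rep_L2 (cos_L2 n) x = complex_of_real (cos (real n * pi * x))"
  unfolding sin_L2_def cos_L2_def
  by (rule rep_abs_L2, rule square_integrable_continuous, intro continuous_intros)+

lemma laplacian_real_eigenfunction:
  assumes p: "\<And>x. (p has_real_derivative p' x) (at x)" "\<And>x. (p' has_real_derivative - l * p x) (at x)"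
    and bc: "satisfies b (\<lambda>x. complex_of_real (p x)) (\<lambda>x. complex_of_real (p' x))"
  defines "f \<equiv> abs_L2 (\<lambda>x. complex_of_real (p x))"
  shows "f \<in> laplacian_dom b" "- weak_deriv2 f = scaleC (of_real l) f"
proof -
  have cont: "continuous_on {0..1} (\<lambda>x. complex_of_real (- l * p x))"
  proof -
    have "continuous_on {0..1} p"
      using p(1) by (meson DERIV_isCont continuous_at_imp_continuous_on)
    then show ?thesis by (intro continuous_intros)
  qed
  have rep: "has_deriv2_rep f (abs_L2 (\<lambda>x. complex_of_real (- l * p x))) (\<lambda>x. of_real (p x)) (\<lambda>x. of_real (p' x))"
    unfolding f_def using p cont by (intro has_deriv2_rep_smooth has_vector_derivative_of_real)
  show "f \<in> laplacian_dom b" by (rule laplacian_domI[OF rep bc])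
  show "- weak_deriv2 f = scaleC (of_real l) f"
  proof (rule L2_eqI)
    show "AE x in lebesgue01. rep_L2 (- weak_deriv2 f) x = rep_L2 (scaleC (of_real l) f) x"
      using rep_uminus_L2[of "weak_deriv2 f"] has_deriv2_repD(1)[OF rep] rep_scaleC[of "of_real l" f]
        rep_abs_L2[OF square_integrable_continuous[OF cont], folded weak_deriv2_eq[OF rep]]
      by eventually_elim simp
  qed
qed

lemma sin_L2_eigen:
  "sin_L2 n \<in> laplacian_dom Dirichlet" "- weak_deriv2 (sin_L2 n) = scaleC (of_real (pi\<^sup>2 * (real n)\<^sup>2)) (sin_L2 n)"
  unfolding sin_L2_def
  by (rule laplacian_real_eigenfunction[where b = Dirichlet and p' = "\<lambda>x. real n * pi * cos (real n * pi * x)"];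
      auto intro!: derivative_eq_intros simp: power2_eq_square algebra_simps)+

lemma cos_L2_eigen:
  "cos_L2 n \<in> laplacian_dom Neumann" "- weak_deriv2 (cos_L2 n) = scaleC (of_real (pi\<^sup>2 * (real n)\<^sup>2)) (cos_L2 n)"
  unfolding cos_L2_def
  by (rule laplacian_real_eigenfunction[where b = Neumann and p' = "\<lambda>x. - real n * pi * sin (real n * pi * x)"];
      auto intro!: derivative_eq_intros simp: power2_eq_square algebra_simps)+

lemma norm_trig_L2_le: "norm (sin_L2 n) \<le> 1" "norm (cos_L2 n) \<le> 1"
  by (rule norm_L2_le[OF rep_trig_L2(1)], simp, rule norm_L2_le[OF rep_trig_L2(2)], simp)

lemma cnj_sin_L2: "cnj_L2 (sin_L2 n) = sin_L2 n"
  by (rule L2_eqI, use rep_cnj_L2[of "sin_L2 n"] rep_trig_L2(1)[of n] in \<open>eventually_elim; simp\<close>)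

lemma L2_nonzero_if_continuous:
  assumes "AE x in lebesgue01. rep_L2 f x = u x" "continuous_on {0..1} u" "x \<in> {0..1}" "u x \<noteq> 0"
  shows "f \<noteq> 0"
proof
  assume "f = 0"
  then have "AE x in lebesgue01. rep_L2 f x = 0" using rep_zero_L2 by simp
  then have "AE x in lebesgue01. u x = 0" using assms(1) by eventually_elim simp
  then show False using continuous_eq_if_AE[of u "\<lambda>x. 0" x] assms by simp
qed

text \<open>The sample point 1 / (2 n) is the first maximum of sin (n \<pi> x).\<close>

lemma sin_L2_nonzero: "n \<ge> 1 \<Longrightarrow> sin_L2 n \<noteq> 0"
  by (rule L2_nonzero_if_continuous[OF rep_trig_L2(1), where x = "1 / (2 * real n)"])
    (auto intro!: continuous_intros simp: field_simps)

lemma cos_L2_nonzero: "cos_L2 n \<noteq> 0"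
  by (rule L2_nonzero_if_continuous[OF rep_trig_L2(2), where x = 0]) (auto intro!: continuous_intros)

text \<open>The frequencies 2 r and 2 r - 1 have opposite parity, so their sum 4 r - 1 and
  difference 1 are odd and neither sine in the product formula integrates to zero. The difference
  frequency contributes 1 / \<pi> independently of \<open>r\<close>, and this is the part that
  survives as \<open>r\<close> grows.\<close>

lemma pairing_sin_cos:
  assumes "r \<ge> 1"
  shows "pairing (sin_L2 (2 * r)) (cos_L2 (2 * r - 1)) = of_real (1 / pi + 1 / ((4 * real r - 1) * pi))"
proof -
  define q where "q = 4 * real r - 1"
  have q: "q > 0" using assms by (simp add: q_def)
  have m: "real (2 * r - 1) = 2 * real r - 1" using assms by (simp add: of_nat_diff)
  define F where "F x = - cos (q * pi * x) / (2 * q * pi) - cos (pi * x) / (2 * pi)" for x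
  have der: "(F has_real_derivative sin (real (2 * r) * pi * x) * cos (real (2 * r - 1) * pi * x)) (at x within S)" for x S
  proof -
    have "(F has_real_derivative (sin (q * pi * x) + sin (pi * x)) / 2) (at x within S)"
      unfolding F_def using q by (auto intro!: derivative_eq_intros simp: field_simps)
    moreover have "sin (real (2 * r) * pi * x) * cos (real (2 * r - 1) * pi * x)
        = (sin (q * pi * x) + sin (pi * x)) / 2"
      unfolding sin_times_cos m by (simp add: q_def algebra_simps)
    ultimately show ?thesis by (simp only:)
  qed
  have "((\<lambda>x. sin (real (2 * r) * pi * x) * cos (real (2 * r - 1) * pi * x)) has_integral F 1 - F 0) {0..1}"
    by (rule fundamental_theorem_of_calculus) (use der in \<open>auto simp: has_real_derivative_iff_has_vector_derivative\<close>)
  moreover have "F 1 - F 0 = 1 / pi + 1 / (q * pi)"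
  proof -
    have "cos (q * pi) = cos (4 * real r * pi - pi)" by (simp add: q_def algebra_simps)
    also have "\<dots> = - cos (real (4 * r) * pi)" by (simp add: cos_diff)
    also have "\<dots> = - 1" by (simp only: cos_npi) simp
    finally show ?thesis using q by (simp add: F_def field_simps)
  qed
  ultimately have "((\<lambda>x. complex_of_real (sin (real (2 * r) * pi * x) * cos (real (2 * r - 1) * pi * x)))
      has_integral complex_of_real (1 / pi + 1 / (q * pi))) {0..1}"
    by (metis has_integral_of_real)
  then show ?thesis
    unfolding q_def pairing_eq[OF rep_trig_L2] by (simp add: integral_unique)
qed

subsection \<open>The operator \<open>A\<^sub>2 D\<close>\<close>

abbreviation A2D :: "real \<Rightarrow> real \<Rightarrow> operator" where
  "A2D a d \<equiv> left_mult (A2 a d) D_op"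

lemma fst_A2D: "fst (A2D a d) = Dom_D"
  by (simp add: left_mult_def D_op_def)

lemma shifted_A2D:
  "shifted (A2D a d) z f $ 1 = scaleC (of_real a) (- weak_deriv2 (f $ 1)) - scaleC z (f $ 1)"
  "shifted (A2D a d) z f $ 2 =
     - weak_deriv2 (f $ 1) + scaleC (of_real d) (- weak_deriv2 (f $ 2)) - scaleC z (f $ 2)"
  by (simp_all add: shifted_def left_mult_def D_op_def matrix_action_def A2_def UNIV_2
      scaleC_one scaleC_zero)

lemma vec2_eqI: "f $ 1 = g $ 1 \<Longrightarrow> f $ 2 = g $ 2 \<Longrightarrow> f = (g :: 'a^2)"
  by (simp add: vec_eq_iff forall_2)

lemma norm_vec2_le: "norm (f :: L2^2) \<le> norm (f $ 1) + norm (f $ 2)"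
  unfolding norm_vec_def using L2_set_le_sum[of UNIV "\<lambda>i. norm (f $ i)"] by (simp add: UNIV_2)

text \<open>Linearity is claimed on the domain only, because \<open>weak_deriv2\<close> is a
  definite description with no known value where no weak derivative exists. The combined form f + r
  g yields sums, differences and multiples at once.\<close>

lemma shifted_A2D_add:
  assumes "f \<in> Dom_D" "g \<in> Dom_D"
  shows "f + r *\<^sub>R g \<in> Dom_D"
    "shifted (A2D a d) z (f + r *\<^sub>R g) = shifted (A2D a d) z f + r *\<^sub>R shifted (A2D a d) z g"
proof -
  have c: "(f + r *\<^sub>R g) $ i = f $ i + scaleC (of_real r) (g $ i)" for i
    by (simp add: scaleC_of_real)
  note dom = laplacian_dom_add[of _ Dirichlet] laplacian_dom_add[of _ Neumann]
  show "f + r *\<^sub>R g \<in> Dom_D" using assms dom by (simp add: Dom_D_iff c del: vector_add_component)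
  have s: "scaleC k (r' *\<^sub>R h) = r' *\<^sub>R scaleC k h" for k r' h
    by (simp add: scaleC_scaleC mult.commute flip: scaleC_of_real)
  have w: "weak_deriv2 (f $ i + r *\<^sub>R g $ i) = weak_deriv2 (f $ i) + r *\<^sub>R weak_deriv2 (g $ i)" for i
    using assms exhaust_2[of i] laplacian_dom_add(2)[of "f $ 1" Dirichlet "g $ 1" "of_real r"]
      laplacian_dom_add(2)[of "f $ 2" Neumann "g $ 2" "of_real r"]
    unfolding Dom_D_iff by (auto simp: scaleC_of_real)
  show "shifted (A2D a d) z (f + r *\<^sub>R g) = shifted (A2D a d) z f + r *\<^sub>R shifted (A2D a d) z g"
    by (rule vec2_eqI) (simp_all add: shifted_A2D w scaleC_add scaleC_uminus scaleC_minus s algebra_simps)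
qed

text \<open>The trivial kernel makes solutions unique, so a bound on some solution is automatically
  a bound on the inverse.\<close>

lemma resolvent_set_A2DI:
  assumes inj: "\<And>f. f \<in> Dom_D \<Longrightarrow> shifted (A2D a d) z f = 0 \<Longrightarrow> f = 0"
    and surj: "\<And>g. \<exists>f\<in>Dom_D. shifted (A2D a d) z f = g \<and> norm f \<le> B * norm g"
  shows "z \<in> resolvent_set (A2D a d)"
proof -
  let ?S = "shifted (A2D a d) z" and ?R = "resolvent (A2D a d) z"
  note add = shifted_A2D_add(1) shifted_A2D_add(2)[where a = a and d = d and z = z]
  have eq: "f = g" if "f \<in> Dom_D" "g \<in> Dom_D" "?S f = ?S g" for f g
    using inj[of "f + (- 1) *\<^sub>R g"] add[OF that(1,2), where r = "- 1"] that(3) by simp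
  have bij: "bij_betw ?S Dom_D UNIV"
    unfolding bij_betw_def inj_on_def using eq surj by (auto, metis rangeI image_eqI)
  have R: "?R g \<in> Dom_D" "?S (?R g) = g" for g
    using bij by (auto simp: resolvent_def fst_A2D bij_betw_def inv_into_into f_inv_into_f)
  have "bounded_linear ?R"
  proof (rule bounded_linear_intro)
    show "?R (g + h) = ?R g + ?R h" for g h
      by (rule eq) (use add[where f = "?R g" and g = "?R h" and r = 1] R in auto)
    show "?R (r *\<^sub>R g) = r *\<^sub>R ?R g" for r g
    proof (rule eq)
      \<comment> \<open>Zero is obtained as the difference of an element of the domain with
        itself.\<close>
      have "0 \<in> Dom_D \<and> ?S 0 = 0"
        using add[OF R(1)[of g] R(1)[of g], where r = "- 1"] by simp
      then show "r *\<^sub>R ?R g \<in> Dom_D" "?S (?R (r *\<^sub>R g)) = ?S (r *\<^sub>R ?R g)"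
        using add[where f = 0 and g = "?R g" and r = r] R by auto
    qed (rule R)
    show "norm (?R g) \<le> norm g * B" for g
      using surj[of g] eq[OF R(1)[of g]] R(2)[of g] by (metis mult.commute)
  qed
  then show ?thesis unfolding resolvent_set_def using bij by (simp add: fst_A2D)
qed

lemma resolvent_set_A2DD:
  assumes "z \<in> resolvent_set (A2D a d)"
  shows "\<exists>f\<in>Dom_D. shifted (A2D a d) z f = g"
    "f \<in> Dom_D \<Longrightarrow> resolvent (A2D a d) z (shifted (A2D a d) z f) = f"
    "resolvent (A2D a d) z g \<in> Dom_D" "shifted (A2D a d) z (resolvent (A2D a d) z g) = g"
    "bounded_linear (resolvent (A2D a d) z)"
proof -
  have *: "bij_betw (shifted (A2D a d) z) Dom_D UNIV" "bounded_linear (resolvent (A2D a d) z)"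
    using assms by (auto simp: resolvent_set_def fst_A2D)
  then show "\<exists>f\<in>Dom_D. shifted (A2D a d) z f = g" by (metis UNIV_I bij_betw_iff_bijections)
  show "f \<in> Dom_D \<Longrightarrow> resolvent (A2D a d) z (shifted (A2D a d) z f) = f"
    "resolvent (A2D a d) z g \<in> Dom_D" "shifted (A2D a d) z (resolvent (A2D a d) z g) = g"
    using *(1) by (auto simp: resolvent_def fst_A2D bij_betw_def inv_into_into f_inv_into_f)
qed (use assms in \<open>simp add: resolvent_set_def\<close>)

section \<open>Scaled scalar problems and forward substitution\<close>

lemma scaled_laplacian:
  assumes a: "a \<noteq> 0" and z: "\<And>n::nat. z \<noteq> complex_of_real (a * pi\<^sup>2 * (real n)\<^sup>2)"
  shows "\<exists>B\<ge>0. \<forall>h. \<exists>f\<in>laplacian_dom b.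
      scaleC (of_real a) (- weak_deriv2 f) - scaleC z f = h \<and> norm f \<le> B * norm h" (is ?solve)
    and "f \<in> laplacian_dom b \<Longrightarrow> scaleC (of_real a) (- weak_deriv2 f) - scaleC z f = 0 \<Longrightarrow> f = 0"
proof -
  define w where "w = z / of_real a"
  have w: "w \<noteq> complex_of_real (pi\<^sup>2 * (real n)\<^sup>2)" for n
  proof
    assume "w = complex_of_real (pi\<^sup>2 * (real n)\<^sup>2)"
    then have "z = complex_of_real (a * pi\<^sup>2 * (real n)\<^sup>2)" using a by (simp add: w_def field_simps)
    then show False using z by blast
  qed
  have eq: "scaleC (of_real a) (- weak_deriv2 f) - scaleC z f = scaleC (of_real a) (- weak_deriv2 f - scaleC w f)" for f
    using a by (simp add: scaleC_minus scaleC_scaleC w_def)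
  have cancel: "scaleC (of_real a) (scaleC (1 / of_real a) h) = h" "scaleC (1 / of_real a) (scaleC (of_real a) h) = h" for h
    using a by (simp_all add: scaleC_scaleC scaleC_one)
  obtain B where B: "\<And>h. \<exists>f\<in>laplacian_dom b. - weak_deriv2 f - scaleC w f = h \<and> norm f \<le> B * norm h"
    using solve_helmholtz[OF w] by blast
  show ?solve
  \<comment> \<open>The unscaled problem gives no sign for \<open>B\<close>; absolute values provide
    the nonnegative constant that the monotonicity arguments for the coupled system require.\<close>
  proof (intro exI[of _ "\<bar>B\<bar> / \<bar>a\<bar>"] conjI allI)
    fix h
    obtain f where f: "f \<in> laplacian_dom b" "- weak_deriv2 f - scaleC w f = scaleC (1 / of_real a) h"
      "norm f \<le> B * norm (scaleC (1 / of_real a) h)" using B by blast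
    have "norm f \<le> \<bar>B\<bar> * norm (scaleC (1 / of_real a) h)"
      using f(3) by (meson abs_ge_self mult_right_mono norm_ge_zero order_trans)
    also have "\<dots> = \<bar>B\<bar> / \<bar>a\<bar> * norm h" by (simp add: norm_scaleC norm_divide)
    finally show "\<exists>f\<in>laplacian_dom b. scaleC (of_real a) (- weak_deriv2 f) - scaleC z f = h \<and> norm f \<le> \<bar>B\<bar> / \<bar>a\<bar> * norm h"
      using f eq cancel by metis
  qed simp
  assume "f \<in> laplacian_dom b" "scaleC (of_real a) (- weak_deriv2 f) - scaleC z f = 0"
  then show "f = 0" using helmholtz_injective[OF w, of f b] eq[of f] cancel scaleC_zero(1) by metis
qed

text \<open>The equation itself bounds the second derivative, since a (- f'') is the right-hand side
  plus z f. Applied to the first component, this controls the term through which it enters the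
  second equation.\<close>

lemma norm_weak_deriv2_le:
  assumes "a \<noteq> 0"
  shows "norm (weak_deriv2 f) \<le> (norm (scaleC (of_real a) (- weak_deriv2 f) - scaleC z f) + cmod z * norm f) / \<bar>a\<bar>"
proof -
  have "\<bar>a\<bar> * norm (weak_deriv2 f) = norm ((scaleC (of_real a) (- weak_deriv2 f) - scaleC z f) + scaleC z f)"
    by (simp add: norm_scaleC)
  also have "\<dots> \<le> norm (scaleC (of_real a) (- weak_deriv2 f) - scaleC z f) + cmod z * norm f"
    by (rule order_trans[OF norm_triangle_ineq]) (simp add: norm_scaleC)
  finally show ?thesis using assms by (simp add: field_simps)
qed

text \<open>Forward substitution in the triangular system: the first row is solved alone, and the
  second derivative of its solution moves to the right-hand side of the second row. Injectivity is
  proved in the same order.\<close>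

lemma resolvent_set_A2D:
  assumes "a \<noteq> 0" "d \<noteq> 0"
    and za: "\<And>n::nat. z \<noteq> complex_of_real (a * pi\<^sup>2 * (real n)\<^sup>2)"
    and zd: "\<And>n::nat. z \<noteq> complex_of_real (d * pi\<^sup>2 * (real n)\<^sup>2)"
  shows "z \<in> resolvent_set (A2D a d)"
proof -
  obtain B1 where B1: "B1 \<ge> 0" "\<And>h. \<exists>f\<in>laplacian_dom Dirichlet.
      scaleC (of_real a) (- weak_deriv2 f) - scaleC z f = h \<and> norm f \<le> B1 * norm h"
    using scaled_laplacian(1)[OF assms(1) za] by blast
  obtain B2 where B2: "B2 \<ge> 0" "\<And>h. \<exists>f\<in>laplacian_dom Neumann.
      scaleC (of_real d) (- weak_deriv2 f) - scaleC z f = h \<and> norm f \<le> B2 * norm h"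
    using scaled_laplacian(1)[OF assms(2) zd] by blast
  show ?thesis
  proof (rule resolvent_set_A2DI)
    fix f assume f: "f \<in> Dom_D" "shifted (A2D a d) z f = 0"
    then have c: "shifted (A2D a d) z f $ 1 = 0" "shifted (A2D a d) z f $ 2 = 0" by simp_all
    have 1: "f $ 1 = 0"
      using scaled_laplacian(2)[OF assms(1) za] f c(1) unfolding shifted_A2D Dom_D_iff by blast
    have "weak_deriv2 (f $ 1) = 0" using norm_weak_deriv2_le[OF assms(1), of "f $ 1" z] c(1) 1
      unfolding shifted_A2D by simp
    then have "f $ 2 = 0"
      using scaled_laplacian(2)[OF assms(2) zd, of "f $ 2" Neumann] f c(2) unfolding shifted_A2D Dom_D_iff by simp
    then show "f = 0" using 1 by (intro vec2_eqI) auto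
  next
    fix g :: "L2^2"
    \<comment> \<open>A bound for the map from \<open>g\<close> to the second derivative of
      \<open>p\<close>: the right-hand side contributes 1, the term z p contributes cmod z *
      B1.\<close>
    define C where "C = (1 + cmod z * B1) / \<bar>a\<bar>"
    have C: "C \<ge> 0" using B1 by (simp add: C_def)
    obtain p where p: "p \<in> laplacian_dom Dirichlet" "scaleC (of_real a) (- weak_deriv2 p) - scaleC z p = g $ 1"
      "norm p \<le> B1 * norm (g $ 1)" using B1 by blast
    obtain q where q: "q \<in> laplacian_dom Neumann" "scaleC (of_real d) (- weak_deriv2 q) - scaleC z q = g $ 2 + weak_deriv2 p"
      "norm q \<le> B2 * norm (g $ 2 + weak_deriv2 p)" using B2 by blast
    define f :: "L2^2" where "f = vector [p, q]"
    have f: "f $ 1 = p" "f $ 2 = q" by (simp_all add: f_def)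
    have g: "norm (g $ i) \<le> norm g" for i by (rule Finite_Cartesian_Product.norm_nth_le)
    have np: "norm p \<le> B1 * norm g" using p(3) mult_left_mono[OF g[of 1] B1(1)] by linarith
    have "norm (weak_deriv2 p) \<le> (norm g + cmod z * (B1 * norm g)) / \<bar>a\<bar>"
      using norm_weak_deriv2_le[OF assms(1), of p z] g[of 1] np
      unfolding p(2) by (meson add_mono divide_right_mono abs_ge_zero mult_left_mono norm_ge_zero order_trans)
    also have "\<dots> = C * norm g" by (simp add: C_def algebra_simps add_divide_distrib)
    finally have "norm (g $ 2 + weak_deriv2 p) \<le> norm g + C * norm g"
      using g[of 2] by (intro norm_triangle_le add_mono)
    then have "norm q \<le> B2 * (norm g + C * norm g)"
      using q(3) B2(1) by (meson mult_left_mono order_trans)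
    then have "norm f \<le> (B1 + B2 * (1 + C)) * norm g"
      using norm_vec2_le[of f] np by (simp add: f algebra_simps)
    moreover have "f \<in> Dom_D" using p q by (simp add: Dom_D_iff f)
    moreover have "shifted (A2D a d) z f = g"
      using p(2) q(2) by (intro vec2_eqI) (simp_all add: shifted_A2D f algebra_simps)
    ultimately show "\<exists>f\<in>Dom_D. shifted (A2D a d) z f = g \<and> norm f \<le> (B1 + B2 * (1 + C)) * norm g"
      by blast
  qed
qed

section \<open>Points of the spectrum\<close>

lemma zero_in_laplacian_dom: "0 \<in> laplacian_dom b" "weak_deriv2 0 = 0"
proof -
  have "abs_L2 (\<lambda>x. 0) = 0" by (simp add: zero_L2_def)
  then have rep: "has_deriv2_rep 0 0 (\<lambda>x. 0) (\<lambda>x. 0)"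
    using has_deriv2_rep_smooth[of "\<lambda>x. 0" "\<lambda>x. 0" "\<lambda>x. 0"] by simp
  have "satisfies b (\<lambda>x. 0) (\<lambda>x. 0)" by (cases b) simp_all
  then show "0 \<in> laplacian_dom b" by (rule laplacian_domI(1)[OF rep])
  show "weak_deriv2 0 = 0" by (rule weak_deriv2_eq[OF rep])
qed

text \<open>The second component does not enter the first row, so (0, cos (n \<pi> x)) is an
  eigenvector whatever \<open>a\<close> is, with n = 0 giving the constant function.\<close>

lemma eigenvalue_d_in_Spec:
  "complex_of_real (d * pi\<^sup>2 * (real n)\<^sup>2) \<in> Spec (A2D a d)"
proof -
  let ?z = "complex_of_real (d * pi\<^sup>2 * (real n)\<^sup>2)"
  define f :: "L2^2" where "f = vector [0, cos_L2 n]"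
  have f: "f \<in> Dom_D" by (simp add: f_def Dom_D_iff zero_in_laplacian_dom cos_L2_eigen)
  have 0: "0 \<in> Dom_D" by (simp add: Dom_D_iff zero_in_laplacian_dom)
  have "shifted (A2D a d) ?z f = 0"
    by (rule vec2_eqI)
      (simp_all only: shifted_A2D f_def vector_2 cos_L2_eigen zero_in_laplacian_dom scaleC_scaleC zero_index,
       simp_all add: scaleC_zero mult.assoc)
  moreover have "shifted (A2D a d) ?z 0 = 0"
    by (rule vec2_eqI) (simp_all add: shifted_A2D zero_in_laplacian_dom scaleC_zero)
  ultimately have "f = 0" if "?z \<in> resolvent_set (A2D a d)"
    using resolvent_set_A2DD(2)[OF that f] resolvent_set_A2DD(2)[OF that 0] by simp
  moreover have "f \<noteq> 0" using cos_L2_nonzero[of n] by (metis f_def vector_2(2) zero_index)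
  ultimately show ?thesis unfolding Spec_def by blast
qed

text \<open>An eigenvector built on the sine would need a second component solving a Neumann problem
  that may be resonant. Surjectivity is refuted instead: by Green's identity the first component of
  every value of the shifted operator pairs to zero with sin (n \<pi> x). For n = 0 this sine
  vanishes, and the point 0 comes from the Neumann constant.\<close>

lemma eigenvalue_a_in_Spec:
  "complex_of_real (a * pi\<^sup>2 * (real n)\<^sup>2) \<in> Spec (A2D a d)"
proof (cases "n = 0")
  case True
  then show ?thesis using eigenvalue_d_in_Spec[of d 0 a] by simp
next
  case False
  let ?z = "complex_of_real (a * pi\<^sup>2 * (real n)\<^sup>2)"
  have "?z \<notin> resolvent_set (A2D a d)"
  proof
    assume "?z \<in> resolvent_set (A2D a d)"
    then obtain f where f: "f \<in> Dom_D" "shifted (A2D a d) ?z f = vector [sin_L2 n, 0]"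
      using resolvent_set_A2DD(1) by blast
    have 1: "scaleC (of_real a) (- weak_deriv2 (f $ 1)) - scaleC ?z (f $ 1) = sin_L2 n"
      using arg_cong[OF f(2), of "\<lambda>v. v $ 1"] unfolding shifted_A2D by simp
    have "complex_of_real ((norm (sin_L2 n))\<^sup>2) = pairing (sin_L2 n) (sin_L2 n)"
      using pairing_cnj_self[of "sin_L2 n"] by (simp add: cnj_sin_L2)
    also have "\<dots> = pairing (scaleC (of_real a) (- weak_deriv2 (f $ 1)) - scaleC ?z (f $ 1)) (sin_L2 n)"
      unfolding 1 ..
    also have "\<dots> = of_real a * pairing (f $ 1) (- weak_deriv2 (sin_L2 n)) - ?z * pairing (f $ 1) (sin_L2 n)"
      using laplacian_green[of "f $ 1" Dirichlet "sin_L2 n"] f(1) sin_L2_eigen(1)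
      by (simp add: pairing_minus_left pairing_scaleC_left pairing_uminus_left pairing_uminus_right Dom_D_iff)
    also have "\<dots> = 0"
      unfolding sin_L2_eigen(2) by (simp add: pairing_scaleC_right mult.assoc)
    finally show False using sin_L2_nonzero[of n] False by simp
  qed
  then show ?thesis by (simp add: Spec_def)
qed

text \<open>The one-sided difference quotients at 1 / 2 are constantly 1 and - 1. The function
  serves as the target that is missed when d = 0.\<close>

lemma abs_not_differentiable:
  "\<not> ((\<lambda>x. complex_of_real \<bar>x - 1/2\<bar>) has_vector_derivative D) (at (1/2))"
proof
  assume "((\<lambda>x. complex_of_real \<bar>x - 1/2\<bar>) has_vector_derivative D) (at (1/2))"
  then have "((\<lambda>x. Re (complex_of_real \<bar>x - 1/2\<bar>)) has_vector_derivative Re D) (at (1/2))"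
    by (rule bounded_linear.has_vector_derivative[OF bounded_linear_Re])
  then have "((\<lambda>x. \<bar>x - 1/2\<bar>) has_real_derivative Re D) (at (1/2))"
    by (simp add: has_real_derivative_iff_has_vector_derivative)
  then have lim: "((\<lambda>h. \<bar>h\<bar> / h) \<longlongrightarrow> Re D) (at 0)" by (simp add: DERIV_def)
  have "((\<lambda>h::real. \<bar>h\<bar> / h) \<longlongrightarrow> 1) (at_right 0)"
    by (rule Lim_transform_eventually[OF tendsto_const]) (auto simp: eventually_at_filter)
  moreover have "((\<lambda>h::real. \<bar>h\<bar> / h) \<longlongrightarrow> - 1) (at_left 0)"
    by (rule Lim_transform_eventually[OF tendsto_const]) (auto simp: eventually_at_filter)
  ultimately have "Re D = 1" "Re D = - 1"
    using lim[unfolded filterlim_at_split] tendsto_unique trivial_limit_at_left_real trivial_limit_at_right_real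
    by blast+
  then show False by simp
qed

text \<open>For \<open>a = 0\<close> the first component of \<open>K - z\<close> takes values vanishing at \<open>0\<close>; for \<open>d = 0\<close> its second component is continuously differentiable whenever the first one vanishes.\<close>

lemma Spec_A2D_degenerate:
  assumes "a * d = 0"
  shows "Spec (A2D a d) = UNIV"
proof -
  have "z \<notin> resolvent_set (A2D a d)" for z
  proof (cases "a = 0")
    case True
    define e where "e = abs_L2 (\<lambda>x. 1)"
    have e: "AE x in lebesgue01. rep_L2 e x = 1"
      unfolding e_def by (intro rep_abs_L2 square_integrable_continuous continuous_intros)
    show ?thesis
    proof
      assume "z \<in> resolvent_set (A2D a d)"
      then obtain f where f: "f \<in> Dom_D" "shifted (A2D a d) z f = vector [e, 0]"
        using resolvent_set_A2DD(1) by blast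
      have "scaleC (- z) (f $ 1) = e"
        using arg_cong[OF f(2), of "\<lambda>v. v $ 1"] True unfolding shifted_A2D
        by (simp add: scaleC_zero scaleC_uminus_left)
      moreover obtain u u' where u: "has_deriv2_rep (f $ 1) (weak_deriv2 (f $ 1)) u u'" "satisfies Dirichlet u u'"
        using f(1) unfolding Dom_D_iff by (meson laplacian_domE)
      ultimately have "AE x in lebesgue01. - z * u x = 1"
        using e rep_scaleC[of "- z" "f $ 1"] has_deriv2_repD(1)[OF u(1)] by (auto elim: eventually_elim2)
      then have "- z * u 0 = 1"
        by (rule continuous_eq_if_AE) (auto intro!: continuous_intros has_deriv2_repD(4)[OF u(1)])
      then show False using u(2) by simp
    qed
  next
    case False
    then have d: "d = 0" using assms by simp
    define k where "k = abs_L2 (\<lambda>x. complex_of_real \<bar>x - 1/2\<bar>)"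
    have k: "AE x in lebesgue01. rep_L2 k x = complex_of_real \<bar>x - 1/2\<bar>"
      unfolding k_def by (intro rep_abs_L2 square_integrable_continuous continuous_intros)
    show ?thesis
    proof
      assume "z \<in> resolvent_set (A2D a d)"
      then obtain f where f: "f \<in> Dom_D" "shifted (A2D a d) z f = vector [0, k]"
        using resolvent_set_A2DD(1) by blast
      obtain u u' where u: "has_deriv2_rep (f $ 1) (weak_deriv2 (f $ 1)) u u'"
        using f(1) unfolding Dom_D_iff by (meson laplacian_domE)
      obtain v v' where v: "has_deriv2_rep (f $ 2) (weak_deriv2 (f $ 2)) v v'"
        using f(1) unfolding Dom_D_iff by (meson laplacian_domE)
      have 1: "scaleC (of_real a) (- weak_deriv2 (f $ 1)) = scaleC z (f $ 1)"
        using arg_cong[OF f(2), of "\<lambda>v. v $ 1"] unfolding shifted_A2D by simp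
      \<comment> \<open>The first row expresses - u'' as (z / a) u, so with d = 0 the second row
        contains no derivative any more and both of its terms are multiples of C1 functions.\<close>
      have "- weak_deriv2 (f $ 1) = scaleC (1 / of_real a) (scaleC (of_real a) (- weak_deriv2 (f $ 1)))"
        using False by (simp add: scaleC_scaleC scaleC_one)
      also have "\<dots> = scaleC (z / of_real a) (f $ 1)" unfolding 1 by (simp add: scaleC_scaleC)
      finally have k_eq: "scaleC (z / of_real a) (f $ 1) - scaleC z (f $ 2) = k"
        using arg_cong[OF f(2), of "\<lambda>v. v $ 2"] d unfolding shifted_A2D by (simp add: scaleC_zero)
      have "AE x in lebesgue01. rep_L2 (scaleC (z / of_real a) (f $ 1) - scaleC z (f $ 2)) x = z / of_real a * u x - z * v x"
        using rep_minus_L2[of "scaleC (z / of_real a) (f $ 1)" "scaleC z (f $ 2)"]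
          rep_scaleC[of "z / of_real a" "f $ 1"] rep_scaleC[of z "f $ 2"]
          has_deriv2_repD(1)[OF u] has_deriv2_repD(1)[OF v]
        by eventually_elim simp
      from this[unfolded k_eq] have ae: "AE x in lebesgue01. z / of_real a * u x - z * v x = complex_of_real \<bar>x - 1/2\<bar>"
        using k by eventually_elim simp
      have eq: "z / of_real a * u x - z * v x = complex_of_real \<bar>x - 1/2\<bar>" if "x \<in> {0..1}" for x
        by (rule continuous_eq_if_AE[OF ae _ _ that]) (intro continuous_intros has_deriv2_repD(4)[OF u] has_deriv2_repD(4)[OF v])+
      have "((\<lambda>x. z / of_real a * u x - z * v x) has_vector_derivative z / of_real a * u' (1/2) - z * v' (1/2)) (at (1/2) within {0..1})"
        by (intro derivative_intros has_deriv2_repD(2)[OF u] has_deriv2_repD(2)[OF v]) auto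
      then have "((\<lambda>x. complex_of_real \<bar>x - 1/2\<bar>) has_vector_derivative z / of_real a * u' (1/2) - z * v' (1/2)) (at (1/2) within {0..1})"
        by (rule has_vector_derivative_transform[rotated 2]) (auto simp only: eq, simp)
      moreover have "at (1/2) within {0..1::real} = at (1/2)" by (intro at_within_interior) auto
      ultimately show False using abs_not_differentiable by simp
    qed
  qed
  then show ?thesis by (auto simp: Spec_def)
qed

lemma Spec_A2D:
  assumes "a * d \<noteq> 0"
  shows "Spec (A2D a d) = (\<Union>n::nat. {complex_of_real (a * pi\<^sup>2 * (real n)\<^sup>2), complex_of_real (d * pi\<^sup>2 * (real n)\<^sup>2)})"
proof (intro equalityI subsetI)
  fix z assume "z \<in> Spec (A2D a d)"
  then have "z \<notin> resolvent_set (A2D a d)" by (simp add: Spec_def)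
  then show "z \<in> (\<Union>n::nat. {complex_of_real (a * pi\<^sup>2 * (real n)\<^sup>2), complex_of_real (d * pi\<^sup>2 * (real n)\<^sup>2)})"
  proof (rule contrapos_np)
    assume "z \<notin> (\<Union>n::nat. {complex_of_real (a * pi\<^sup>2 * (real n)\<^sup>2), complex_of_real (d * pi\<^sup>2 * (real n)\<^sup>2)})"
    then show "z \<in> resolvent_set (A2D a d)"
      using assms by (intro resolvent_set_A2D) simp_all
  qed
next
  fix z assume "z \<in> (\<Union>n::nat. {complex_of_real (a * pi\<^sup>2 * (real n)\<^sup>2), complex_of_real (d * pi\<^sup>2 * (real n)\<^sup>2)})"
  then obtain n :: nat where "z = complex_of_real (a * pi\<^sup>2 * (real n)\<^sup>2) \<or> z = complex_of_real (d * pi\<^sup>2 * (real n)\<^sup>2)"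
    by blast
  then show "z \<in> Spec (A2D a d)"
    using eigenvalue_a_in_Spec[of a n d] eigenvalue_d_in_Spec[of d n a] by (elim disjE) (simp_all only:)
qed

subsection \<open>Resolvent estimates\<close>

text \<open>In the right half-plane the distance to the ray is at least |Im z| = |z| sin |arg z|; in
  the left half-plane the origin is the nearest point and the distance is at least |z|. Capping
  \<epsilon> at \<pi> / 2 keeps the sine in the range where it increases.\<close>

lemma sector_distance:
  assumes "\<epsilon> > 0" "t \<ge> 0" "z \<notin> sector (- \<epsilon>) \<epsilon>"
  shows "sin (min \<epsilon> (pi / 2)) * cmod z \<le> cmod (complex_of_real t - z)"
proof -
  define \<theta> where "\<theta> = Arg z"
  have z: "z = complex_of_real (cmod z) * cis \<theta>"
    unfolding \<theta>_def by (metis rcis_cmod_Arg rcis_def)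
  have \<theta>: "- pi < \<theta>" "\<theta> \<le> pi" unfolding \<theta>_def using Arg_bounded by auto
  have "\<not> (- \<epsilon> \<le> \<theta> \<and> \<theta> \<le> \<epsilon>)" using assms(3) z unfolding sector_def by blast
  then have abs: "\<bar>\<theta>\<bar> > \<epsilon>" by linarith
  have Im: "\<bar>Im z\<bar> = cmod z * sin \<bar>\<theta>\<bar>"
  proof -
    have "Im z = cmod z * sin \<theta>" by (subst z) simp
    moreover have "\<bar>sin \<theta>\<bar> = sin \<bar>\<theta>\<bar>"
      using \<theta> sin_ge_zero[of "\<bar>\<theta>\<bar>"] by (cases "\<theta> \<ge> 0") auto
    ultimately show ?thesis by (simp add: abs_mult)
  qed
  show ?thesis
  proof (cases "\<bar>\<theta>\<bar> \<le> pi / 2")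
    case True
    have "sin (min \<epsilon> (pi / 2)) \<le> sin \<bar>\<theta>\<bar>"
      using True abs assms(1) by (intro sin_monotone_2pi_le) auto
    then have "sin (min \<epsilon> (pi / 2)) * cmod z \<le> \<bar>Im z\<bar>"
      unfolding Im by (simp add: mult.commute mult_left_mono)
    also have "\<dots> \<le> cmod (complex_of_real t - z)"
      using abs_Im_le_cmod[of "complex_of_real t - z"] by simp
    finally show ?thesis .
  next
    case False
    have "cos \<theta> = cos \<bar>\<theta>\<bar>" by (simp add: abs_if)
    also have "\<dots> \<le> cos (pi / 2)" using False \<theta> by (intro cos_monotone_0_pi_le) auto
    finally have "Re z \<le> 0" by (subst z) (simp add: mult_nonneg_nonpos)
    then have "(Re z)\<^sup>2 \<le> (t - Re z)\<^sup>2" using assms(2) by (simp add: power2_le_iff_abs_le abs_le_iff)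
    then have "cmod z \<le> cmod (complex_of_real t - z)"
      by (simp add: cmod_def)
    moreover have "sin (min \<epsilon> (pi / 2)) * cmod z \<le> 1 * cmod z" by (intro mult_right_mono) auto
    ultimately show ?thesis by linarith
  qed
qed

lemma sector_distance_scaled:
  assumes "\<epsilon> > 0" "t \<ge> 0" "z \<notin> (if a > 0 then sector (- \<epsilon>) \<epsilon> else uminus ` sector (- \<epsilon>) \<epsilon>)" "a \<noteq> 0"
  shows "sin (min \<epsilon> (pi / 2)) * cmod z \<le> cmod (complex_of_real (a * t) - z)"
proof (cases "a > 0")
  case True
  then show ?thesis using sector_distance[of \<epsilon> "a * t" z] assms by simp
next
  case False
  then have "- z \<notin> sector (- \<epsilon>) \<epsilon>" using assms(3) by (metis add.inverse_inverse imageI)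
  then have "sin (min \<epsilon> (pi / 2)) * cmod (- z) \<le> cmod (complex_of_real (- a * t) - - z)"
    using False assms by (intro sector_distance) (auto simp: mult_nonpos_nonneg)
  also have "\<dots> = cmod (complex_of_real (a * t) - z)"
    by (metis (no_types) minus_diff_minus mult_minus_left norm_minus_cancel of_real_minus)
  finally show ?thesis by simp
qed

text \<open>Take norm g = 1. The first component is at most 1 / (\<kappa> |z|), so \<open>z\<close>
  times it stays bounded, the coupling term is at most (1 + 1 / \<kappa>) / |a| uniformly in
  \<open>z\<close>, and a second use of the scalar bound divides by \<kappa> |z|. The two
  contributions add up to the stated constant.\<close>

lemma resolvent_A2D_bound:
  assumes ad: "a \<noteq> 0" "d \<noteq> 0" and \<kappa>: "\<kappa> > 0" and z: "z \<noteq> 0"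
    and fa: "\<And>t. t \<ge> 0 \<Longrightarrow> \<kappa> * cmod z \<le> cmod (complex_of_real (a * t) - z)"
    and fd: "\<And>t. t \<ge> 0 \<Longrightarrow> \<kappa> * cmod z \<le> cmod (complex_of_real (d * t) - z)"
  shows "z \<in> resolvent_set (A2D a d)"
    "onorm (resolvent (A2D a d) z) \<le> ((2 + (1 + 1 / \<kappa>) / \<bar>a\<bar>) / \<kappa>) / cmod z"
proof -
  \<comment> \<open>Eigenvalues lie on the ray, at distance 0, while the hypothesis keeps a nonzero
    \<open>z\<close> at positive distance.\<close>
  have ne: "z \<noteq> complex_of_real (c * pi\<^sup>2 * (real n)\<^sup>2)"
    if "\<And>t. t \<ge> 0 \<Longrightarrow> \<kappa> * cmod z \<le> cmod (complex_of_real (c * t) - z)" for c n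
  proof
    assume "z = complex_of_real (c * pi\<^sup>2 * (real n)\<^sup>2)"
    then have "complex_of_real (c * (pi\<^sup>2 * (real n)\<^sup>2)) - z = 0" by (simp add: mult.assoc)
    then have "\<kappa> * cmod z \<le> 0" using that[of "pi\<^sup>2 * (real n)\<^sup>2"] by simp
    then show False using \<kappa> z by (simp add: mult_le_0_iff)
  qed
  show res: "z \<in> resolvent_set (A2D a d)"
    by (rule resolvent_set_A2D[OF ad ne[OF fa] ne[OF fd]])
  show "onorm (resolvent (A2D a d) z) \<le> ((2 + (1 + 1 / \<kappa>) / \<bar>a\<bar>) / \<kappa>) / cmod z"
  proof (rule onorm_bound)
    show "0 \<le> ((2 + (1 + 1 / \<kappa>) / \<bar>a\<bar>) / \<kappa>) / cmod z" using \<kappa> by simp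
    fix g :: "L2^2"
    define f where "f = resolvent (A2D a d) z g"
    have f: "f $ 1 \<in> laplacian_dom Dirichlet" "f $ 2 \<in> laplacian_dom Neumann"
      using resolvent_set_A2DD(3)[OF res, of g] by (simp_all add: Dom_D_iff f_def)
    have e: "shifted (A2D a d) z f = g" unfolding f_def by (rule resolvent_set_A2DD(4)[OF res])
    have e1: "scaleC (of_real a) (- weak_deriv2 (f $ 1)) - scaleC z (f $ 1) = g $ 1"
      using arg_cong[OF e, of "\<lambda>v. v $ 1"] unfolding shifted_A2D .
    have e2: "scaleC (of_real d) (- weak_deriv2 (f $ 2)) - scaleC z (f $ 2) = g $ 2 + weak_deriv2 (f $ 1)"
      using arg_cong[OF e, of "\<lambda>v. v $ 2"] unfolding shifted_A2D by (simp add: algebra_simps)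
    have g: "norm (g $ i) \<le> norm g" for i by (rule Finite_Cartesian_Product.norm_nth_le)
    define Z where "Z = cmod z"
    have Z: "Z > 0" using z by (simp add: Z_def)
    have "\<kappa> * Z * norm (f $ 1) \<le> norm g"
      using laplacian_resolvent_bound[OF f(1) fa] g[of 1] unfolding e1 Z_def by linarith
    then have n1: "Z * norm (f $ 1) \<le> norm g / \<kappa>" using \<kappa> by (simp add: field_simps)
    have "norm (weak_deriv2 (f $ 1)) \<le> (norm g + norm g / \<kappa>) / \<bar>a\<bar>"
      using norm_weak_deriv2_le[OF ad(1), of "f $ 1" z] g[of 1] n1 unfolding e1 Z_def
      by (meson add_mono divide_right_mono abs_ge_zero order_trans)
    then have "norm (g $ 2 + weak_deriv2 (f $ 1)) \<le> norm g + (norm g + norm g / \<kappa>) / \<bar>a\<bar>"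
      using g[of 2] by (intro norm_triangle_le add_mono)
    then have "\<kappa> * Z * norm (f $ 2) \<le> norm g + (norm g + norm g / \<kappa>) / \<bar>a\<bar>"
      using laplacian_resolvent_bound[OF f(2) fd] unfolding e2 Z_def by linarith
    then have n2: "Z * norm (f $ 2) \<le> (norm g + (norm g + norm g / \<kappa>) / \<bar>a\<bar>) / \<kappa>"
      using \<kappa> by (simp add: field_simps)
    have "Z * norm f \<le> Z * norm (f $ 1) + Z * norm (f $ 2)"
      using mult_left_mono[OF norm_vec2_le[of f], of Z] Z by (simp add: algebra_simps)
    also have "\<dots> \<le> norm g / \<kappa> + (norm g + (norm g + norm g / \<kappa>) / \<bar>a\<bar>) / \<kappa>"
      using n1 n2 by linarith
    also have "\<dots> = ((2 + (1 + 1 / \<kappa>) / \<bar>a\<bar>) / \<kappa>) * norm g"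
      using \<kappa> ad by (simp add: field_simps)
    finally have "norm f \<le> ((2 + (1 + 1 / \<kappa>) / \<bar>a\<bar>) / \<kappa>) * norm g / Z"
      using Z by (simp only: pos_le_divide_eq mult.commute)
    then show "norm (resolvent (A2D a d) z g) \<le> ((2 + (1 + 1 / \<kappa>) / \<bar>a\<bar>) / \<kappa>) / cmod z * norm g"
      by (simp only: f_def Z_def times_divide_eq_left)
  qed
qed

text \<open>Each diagonal entry excludes the sector around its own half-line. For equal signs the
  two exclusions coincide, for opposite signs they form a double sector; one constant serves all
  \<open>z\<close>, since \<kappa> depends only on \<epsilon>.\<close>

lemma sector_resolvent_bound:
  assumes ad: "a \<noteq> 0" "d \<noteq> 0" and \<epsilon>: "\<epsilon> > 0"
  shows "\<exists>k>0. \<forall>z. z \<notin> (if a > 0 then sector (- \<epsilon>) \<epsilon> else uminus ` sector (- \<epsilon>) \<epsilon>) \<longrightarrow>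
      z \<notin> (if d > 0 then sector (- \<epsilon>) \<epsilon> else uminus ` sector (- \<epsilon>) \<epsilon>) \<longrightarrow>
      z \<in> resolvent_set (A2D a d) \<and> onorm (resolvent (A2D a d) z) \<le> k / cmod z"
proof -
  define \<kappa> where "\<kappa> = sin (min \<epsilon> (pi / 2))"
  have \<kappa>: "\<kappa> > 0" unfolding \<kappa>_def using \<epsilon> by (intro sin_gt_zero) (auto simp: min_def)
  \<comment> \<open>The origin belongs to both sectors, so every \<open>z\<close> outside them is
    nonzero.\<close>
  have "(0::complex) \<in> sector (- \<epsilon>) \<epsilon>" "(0::complex) \<in> uminus ` sector (- \<epsilon>) \<epsilon>"
    by (auto simp: sector_def image_iff intro!: exI[of _ 0])
  then have nz: "z \<noteq> 0" if "z \<notin> (if a > 0 then sector (- \<epsilon>) \<epsilon> else uminus ` sector (- \<epsilon>) \<epsilon>)" for z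
    using that by (auto split: if_splits)
  show ?thesis
  proof (intro exI[of _ "(2 + (1 + 1 / \<kappa>) / \<bar>a\<bar>) / \<kappa>"] conjI allI impI)
    show "0 < (2 + (1 + 1 / \<kappa>) / \<bar>a\<bar>) / \<kappa>"
      using \<kappa> by (intro divide_pos_pos add_pos_nonneg) auto
    fix z
    assume za: "z \<notin> (if a > 0 then sector (- \<epsilon>) \<epsilon> else uminus ` sector (- \<epsilon>) \<epsilon>)"
      and zd: "z \<notin> (if d > 0 then sector (- \<epsilon>) \<epsilon> else uminus ` sector (- \<epsilon>) \<epsilon>)"
    note * = resolvent_A2D_bound[OF ad \<kappa> nz[OF za]
        sector_distance_scaled[OF \<epsilon> _ za ad(1), folded \<kappa>_def] sector_distance_scaled[OF \<epsilon> _ zd ad(2), folded \<kappa>_def]]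
    show "z \<in> resolvent_set (A2D a d)" using *(1) by blast
    show "onorm (resolvent (A2D a d) z) \<le> ((2 + (1 + 1 / \<kappa>) / \<bar>a\<bar>) / \<kappa>) / cmod z" using *(2) by blast
  qed
qed

text \<open>Subtracting \<pi> from the argument negates the number. The inclusion is used
  contrapositively: a point outside the shifted sector is outside the negated one.\<close>

lemma uminus_sector: "uminus ` sector (- \<epsilon>) \<epsilon> \<subseteq> sector (- pi - \<epsilon>) (- pi + \<epsilon>)"
proof
  fix z assume "z \<in> uminus ` sector (- \<epsilon>) \<epsilon>"
  then obtain w where w: "w \<in> sector (- \<epsilon>) \<epsilon>" "z = - w" by blast
  show "z \<in> sector (- pi - \<epsilon>) (- pi + \<epsilon>)"
  proof (cases "w = 0")
    case False
    then obtain \<theta> where "- \<epsilon> \<le> \<theta>" "\<theta> \<le> \<epsilon>" "w = complex_of_real (cmod w) * cis \<theta>"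
      using w(1) unfolding sector_def by blast
    note \<theta> = this
    have "cis (\<theta> - pi) = - cis \<theta>" by (simp add: complex_eq_iff)
    then have "- w = complex_of_real (cmod (- w)) * cis (\<theta> - pi)"
      using \<theta>(3) by (metis minus_mult_right norm_minus_cancel)
    then show ?thesis
      unfolding sector_def w(2) using \<theta>(1,2) by (intro CollectI disjI2 exI[of _ "\<theta> - pi"] conjI) (linarith | assumption)+
  qed (simp add: sector_def w)
qed

text \<open>Apply the resolvent to \<open>(sin 2\<pi>rx, 0)\<close>. The second component of the result has a coefficient of order \<open>r\<close> along \<open>cos (2r-1)\<pi>x\<close>, because the two eigenvalues differ only by \<open>O(r)\<close> while \<open>D\<close> contributes a factor \<open>4\<pi>\<^sup>2r\<^sup>2\<close>.\<close>

lemma resolvent_A2D_growth: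
  assumes a: "a \<noteq> 0" and \<epsilon>: "\<epsilon> > 0" and r: "r \<ge> 1" and \<sigma>: "\<bar>\<sigma>\<bar> = \<epsilon>"
  defines "z \<equiv> Complex (4 * a * pi\<^sup>2 * (real r)\<^sup>2) \<sigma>"
  defines "Q \<equiv> 4 * \<bar>a\<bar> * pi\<^sup>2 + \<epsilon>"
  shows "z \<in> resolvent_set (A2D a a)"
    "4 * pi * real r / (\<epsilon> * Q) \<le> onorm (resolvent (A2D a a) z)"
    "cmod z \<le> Q * (real r)\<^sup>2"
proof -
  have "Im z \<noteq> 0" using \<sigma> \<epsilon> by (auto simp: z_def)
  then have ne: "z \<noteq> complex_of_real x" for x by auto
  show res: "z \<in> resolvent_set (A2D a a)" by (rule resolvent_set_A2D[OF a a]) (rule ne)+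
  have r1: "1 \<le> (real r)\<^sup>2" using r by simp
  have "cmod z \<le> \<bar>4 * a * pi\<^sup>2 * (real r)\<^sup>2\<bar> + \<bar>\<sigma>\<bar>"
    using cmod_le[of z] by (simp add: z_def)
  also have "\<dots> \<le> 4 * \<bar>a\<bar> * pi\<^sup>2 * (real r)\<^sup>2 + \<epsilon> * (real r)\<^sup>2"
    using r1 \<epsilon> \<sigma> by (simp add: abs_mult)
  finally show "cmod z \<le> Q * (real r)\<^sup>2" by (simp add: Q_def algebra_simps)
  have Q: "Q > 0" using \<epsilon> by (simp add: Q_def add_nonneg_pos)
  \<comment> \<open>\<open>l\<close> is the Dirichlet eigenvalue with a * l = Re z, so that only the
    shift \<sigma> remains in \<mu>. \<open>m\<close> is a neighbouring Neumann eigenvalue; the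
    index 2 r itself would not do, because sin (2 r \<pi> x) and cos (2 r \<pi> x) are
    orthogonal.\<close>
  define l where "l = pi\<^sup>2 * (real (2 * r))\<^sup>2"
  define m where "m = pi\<^sup>2 * (real (2 * r - 1))\<^sup>2"
  define \<mu> where "\<mu> = of_real (a * l) - z"
  have \<mu>: "\<mu> = - \<i> * of_real \<sigma>" by (simp add: \<mu>_def l_def z_def complex_eq_iff)
  have \<mu>0: "\<mu> \<noteq> 0" "cmod \<mu> = \<epsilon>" unfolding \<mu> using \<sigma> \<epsilon> by (auto simp: norm_mult)
  define p where "p = scaleC (1 / \<mu>) (sin_L2 (2 * r))"
  have p: "p \<in> laplacian_dom Dirichlet" "- weak_deriv2 p = scaleC (of_real l) p"
  proof -
    have "0 + scaleC (1 / \<mu>) (sin_L2 (2 * r)) \<in> laplacian_dom Dirichlet"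
      "weak_deriv2 (0 + scaleC (1 / \<mu>) (sin_L2 (2 * r))) = weak_deriv2 0 + scaleC (1 / \<mu>) (weak_deriv2 (sin_L2 (2 * r)))"
      by (intro laplacian_dom_add[where b = Dirichlet] zero_in_laplacian_dom sin_L2_eigen)+
    then show "p \<in> laplacian_dom Dirichlet" "- weak_deriv2 p = scaleC (of_real l) p"
      using sin_L2_eigen(2)[of "2 * r", folded l_def]
      by (simp_all add: p_def zero_in_laplacian_dom scaleC_scaleC mult.commute flip: scaleC_uminus)
  qed
  obtain q where q: "q \<in> laplacian_dom Neumann" "scaleC (of_real a) (- weak_deriv2 q) - scaleC z q = scaleC (- of_real l) p"
    using scaled_laplacian(1)[OF a, of z Neumann] ne by blast
  define f :: "L2^2" where "f = vector [p, q]"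
  define g :: "L2^2" where "g = vector [sin_L2 (2 * r), 0]"
  have f: "f \<in> Dom_D" using p q by (simp add: f_def Dom_D_iff)
  have "shifted (A2D a a) z f = g"
  proof (rule vec2_eqI)
    have "scaleC (of_real a) (scaleC (of_real l) p) - scaleC z p = scaleC \<mu> p"
      by (rule L2_eqI, unfold scaleC_scaleC)
        (use rep_minus_L2[of "scaleC (of_real a * of_real l) p" "scaleC z p"]
          rep_scaleC[of "of_real a * of_real l" p] rep_scaleC[of z p] rep_scaleC[of \<mu> p]
          in \<open>eventually_elim; simp add: \<mu>_def left_diff_distrib\<close>)
    also have "\<dots> = sin_L2 (2 * r)" using \<mu>0 by (simp add: p_def scaleC_scaleC scaleC_one)
    finally show "shifted (A2D a a) z f $ 1 = g $ 1"
      unfolding shifted_A2D by (simp add: f_def g_def p)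
    show "shifted (A2D a a) z f $ 2 = g $ 2"
      unfolding shifted_A2D using q(2) by (simp add: f_def g_def p scaleC_uminus_left algebra_simps)
  qed
  then have Rg: "resolvent (A2D a a) z g = f" using resolvent_set_A2DD(2)[OF res f] by simp
  have "norm q \<le> norm f"
    using Finite_Cartesian_Product.norm_nth_le[of f 2] by (simp add: f_def)
  also have "\<dots> \<le> onorm (resolvent (A2D a a) z) * norm g"
    unfolding Rg[symmetric] by (intro onorm resolvent_set_A2DD(5)[OF res])
  also have "\<dots> \<le> onorm (resolvent (A2D a a) z) * 1"
  proof (intro mult_left_mono onorm_pos_le resolvent_set_A2DD(5)[OF res])
    show "norm g \<le> 1" using norm_vec2_le[of g] norm_trig_L2_le(1)[of "2 * r"] by (simp add: g_def)
  qed
  finally have nq: "norm q \<le> onorm (resolvent (A2D a a) z)" by simp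
  let ?c = "cos_L2 (2 * r - 1)"
  \<comment> \<open>Pairing the second row with the cosine turns the differential operator into the
    number a m - z, so the coefficient of \<open>q\<close> becomes explicit.\<close>
  have eq: "(of_real (a * m) - z) * pairing q ?c = - of_real l / \<mu> * pairing (sin_L2 (2 * r)) ?c"
  proof -
    have "pairing (- weak_deriv2 q) ?c = pairing q (- weak_deriv2 ?c)"
      using laplacian_green[OF q(1) cos_L2_eigen(1)] by (simp add: pairing_uminus_left pairing_uminus_right)
    also have "\<dots> = of_real m * pairing q ?c" unfolding cos_L2_eigen(2) m_def by (rule pairing_scaleC_right)
    finally have "(of_real (a * m) - z) * pairing q ?c = pairing (scaleC (of_real a) (- weak_deriv2 q) - scaleC z q) ?c"
      by (simp add: pairing_minus_left pairing_scaleC_left algebra_simps)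
    then show ?thesis unfolding q(2) by (simp add: pairing_scaleC_left p_def)
  qed
  \<comment> \<open>Since (2 r)^2 - (2 r - 1)^2 = 4 r - 1, the real part of the gap grows only
    linearly; the constant \<open>Q\<close> that bounds |z| by Q r^2 also bounds the gap by Q
    r.\<close>
  have "cmod (of_real (a * m) - z) \<le> Q * real r"
  proof -
    have rr: "real (2 * r - 1) = 2 * real r - 1" using r by (simp add: of_nat_diff)
    have "of_real (a * m) - z = Complex (- (a * pi\<^sup>2 * (4 * real r - 1))) (- \<sigma>)"
      unfolding m_def z_def rr by (simp add: complex_eq_iff power2_eq_square algebra_simps)
    then have "cmod (of_real (a * m) - z) \<le> \<bar>a * pi\<^sup>2 * (4 * real r - 1)\<bar> + \<bar>\<sigma>\<bar>"
      using cmod_le[of "of_real (a * m) - z"] by simp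
    also have "\<bar>a * pi\<^sup>2 * (4 * real r - 1)\<bar> = \<bar>a\<bar> * pi\<^sup>2 * (4 * real r - 1)" using r by (simp add: abs_mult)
    also have "\<dots> \<le> \<bar>a\<bar> * pi\<^sup>2 * (4 * real r)" by (intro mult_left_mono) auto
    also have "\<bar>\<sigma>\<bar> \<le> \<epsilon> * real r" using r \<epsilon> \<sigma> by simp
    finally show ?thesis by (simp add: Q_def algebra_simps)
  qed
  moreover have "cmod (pairing q ?c) \<le> norm q"
    using norm_pairing_le[of q ?c] mult_left_mono[OF norm_trig_L2_le(2)[of "2 * r - 1"] norm_ge_zero[of q]] by linarith
  ultimately have "cmod ((of_real (a * m) - z) * pairing q ?c) \<le> Q * real r * norm q"
    unfolding norm_mult using Q by (intro mult_mono) auto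
  moreover have "cmod (- of_real l / \<mu> * pairing (sin_L2 (2 * r)) ?c) \<ge> l / \<epsilon> * (1 / pi)"
  proof -
    have "1 / pi \<le> \<bar>1 / pi + 1 / ((4 * real r - 1) * pi)\<bar>" using r by simp
    then have "l / \<epsilon> * (1 / pi) \<le> \<bar>l\<bar> / \<epsilon> * \<bar>1 / pi + 1 / ((4 * real r - 1) * pi)\<bar>"
      using \<epsilon> by (intro mult_mono divide_right_mono) auto
    then show ?thesis
      unfolding pairing_sin_cos[OF r] norm_mult norm_divide norm_minus_cancel \<mu>0 norm_of_real .
  qed
  ultimately have "l / \<epsilon> * (1 / pi) \<le> Q * real r * norm q" unfolding eq by linarith
  then have "4 * pi * (real r)\<^sup>2 / \<epsilon> \<le> Q * real r * norm q"
    by (simp add: l_def power2_eq_square mult_ac)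
  then have "4 * pi * real r / (\<epsilon> * Q) \<le> norm q"
    using r \<epsilon> Q by (simp add: field_simps power2_eq_square)
  then show "4 * pi * real r / (\<epsilon> * Q) \<le> onorm (resolvent (A2D a a) z)" using nq by linarith
qed

lemma resolvent_A2D_lower_bound:
  assumes a: "a \<noteq> 0" and \<epsilon>: "\<epsilon> > 0"
  shows "\<exists>k>0. \<forall>r::nat. r \<ge> 1 \<longrightarrow>
    (\<forall>z \<in> {Complex (4 * a * pi\<^sup>2 * (real r)\<^sup>2) \<epsilon>, Complex (4 * a * pi\<^sup>2 * (real r)\<^sup>2) (- \<epsilon>)}.
      z \<in> resolvent_set (A2D a a) \<and> onorm (resolvent (A2D a a) z) \<ge> k * cmod z powr (1/4))"
proof -
  define Q where "Q = 4 * \<bar>a\<bar> * pi\<^sup>2 + \<epsilon>"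
  have Q: "Q > 0" using \<epsilon> by (simp add: Q_def add_nonneg_pos)
  \<comment> \<open>Fixed by the requirement that k * Q powr (1/4) be the constant 4 * pi /
    (\<epsilon> * Q) of the growth bound.\<close>
  define k where "k = 4 * pi / (\<epsilon> * Q * Q powr (1/4))"
  have k: "k > 0" using Q \<epsilon> by (simp add: k_def)
  have main: "z \<in> resolvent_set (A2D a a) \<and> k * cmod z powr (1/4) \<le> onorm (resolvent (A2D a a) z)"
    if r: "r \<ge> 1" and z: "z = Complex (4 * a * pi\<^sup>2 * (real r)\<^sup>2) \<sigma>" and \<sigma>: "\<bar>\<sigma>\<bar> = \<epsilon>" for r z \<sigma>
  proof
    note * = resolvent_A2D_growth[OF a \<epsilon> r \<sigma>, folded z Q_def]
    show "z \<in> resolvent_set (A2D a a)" by (rule *(1))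
    \<comment> \<open>The lower bound of order \<open>r\<close> corresponds to the square root of
      |z|. Weakening r^2 to r^4 brings it to the exponent 1 / 4 that is claimed.\<close>
    have "Q * (real r)\<^sup>2 \<le> Q * real r ^ 4" using r Q by (intro mult_left_mono power_increasing) auto
    with *(3) have "cmod z \<le> Q * real r ^ 4" by linarith
    then have "cmod z powr (1/4) \<le> (Q * real r ^ 4) powr (1/4)" by (intro powr_mono2) auto
    also have "\<dots> = Q powr (1/4) * real r"
    proof -
      have "(real r ^ 4) powr (1/4) = (real r powr 4) powr (1/4)" using r by simp
      also have "\<dots> = real r" unfolding powr_powr using r by simp
      finally show ?thesis using Q by (simp add: powr_mult)
    qed
    finally have "k * cmod z powr (1/4) \<le> k * (Q powr (1/4) * real r)"
      using k by (intro mult_left_mono) auto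
    also have "\<dots> = 4 * pi * real r / (\<epsilon> * Q)" using Q by (simp add: k_def)
    finally show "k * cmod z powr (1/4) \<le> onorm (resolvent (A2D a a) z)" using *(2) by linarith
  qed
  show ?thesis
    by (rule exI[of _ k]) (use k \<epsilon> main[of _ _ \<epsilon>] main[of _ _ "- \<epsilon>"] in auto)
qed

theorem theorem20:
  fixes a d :: real
  defines "K \<equiv> left_mult (A2 a d) D_op"
  shows
    "(a * d = 0 \<longrightarrow> Spec K = UNIV) \<and>
     (a * d \<noteq> 0 \<longrightarrow>
        Spec K = (\<Union>n::nat. {complex_of_real (a * pi\<^sup>2 * (real n)\<^sup>2),
                              complex_of_real (d * pi\<^sup>2 * (real n)\<^sup>2)})) \<and>
     (a * d > 0 \<longrightarrow>
        (\<forall>\<epsilon>>0. \<exists>k>0. \<forall>z. z \<notin> (if a > 0 then sector (- \<epsilon>) \<epsilon> else uminus ` sector (- \<epsilon>) \<epsilon>) \<longrightarrow>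
           z \<in> resolvent_set K \<and> onorm (resolvent K z) \<le> k / cmod z)) \<and>
     (a * d < 0 \<longrightarrow>
        (\<forall>\<epsilon>>0. \<exists>k>0. \<forall>z. z \<notin> sector (- \<epsilon>) \<epsilon> \<union> sector (- pi - \<epsilon>) (- pi + \<epsilon>) \<longrightarrow>
           z \<in> resolvent_set K \<and> onorm (resolvent K z) \<le> k / cmod z)) \<and>
     (a = d \<and> a \<noteq> 0 \<longrightarrow>
        (\<forall>\<epsilon>>0. \<exists>k>0. \<forall>r::nat. r \<ge> 1 \<longrightarrow>
           (\<forall>z \<in> {Complex (4 * a * pi\<^sup>2 * (real r)\<^sup>2) \<epsilon>, Complex (4 * a * pi\<^sup>2 * (real r)\<^sup>2) (- \<epsilon>)}.
              z \<in> resolvent_set K \<and> onorm (resolvent K z) \<ge> k * cmod z powr (1/4))))"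
  unfolding K_def
proof (intro conjI impI allI)
  show "Spec (A2D a d) = UNIV" if "a * d = 0" using that by (rule Spec_A2D_degenerate)
  show "Spec (A2D a d) = (\<Union>n::nat. {complex_of_real (a * pi\<^sup>2 * (real n)\<^sup>2), complex_of_real (d * pi\<^sup>2 * (real n)\<^sup>2)})"
    if "a * d \<noteq> 0" using that by (rule Spec_A2D)
next
  fix \<epsilon> :: real assume ad: "a * d > 0" and \<epsilon>: "\<epsilon> > 0"
  \<comment> \<open>Equal signs merge the two excluded sectors into one.\<close>
  have "a \<noteq> 0" "d \<noteq> 0" "a > 0 \<longleftrightarrow> d > 0" using ad by (auto simp: zero_less_mult_iff)
  then show "\<exists>k>0. \<forall>z. z \<notin> (if a > 0 then sector (- \<epsilon>) \<epsilon> else uminus ` sector (- \<epsilon>) \<epsilon>) \<longrightarrow>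
      z \<in> resolvent_set (A2D a d) \<and> onorm (resolvent (A2D a d) z) \<le> k / cmod z"
    using sector_resolvent_bound[OF _ _ \<epsilon>, of a d] by simp
next
  fix \<epsilon> :: real assume ad: "a * d < 0" and \<epsilon>: "\<epsilon> > 0"
  have ne: "a \<noteq> 0" "d \<noteq> 0" using ad by auto
  obtain k where k: "k > 0" "\<And>z. z \<notin> (if a > 0 then sector (- \<epsilon>) \<epsilon> else uminus ` sector (- \<epsilon>) \<epsilon>) \<Longrightarrow>
      z \<notin> (if d > 0 then sector (- \<epsilon>) \<epsilon> else uminus ` sector (- \<epsilon>) \<epsilon>) \<Longrightarrow>
      z \<in> resolvent_set (A2D a d) \<and> onorm (resolvent (A2D a d) z) \<le> k / cmod z"
    using sector_resolvent_bound[OF ne \<epsilon>] by blast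
  \<comment> \<open>Exactly one of \<open>a\<close> and \<open>d\<close> is positive; either way
    both exclusions follow from avoiding the union.\<close>
  have "z \<in> resolvent_set (A2D a d) \<and> onorm (resolvent (A2D a d) z) \<le> k / cmod z"
    if "z \<notin> sector (- \<epsilon>) \<epsilon> \<union> sector (- pi - \<epsilon>) (- pi + \<epsilon>)" for z
    using that uminus_sector[of \<epsilon>] by (intro k(2)) auto
  then show "\<exists>k>0. \<forall>z. z \<notin> sector (- \<epsilon>) \<epsilon> \<union> sector (- pi - \<epsilon>) (- pi + \<epsilon>) \<longrightarrow>
      z \<in> resolvent_set (A2D a d) \<and> onorm (resolvent (A2D a d) z) \<le> k / cmod z"
    using k(1) by blast
next
  fix \<epsilon> :: real assume "a = d \<and> a \<noteq> 0" and \<epsilon>: "\<epsilon> > 0"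
  then show "\<exists>k>0. \<forall>r::nat. r \<ge> 1 \<longrightarrow>
      (\<forall>z \<in> {Complex (4 * a * pi\<^sup>2 * (real r)\<^sup>2) \<epsilon>, Complex (4 * a * pi\<^sup>2 * (real r)\<^sup>2) (- \<epsilon>)}.
        z \<in> resolvent_set (A2D a d) \<and> onorm (resolvent (A2D a d) z) \<ge> k * cmod z powr (1/4))"
    using resolvent_A2D_lower_bound[of a \<epsilon>] by blast
qed

end
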